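(* Let $m\ge2$ and $\mathfrak g=\mathfrak{spo}(2m|2)$. The Coxeter graph of the Coxeter group $\widehat{\mathscr C}$ for $\mathfrak g$ is the chain $$\widehat r_{\overline m}\overset{4}{-}\widehat r_{\overline{m-1,m}}-\widehat r_{\overline{m-2,m-1}}-\cdots-\widehat r_{\overline{1,2}}\overset{12}{-}\widehat r_{\bar11},$$ where the edge between $\widehat r_{\overline m}$ and $\widehat r_{\overline{m-1,m}}$ is labelled $4$, the edge between $\widehat r_{\overline{1,2}}$ and $\widehat r_{\bar11}$ is labelled $12$, and all other edges are unlabelled.
   Context: The ground field is algebraically closed of characteristic $0$. $\mathfrak h$ is the Cartan subalgebra of diagonal matrices; $\mathfrak h^*$ has basis $\delta_1,\dots,\delta_m,\varepsilon_1$ with bilinear form $(\delta_i,\delta_i)=1$, $(\varepsilon_1,\varepsilon_1)=-1$, other pairings zero. Roots of $\mathfrak{spo}(2m|2)$: even $\pm\delta_i\pm\delta_{i'}$ ($i\neq i'$), $\pm2\delta_i$; odd $\pm\delta_i\pm\varepsilon_1$ (all isotropic). $\mathcal B$ is the (finite) set of Borel subalgebras containing $\mathfrak h$, identified with the set of fundamental (simple root) systems. For an isotropic odd root $\gamma$, the odd reflection $\widehat r_\gamma=\widehat r_{-\gamma}$ is the involution of $\mathcal B$ which sends $\Pi_1\ni\gamma$ to $\{-\gamma\}\cup\{\alpha\in\Pi_1: (\alpha,\gamma)=0,\alpha\ne\gamma\}\cup\{\alpha+\gamma:\alpha\in\Pi_1,(\alpha,\gamma)\neq0\}$, acts on $\Pi_1\ni-\gamma$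 by the same rule with $-\gamma$ in place of $\gamma$, and fixes every fundamental system containing neither $\gamma$ nor $-\gamma$. For an even root $\alpha$, $\widehat r_\alpha$ is the permutation of $\mathcal B$ induced by the ordinary reflection $s_\alpha$. The super Weyl group $\widehat W$ is the group of permutations of $\mathcal B$ generated by all odd and ordinary reflections. $\widetilde\Pi=\Pi=\{\varepsilon_1-\delta_1,\delta_1-\delta_2,\dots,\delta_{m-1}-\delta_m,2\delta_m\}$ and $\mathsf S_{\widetilde\Pi}=\{\widehat r_\theta:\theta\in\widetilde\Pi\}$, with $\widehat r_{\overline m}=\widehat r_{2\delta_m}$, $\widehat r_{\overline{i,i+1}}=\widehat r_{\delta_i-\delta_{i+1}}$, $\widehat r_{\bar11}=\widehat r_{\delta_1-\varepsilon_1}$. The Coxeter group $\widehat{\mathscr C}$ is $\langle x\in\mathsf S_{\widetilde\Pi}\mid (xy)^{m_{xy}}=1\rangle$ where $m_{xy}$ is the order of $xy$ in $\widehat W$. In its Coxeter graph, with vertex set $\mathsf S_{\widetilde\Pi}$, distinct $x,y$ are joined by an edge iff $m_{xy}\ge3$, labelled by $m_{xy}$ if $m_{xy}\ge4$ (no edge means $m_{xy}=2$, an unlabelled edge means $m_{xy}=3$). *)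

theory Defs
  imports
    "HOL-Algebra.Bij"
    "HOL-Algebra.Generated_Groups"
    "HOL-Algebra.Multiplicative_Group"
    "HOL-Computational_Algebra.Polynomial"
    "HOL-Library.Function_Algebras"
begin

section \<open>Weights and roots of spo(2m|2)\<close>

text \<open>
  An element of the dual of the Cartan subalgebra of spo(2m|2) over the ground field 'k is given by
  its coordinates in the basis delta 1, ..., delta m, eps1. Coordinate 0 is the one at eps1;
  the coordinates beyond m are unused and vanish on all roots.
\<close>

type_synonym 'k weight = "nat \<Rightarrow> 'k"

definition delta :: "nat \<Rightarrow> 'k::field weight" where
  "delta i = (\<lambda>j. if j = i then 1 else 0)"

definition eps1 :: "'k::field weight" where
  "eps1 = (\<lambda>j. if j = 0 then 1 else 0)"

definition smul :: "'k \<Rightarrow> 'k weight \<Rightarrow> 'k::field weight" where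
  "smul c v = (\<lambda>j. c * v j)"

definition bform :: "nat \<Rightarrow> 'k weight \<Rightarrow> 'k weight \<Rightarrow> 'k::field" where
  "bform m x y = (\<Sum>i = 1..m. x i * y i) - x 0 * y 0"

definition even_roots :: "nat \<Rightarrow> 'k::field weight set" where
  "even_roots m =
     {smul s (delta i) + smul t (delta j) | s t i j.
        s \<in> {1, -1} \<and> t \<in> {1, -1} \<and> i \<in> {1..m} \<and> j \<in> {1..m} \<and> i \<noteq> j} \<union>
     {smul s (delta i) | s i. s \<in> {2, -2} \<and> i \<in> {1..m}}"

definition odd_roots :: "nat \<Rightarrow> 'k::field weight set" where
  "odd_roots m =
     {smul s (delta i) + smul t eps1 | s t i. s \<in> {1, -1} \<and> t \<in> {1, -1} \<and> i \<in> {1..m}}"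

definition roots :: "nat \<Rightarrow> 'k::field weight set" where
  "roots m = even_roots m \<union> odd_roots m"

definition root_lattice :: "nat \<Rightarrow> 'k::field weight set" where
  "root_lattice m = {v. \<exists>n. v = (\<Sum>\<alpha>\<in>roots m. smul (of_int (n \<alpha>)) \<alpha>)}"

section \<open>Borel subalgebras as fundamental systems\<close>

text \<open>
  A Borel subalgebra containing the Cartan subalgebra is the sum of the Cartan subalgebra and of the
  root spaces of a positive system; a positive system consists of the roots on which a generic
  additive real-valued function on the root lattice is positive. As the ground field need not be
  comparable with the reals, the functional is only required on the lattice. The Borel subalgebra
  is represented by the set of simple roots, i.e. of the positive roots that are not sums of two
  positive roots.
\<close>

definition positive_system :: "nat \<Rightarrow> 'k::field weight set \<Rightarrow> bool" where
  "positive_system m P \<longleftrightarrow>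
     (\<exists>f :: 'k weight \<Rightarrow> real.
        (\<forall>x\<in>root_lattice m. \<forall>y\<in>root_lattice m. f (x + y) = f x + f y) \<and>
        (\<forall>\<alpha>\<in>roots m. f \<alpha> \<noteq> 0) \<and>
        P = {\<alpha> \<in> roots m. f \<alpha> > 0})"

definition simple_roots :: "'k::field weight set \<Rightarrow> 'k weight set" where
  "simple_roots P = {\<alpha> \<in> P. \<not> (\<exists>\<beta>\<in>P. \<exists>\<gamma>\<in>P. \<alpha> = \<beta> + \<gamma>)}"

definition Borels :: "nat \<Rightarrow> 'k::field weight set set" where
  "Borels m = {simple_roots P | P. positive_system m P}"

section \<open>The super Weyl group\<close>

definition reflection :: "nat \<Rightarrow> 'k weight \<Rightarrow> 'k weight \<Rightarrow> 'k::field weight" where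
  "reflection m \<alpha> x = x - smul (2 * bform m x \<alpha> / bform m \<alpha> \<alpha>) \<alpha>"

definition odd_flip :: "nat \<Rightarrow> 'k::field weight \<Rightarrow> 'k weight set \<Rightarrow> 'k weight set" where
  "odd_flip m \<gamma> B =
     {- \<gamma>} \<union> {\<alpha> \<in> B. bform m \<alpha> \<gamma> = 0 \<and> \<alpha> \<noteq> \<gamma>} \<union> {\<alpha> + \<gamma> | \<alpha>. \<alpha> \<in> B \<and> bform m \<alpha> \<gamma> \<noteq> 0}"

text \<open>
  The permutation of the set of Borel subalgebras attached to a root. As in \<^const>\<open>BijGroup\<close>,
  it is an extensional function on that set.
\<close>

type_synonym 'k borel_map = "'k weight set \<Rightarrow> 'k weight set"

definition rhat :: "nat \<Rightarrow> 'k::field weight \<Rightarrow> 'k borel_map" where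
  "rhat m \<theta> = (\<lambda>B\<in>Borels m.
     if \<theta> \<in> even_roots m then reflection m \<theta> ` B
     else if \<theta> \<in> B then odd_flip m \<theta> B
     else if - \<theta> \<in> B then odd_flip m (- \<theta>) B
     else B)"

definition super_Weyl_group :: "nat \<Rightarrow> 'k::field borel_map monoid" where
  "super_Weyl_group m =
     (BijGroup (Borels m)) \<lparr>carrier := generate (BijGroup (Borels m)) (rhat m ` roots m)\<rparr>"

section \<open>The Coxeter group and its graph\<close>

text \<open>
  A Coxeter group is given by its presentation: the set S of generators x and the exponents
  in the relations (x y)^(m x y) = 1.
\<close>

record 'a coxeter_presentation =
  generators :: "'a set"
  exponents :: "'a \<Rightarrow> 'a \<Rightarrow> nat"

definition standard_system :: "nat \<Rightarrow> 'k::field weight set" where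
  "standard_system m =
     {eps1 - delta 1} \<union> {delta i - delta (i + 1) | i. i \<in> {1..<m}} \<union> {smul 2 (delta m)}"

definition super_Coxeter_group :: "nat \<Rightarrow> 'k::field borel_map coxeter_presentation" where
  "super_Coxeter_group m =
     \<lparr>generators = rhat m ` standard_system m,
      exponents = (\<lambda>x y. group.ord (super_Weyl_group m) (x \<otimes>\<^bsub>super_Weyl_group m\<^esub> y))\<rparr>"

text \<open>
  Edges are unordered pairs; an edge not occurring in the first components of the
  relation \<open>labels\<close> is unlabelled.
\<close>

record 'a labelled_graph =
  vertices :: "'a set"
  edges :: "'a set set"
  labels :: "('a set \<times> nat) set"

definition Coxeter_graph :: "'a coxeter_presentation \<Rightarrow> 'a labelled_graph" where
  "Coxeter_graph C =
     \<lparr>vertices = generators C,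
      edges = {{x, y} | x y. x \<in> generators C \<and> y \<in> generators C \<and> x \<noteq> y \<and> exponents C x y \<ge> 3},
      labels = {({x, y}, exponents C x y) | x y.
        x \<in> generators C \<and> y \<in> generators C \<and> x \<noteq> y \<and> exponents C x y \<ge> 4}\<rparr>"

text \<open>
  The chain with successive vertices vs, whose i-th edge (counting from 0) carries the i-th entry of ls;
  the entry 3 stands for an unlabelled edge.
\<close>

definition chain_graph :: "'a list \<Rightarrow> nat list \<Rightarrow> 'a labelled_graph" where
  "chain_graph vs ls =
     \<lparr>vertices = set vs,
      edges = {{vs ! i, vs ! (i + 1)} | i. i + 1 < length vs},
      labels = {({vs ! i, vs ! (i + 1)}, ls ! i) | i. i + 1 < length vs \<and> ls ! i \<noteq> 3}\<rparr>"

definition chain_vertices :: "nat \<Rightarrow> 'k::field borel_map list" where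
  "chain_vertices m =
     rhat m (smul 2 (delta m)) #
     map (\<lambda>i. rhat m (delta i - delta (i + 1))) (rev [1..<m]) @
     [rhat m (delta 1 - eps1)]"

end

theory Submission
  imports Defs
begin

text \<open>
  A Borel subalgebra is determined by its positive system, and a positive system is cut out by real
  values a 1, ..., a m of delta 1, ..., delta m and e of eps1. Only the order of the real
  numbers \<open>\<plusminus>a i\<close> and the place of e among them matter, so a Borel subalgebra is an arrangement
  of 2m symmetric points on the line together with one of the 2m + 1 gaps, the one containing e. On
  such arrangements the even reflections permute the values \<open>\<plusminus>a i\<close> by signed permutations. The odd
  reflection in \<open>eps1 - delta i\<close> moves e across a i if no other point lies between e and a i, and
  does nothing otherwise; that this is what the combinatorial rule on simple roots does is
  \<open>simple_roots_odd_flip\<close> with \<open>flip_positive\<close>, and \<open>rhat_simple_roots\<close> carries the whole action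
  from simple roots to positive systems (\<open>pos_act\<close>). This is legitimate since a positive system can
  be recovered from its simple roots (\<open>simple_roots_inj\<close>).

  With this picture the exponents are read off. Two generators of the chain that are both even act by
  signed permutations, so that the orders 2, 3 and 4 are those of the Weyl group of type C. The odd
  generator r commutes with every even generator fixing its root. The remaining pair is r and the
  reflection s in \<open>delta 1 - delta 2\<close>. The square of r s is the product of r with the conjugate
  r' = s r s, the odd reflection in \<open>eps1 - delta 2\<close>. Applying r and r' repeatedly moves e across
  a 1 and a 2 only, hence changes the signs of \<open>eps1 - delta 1\<close> and \<open>eps1 - delta 2\<close> only. One of the
  four sign patterns contradicts the fixed sign of \<open>delta 1 - delta 2\<close>, so an orbit of r r' has at
  most three elements and (r r')^6 = 1 (\<open>two_odd_reflections_order\<close>). If a 1 and a 2 are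
  neighbours, an orbit of length 3 occurs (\<open>odd_pair_pow_2\<close>); if another point separates them, one of
  length 2 occurs (\<open>odd_pair_pow_3\<close>). So r r' has order 6, and r s, whose order divides 12 and divides
  neither 4 nor 6, has order 12.
\<close>

section \<open>Roots as pairs of signed unit weights\<close>

text \<open>
  The weights \<open>\<plusminus>eps1\<close>, \<open>\<plusminus>delta i\<close>, indexed by the nonzero integers p with \<open>\<bar>p\<bar> \<le> m + 1\<close>: the
  integers \<open>\<plusminus>1\<close> stand for \<open>\<plusminus>eps1\<close> and \<open>\<plusminus>(i + 1)\<close> for \<open>\<plusminus>delta i\<close>. The shift by one is needed because 0
  has no sign; in return, negating a weight is negating an integer.
\<close>

definition unit_weight :: "int \<Rightarrow> 'k::field weight" where
  "unit_weight p = smul (of_int (sgn p)) (delta (nat (\<bar>p\<bar> - 1)))"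

text \<open>
  Every root, including \<open>\<plusminus>2 delta i\<close> and the odd ones, is a sum of two signed unit weights. The
  decomposition is unique up to order, so that root arithmetic turns into case distinctions about
  integers.
\<close>

definition root_of :: "int \<Rightarrow> int \<Rightarrow> 'k::field weight" where
  "root_of p q = unit_weight p + unit_weight q"

definition points :: "nat \<Rightarrow> int set" where
  "points m = {p. 1 \<le> \<bar>p\<bar> \<and> \<bar>p\<bar> \<le> int m + 1}"

text \<open>
  The excluded pairs are those with sum 0 or \<open>\<plusminus>2 eps1\<close>.
\<close>

definition root_pair :: "nat \<Rightarrow> int \<Rightarrow> int \<Rightarrow> bool" where
  "root_pair m p q \<longleftrightarrow> p \<in> points m \<and> q \<in> points m \<and> p \<noteq> - q \<and> \<not> (\<bar>p\<bar> = 1 \<and> \<bar>q\<bar> = 1)"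

text \<open>
  The coefficient of the unit weight of x in the unit weight of y, as an integer. Counting with
  integer coefficients avoids all reasoning about the ground field.
\<close>

definition coord :: "int \<Rightarrow> int \<Rightarrow> int" where
  "coord x y = (if y = x then 1 else if y = - x then - 1 else 0)"

lemma unit_weight_minus [simp]: "unit_weight (- p) = - unit_weight p"
  by (auto simp: unit_weight_def smul_def sgn_if fun_eq_iff)

lemma root_of_minus: "root_of (- p) (- q) = - root_of p q"
  by (simp add: root_of_def)

lemma root_of_commute: "root_of p q = root_of q p"
  by (simp add: root_of_def add.commute)

lemma unit_weight_coord:
  assumes "x \<noteq> 0" "y \<noteq> 0"
  shows "of_int (sgn x) * unit_weight y (nat (\<bar>x\<bar> - 1)) = of_int (coord x y)"
proof (cases "\<bar>x\<bar> = \<bar>y\<bar>")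
  case True
  hence "y = x \<or> y = - x" by linarith
  thus ?thesis using assms
    by (auto simp: unit_weight_def smul_def delta_def coord_def simp flip: of_int_mult of_int_minus)
next
  case False
  hence "nat (\<bar>x\<bar> - 1) \<noteq> nat (\<bar>y\<bar> - 1)" using assms by linarith
  moreover have "y \<noteq> x" "y \<noteq> - x" using False by auto
  ultimately show ?thesis by (simp add: unit_weight_def smul_def delta_def coord_def)
qed

lemma root_pair_sym: "root_pair m p q \<longleftrightarrow> root_pair m q p"
  by (auto simp: root_pair_def)

lemma root_pairD:
  assumes "root_pair m p q"
  shows "p \<noteq> 0" "q \<noteq> 0" "p \<noteq> - q" "\<bar>p\<bar> \<le> int m + 1" "\<bar>q\<bar> \<le> int m + 1"
    "\<bar>p\<bar> = 1 \<Longrightarrow> 2 \<le> \<bar>q\<bar>" "\<bar>q\<bar> = 1 \<Longrightarrow> 2 \<le> \<bar>p\<bar>"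
  using assms by (auto simp: root_pair_def points_def)

lemma root_pairI:
  assumes "p \<noteq> 0" "q \<noteq> 0" "p \<noteq> - q" "\<bar>p\<bar> \<le> int m + 1" "\<bar>q\<bar> \<le> int m + 1" "2 \<le> \<bar>p\<bar> \<or> 2 \<le> \<bar>q\<bar>"
  shows "root_pair m p q"
proof -
  have "1 \<le> \<bar>p\<bar>" "1 \<le> \<bar>q\<bar>" using assms(1,2) by linarith+
  thus ?thesis using assms(3-) unfolding root_pair_def points_def by auto
qed

lemma of_int_sgn_cases: "p \<noteq> 0 \<Longrightarrow> of_int (sgn p) \<in> {1, - 1 :: 'a::field}"
  by (cases "p > 0") auto

lemma root_pair_minus [simp]: "root_pair m (- p) (- q) \<longleftrightarrow> root_pair m p q"
  by (auto simp: root_pair_def points_def)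

text \<open>
  Characteristic 0 enters here: an equality of weights is an equality of integer coefficients.
\<close>

lemma root_of_eq_coord:
  assumes "root_of p q = (root_of u v :: 'k::field_char_0 weight)"
  assumes "p \<noteq> 0" "q \<noteq> 0" "u \<noteq> 0" "v \<noteq> 0" "x \<noteq> 0"
  shows "coord x p + coord x q = coord x u + coord x v"
proof -
  have "of_int (sgn x) * (root_of p q :: 'k weight) (nat (\<bar>x\<bar> - 1)) = of_int (sgn x) * root_of u v (nat (\<bar>x\<bar> - 1))"
    using assms(1) by simp
  hence "(of_int (coord x p + coord x q) :: 'k) = of_int (coord x u + coord x v)"
    using assms(2-) by (simp add: root_of_def algebra_simps unit_weight_coord)
  thus ?thesis by (simp only: of_int_eq_iff)
qed

lemma root_of_sum_eq_coord:
  assumes "root_of a b + root_of c d = (root_of u v :: 'k::field_char_0 weight)"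
  assumes "a \<noteq> 0" "b \<noteq> 0" "c \<noteq> 0" "d \<noteq> 0" "u \<noteq> 0" "v \<noteq> 0" "x \<noteq> 0"
  shows "coord x a + coord x b + coord x c + coord x d = coord x u + coord x v"
proof -
  have "of_int (sgn x) * (root_of a b + root_of c d :: 'k weight) (nat (\<bar>x\<bar> - 1)) = of_int (sgn x) * root_of u v (nat (\<bar>x\<bar> - 1))"
    using assms(1) by simp
  hence "(of_int (coord x a + coord x b + coord x c + coord x d) :: 'k) = of_int (coord x u + coord x v)"
    using assms(2-) by (simp add: root_of_def algebra_simps unit_weight_coord)
  thus ?thesis by (simp only: of_int_eq_iff)
qed

lemma coord_pos_iff: "coord x y > 0 \<longleftrightarrow> y = x"
  by (auto simp: coord_def)

lemma coord_nonneg: "y \<noteq> - x \<Longrightarrow> coord x y \<ge> 0"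
  by (auto simp: coord_def)

lemma coord_self [simp]: "coord x x = 1"
  by (simp add: coord_def)

lemma root_of_eq_imp:
  assumes "(root_of p q :: 'k::field_char_0 weight) = root_of u v"
    and nz: "p \<noteq> 0" "q \<noteq> 0" "u \<noteq> 0" "v \<noteq> 0" "u \<noteq> - v"
  shows "p = u \<and> q = v \<or> p = v \<and> q = u"
proof -
  note C = root_of_eq_coord [OF assms(1-5)]
  have u: "u = p \<or> u = q"
    using C[OF nz(3)] coord_nonneg[of v u] coord_pos_iff[of u p] coord_pos_iff[of u q] nz(5)
      coord_self[of u] by linarith
  have v: "v = p \<or> v = q"
    using C[OF nz(4)] coord_nonneg[of u v] coord_pos_iff[of v p] coord_pos_iff[of v q] nz(5)
      coord_self[of v] by linarith
  show ?thesis
  proof (cases "u = v")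
    case True
    hence "coord u p + coord u q = 2" using C[OF nz(3)] by simp
    hence "p = u \<and> q = u" by (auto simp: coord_def split: if_splits)
    thus ?thesis using True by simp
  next
    case False
    thus ?thesis using u v by auto
  qed
qed

lemma root_of_eq_iff:
  assumes "root_pair m p q" "root_pair m u v"
  shows "(root_of p q :: 'k::field_char_0 weight) = root_of u v \<longleftrightarrow> p = u \<and> q = v \<or> p = v \<and> q = u"
proof
  have "p \<noteq> 0" "q \<noteq> 0" "u \<noteq> 0" "v \<noteq> 0" "u \<noteq> - v"
    by (rule root_pairD[OF assms(1)] root_pairD[OF assms(2)])+
  thus "p = u \<and> q = v \<or> p = v \<and> q = u" if "(root_of p q :: 'k weight) = root_of u v"
    using root_of_eq_imp[OF that] by blast
qed (auto simp: root_of_commute)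

text \<open>
  If nothing cancelled, the left side would have four units in its coordinates, the right side has
  only two.
\<close>

lemma root_of_sum_cancel:
  assumes "root_of a b + root_of c d = (root_of u v :: 'k::field_char_0 weight)"
    and "root_pair m a b" "root_pair m c d" "root_pair m u v"
  shows "c = - a \<or> c = - b \<or> d = - a \<or> d = - b"
proof (rule ccontr)
  assume n: "\<not> ?thesis"
  have nz: "a \<noteq> 0" "b \<noteq> 0" "c \<noteq> 0" "d \<noteq> 0" "u \<noteq> 0" "v \<noteq> 0" "a \<noteq> - b" "c \<noteq> - d" "u \<noteq> - v"
    by (rule root_pairD[OF assms(2)] root_pairD[OF assms(3)] root_pairD[OF assms(4)])+
  note C = root_of_sum_eq_coord [OF assms(1) nz(1-6)]
  have sums: "a + b \<noteq> 0" "c + a \<noteq> 0" "d + a \<noteq> 0" "c + b \<noteq> 0" "d + b \<noteq> 0" "c + d \<noteq> 0"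
    using n nz(7,8) unfolding eq_neg_iff_add_eq_0 by blast+
  have S: "y \<noteq> - x" if "x \<in> {a, b, c, d}" "y \<in> {a, b, c, d}" for x y
  proof -
    have "x + y \<noteq> 0" using that sums nz(1-4) by (elim insertE emptyE; simp add: add.commute)
    thus ?thesis by linarith
  qed
  have uv: "x = u \<or> x = v" if x: "x \<in> {a, b, c, d}" for x
  proof -
    have "x \<noteq> 0" using x nz(1-4) by blast
    have "coord x y \<ge> 0" if "y \<in> {a, b, c, d}" for y
      using coord_nonneg S[OF x that] .
    hence "coord x a \<ge> 0" "coord x b \<ge> 0" "coord x c \<ge> 0" "coord x d \<ge> 0" by blast+
    moreover have "coord x a > 0 \<or> coord x b > 0 \<or> coord x c > 0 \<or> coord x d > 0"
      using x unfolding coord_pos_iff by blast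
    ultimately have "coord x u > 0 \<or> coord x v > 0" using C[OF \<open>x \<noteq> 0\<close>] by linarith
    thus ?thesis unfolding coord_pos_iff by blast
  qed
  have "coord u u = 1" "coord v v = 1" by simp_all
  show False
  proof (cases "u = v")
    case True
    hence "a = u" "b = u" "c = u" "d = u" using uv[of a] uv[of b] uv[of c] uv[of d] by blast+
    thus False using C[OF nz(5)] True by simp
  next
    case False
    hence "coord u v = 0" "coord v u = 0" using nz(9) by (auto simp: coord_def)
    hence one: "coord u x + coord v x = 1" if "x \<in> {a, b, c, d}" for x
      using uv[OF that] by auto
    show False
      using C[OF nz(5)] C[OF nz(6)] one[of a] one[of b] one[of c] one[of d]
        \<open>coord u v = 0\<close> \<open>coord v u = 0\<close> by simp
  qed
qed

lemma even_roots_eq: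
  "even_roots m = {root_of p q | p q. root_pair m p q \<and> 2 \<le> \<bar>p\<bar> \<and> 2 \<le> \<bar>q\<bar>}"
proof (intro equalityI subsetI)
  fix \<alpha> :: "'a weight"
  assume "\<alpha> \<in> even_roots m"
  then consider s t i j where "\<alpha> = smul s (delta i) + smul t (delta j)" "s \<in> {1, -1}" "t \<in> {1, -1}"
      "i \<in> {1..m}" "j \<in> {1..m}" "i \<noteq> j"
    | s i where "\<alpha> = smul s (delta i)" "s \<in> {2, -2}" "i \<in> {1..m}"
    unfolding even_roots_def by blast
  thus "\<alpha> \<in> {root_of p q | p q. root_pair m p q \<and> 2 \<le> \<bar>p\<bar> \<and> 2 \<le> \<bar>q\<bar>}"
  proof cases
    case 1
    define p where "p = (if s = 1 then int i + 1 else - int i - 1)"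
    define q where "q = (if t = 1 then int j + 1 else - int j - 1)"
    have "\<alpha> = root_of p q" using 1(1-3)
      by (auto simp: root_of_def unit_weight_def p_def q_def smul_def fun_eq_iff delta_def)
    moreover have "root_pair m p q \<and> 2 \<le> \<bar>p\<bar> \<and> 2 \<le> \<bar>q\<bar>"
      using 1(4-6) by (auto simp: root_pair_def points_def p_def q_def)
    ultimately show ?thesis by blast
  next
    case 2
    define p where "p = (if s = 2 then int i + 1 else - int i - 1)"
    have "\<alpha> = root_of p p" using 2
      by (auto simp: root_of_def unit_weight_def p_def smul_def fun_eq_iff delta_def)
    moreover have "root_pair m p p \<and> 2 \<le> \<bar>p\<bar> \<and> 2 \<le> \<bar>p\<bar>"
      using 2 by (auto simp: root_pair_def points_def p_def)
    ultimately show ?thesis by blast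
  qed
next
  fix \<alpha> :: "'a weight"
  assume "\<alpha> \<in> {root_of p q | p q. root_pair m p q \<and> 2 \<le> \<bar>p\<bar> \<and> 2 \<le> \<bar>q\<bar>}"
  then obtain p q where \<alpha>: "\<alpha> = root_of p q" and pq: "root_pair m p q" "2 \<le> \<bar>p\<bar>" "2 \<le> \<bar>q\<bar>" by blast
  have ran: "nat (\<bar>p\<bar> - 1) \<in> {1..m}" "nat (\<bar>q\<bar> - 1) \<in> {1..m}"
    using pq by (auto simp: root_pair_def points_def)
  show "\<alpha> \<in> even_roots m"
  proof (cases "p = q")
    case True
    hence "\<alpha> = smul (2 * of_int (sgn p)) (delta (nat (\<bar>p\<bar> - 1)))"
      by (simp add: \<alpha> root_of_def unit_weight_def smul_def fun_eq_iff)
    moreover have "2 * of_int (sgn p) \<in> {2, - 2 :: 'a}"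
      using of_int_sgn_cases[of p, where 'a='a] root_pairD(1)[OF pq(1)] by auto
    ultimately show ?thesis unfolding even_roots_def using ran(1)
      by (intro UnI2 CollectI exI conjI)
  next
    case False
    have "\<bar>p\<bar> \<noteq> \<bar>q\<bar>" using False root_pairD(3)[OF pq(1)] by linarith
    hence "nat (\<bar>p\<bar> - 1) \<noteq> nat (\<bar>q\<bar> - 1)" using pq(2,3) by linarith
    moreover have "of_int (sgn p) \<in> {1, - 1 :: 'a}" "of_int (sgn q) \<in> {1, - 1 :: 'a}"
      by (rule of_int_sgn_cases[OF root_pairD(1)[OF pq(1)]] of_int_sgn_cases[OF root_pairD(2)[OF pq(1)]])+
    ultimately show ?thesis unfolding even_roots_def \<alpha> root_of_def unit_weight_def using ran
      by (intro UnI1 CollectI exI conjI) (rule refl | assumption)+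
  qed
qed

lemma odd_roots_eq:
  "odd_roots m = {root_of g h | g h. root_pair m g h \<and> \<bar>g\<bar> = 1}"
proof (intro equalityI subsetI)
  fix \<alpha> :: "'a weight"
  assume "\<alpha> \<in> odd_roots m"
  then obtain s t i where 1: "\<alpha> = smul s (delta i) + smul t eps1" "s \<in> {1, -1}" "t \<in> {1, -1}" "i \<in> {1..m}"
    unfolding odd_roots_def by blast
  define p where "p = (if s = 1 then int i + 1 else - int i - 1)"
  define q :: int where "q = (if t = 1 then 1 else - 1)"
  have "\<alpha> = root_of q p" using 1(1-3)
    by (auto simp: root_of_def unit_weight_def p_def q_def smul_def fun_eq_iff delta_def eps1_def)
  moreover have "root_pair m q p \<and> \<bar>q\<bar> = 1"
    using 1(4) by (auto simp: root_pair_def points_def p_def q_def)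
  ultimately show "\<alpha> \<in> {root_of g h | g h. root_pair m g h \<and> \<bar>g\<bar> = 1}" by blast
next
  fix \<alpha> :: "'a weight"
  assume "\<alpha> \<in> {root_of g h | g h. root_pair m g h \<and> \<bar>g\<bar> = 1}"
  then obtain p q where \<alpha>: "\<alpha> = root_of p q" and pq: "root_pair m p q" "\<bar>p\<bar> = 1" by blast
  have ran: "nat (\<bar>q\<bar> - 1) \<in> {1..m}" using pq by (auto simp: root_pair_def points_def)
  have "\<alpha> = smul (of_int (sgn q)) (delta (nat (\<bar>q\<bar> - 1))) + smul (of_int (sgn p)) eps1"
    using pq(2) by (simp add: \<alpha> root_of_def unit_weight_def eps1_def delta_def add.commute)
  moreover have "of_int (sgn p) \<in> {1, - 1 :: 'a}" "of_int (sgn q) \<in> {1, - 1 :: 'a}"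
    by (rule of_int_sgn_cases[OF root_pairD(1)[OF pq(1)]] of_int_sgn_cases[OF root_pairD(2)[OF pq(1)]])+
  ultimately show "\<alpha> \<in> odd_roots m" unfolding odd_roots_def using ran
    by (intro CollectI exI conjI)
qed

lemma roots_eq: "roots m = {root_of p q | p q. root_pair m p q}"
proof (intro equalityI subsetI)
  fix \<alpha> :: "'a weight"
  assume "\<alpha> \<in> {root_of p q | p q. root_pair m p q}"
  then obtain p q where \<alpha>: "\<alpha> = root_of p q" "root_pair m p q" by blast
  consider "2 \<le> \<bar>p\<bar>" "2 \<le> \<bar>q\<bar>" | "\<bar>p\<bar> = 1" | "\<bar>q\<bar> = 1"
    using \<alpha>(2) unfolding root_pair_def points_def by force
  thus "\<alpha> \<in> roots m"
  proof cases
    case 1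
    thus ?thesis unfolding roots_def even_roots_eq using \<alpha> by blast
  next
    case 2
    thus ?thesis unfolding roots_def odd_roots_eq using \<alpha> by blast
  next
    case 3
    moreover have "root_pair m q p" using \<alpha>(2) root_pair_sym by blast
    ultimately show ?thesis unfolding roots_def odd_roots_eq using \<alpha>(1) root_of_commute by blast
  qed
qed (auto simp: roots_def even_roots_eq odd_roots_eq)

lemma root_of_in_roots: "root_pair m p q \<Longrightarrow> root_of p q \<in> roots m"
  unfolding roots_eq by blast

lemma even_odd_disjoint: "even_roots m \<inter> odd_roots m = ({} :: 'k::field_char_0 weight set)"
proof -
  { fix \<alpha> :: "'k weight"
    assume "\<alpha> \<in> even_roots m" "\<alpha> \<in> odd_roots m"
    then obtain p q g h where *: "\<alpha> = root_of p q" "root_pair m p q" "2 \<le> \<bar>p\<bar>" "2 \<le> \<bar>q\<bar>"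
      "\<alpha> = root_of g h" "root_pair m g h" "\<bar>g\<bar> = 1"
      unfolding even_roots_eq odd_roots_eq by blast
    hence False using root_of_eq_iff[OF *(2,6), where 'k='k] by auto }
  thus ?thesis by blast
qed

text \<open>
  The normal form in which all sums of two roots are treated below: a common unit weight cancels,
  as with elementary matrices.
\<close>

lemma sum_of_roots:
  assumes "\<beta> \<in> roots m" "\<delta> \<in> roots m" "\<beta> + \<delta> \<in> (roots m :: 'k::field_char_0 weight set)"
  obtains p r q where "\<beta> = root_of p r" "\<delta> = root_of (- r) q" "\<beta> + \<delta> = root_of p q"
    "root_pair m p r" "root_pair m (- r) q" "root_pair m p q"
proof -
  obtain a b c d u v where *: "\<beta> = root_of a b" "root_pair m a b" "\<delta> = root_of c d" "root_pair m c d"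
    "\<beta> + \<delta> = root_of u v" "root_pair m u v"
    using assms unfolding roots_eq by blast
  have "\<exists>p r q. \<beta> = root_of p r \<and> \<delta> = root_of (- r) q \<and> root_pair m p r \<and> root_pair m (- r) q"
    using root_of_sum_cancel[of a b c d u v m, where 'k='k] * root_pair_sym root_of_commute
    by (metis minus_minus)
  then obtain p r q where 1: "\<beta> = root_of p r" "\<delta> = root_of (- r) q" "root_pair m p r" "root_pair m (- r) q" by blast
  have 2: "\<beta> + \<delta> = root_of p q" by (simp add: 1 root_of_def)
  have nz: "p \<noteq> 0" "q \<noteq> 0" "u \<noteq> 0" "v \<noteq> 0" "u \<noteq> - v"
    by (rule root_pairD[OF 1(3)] root_pairD[OF 1(4)] root_pairD[OF *(6)])+
  have "(root_of p q :: 'k weight) = root_of u v" using 2 * by simp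
  hence "p = u \<and> q = v \<or> p = v \<and> q = u" using root_of_eq_imp nz by blast
  hence "root_pair m p q" using *(6) root_pair_sym by blast
  thus thesis using that 1 2 by blast
qed

section \<open>Positive systems and functionals\<close>

text \<open>
  The positive roots of a functional, given by its real values c on the signed unit weights. Such
  values come from a functional if c is odd, and from one without zeros on the roots if c is
  \<open>generic\<close>.
\<close>

definition pos_roots :: "nat \<Rightarrow> (int \<Rightarrow> real) \<Rightarrow> 'k::field weight set" where
  "pos_roots m c = {root_of p q | p q. root_pair m p q \<and> c p + c q > 0}"

definition generic :: "nat \<Rightarrow> (int \<Rightarrow> real) \<Rightarrow> bool" where
  "generic m c \<longleftrightarrow> (\<forall>x. c (- x) = - c x) \<and> (\<forall>p q. root_pair m p q \<longrightarrow> c p + c q \<noteq> 0)"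

lemma genericD:
  assumes "generic m c"
  shows "c (- x) = - c x" "root_pair m p q \<Longrightarrow> c p + c q \<noteq> 0"
  using assms unfolding generic_def by blast+

lemma finite_roots: "finite (roots m)"
proof -
  have fin: "finite (points m)"
    by (rule finite_subset[of _ "{- int m - 1..int m + 1}"]) (auto simp: points_def)
  have "roots m \<subseteq> (\<lambda>(p, q). root_of p q) ` (points m \<times> points m)"
    unfolding roots_eq root_pair_def by auto
  thus ?thesis using fin finite_subset by blast
qed

lemma root_lattice_add:
  assumes "x \<in> root_lattice m" "y \<in> root_lattice m"
  shows "x + y \<in> root_lattice m"
proof -
  obtain n n' where *: "x = (\<Sum>\<alpha>\<in>roots m. smul (of_int (n \<alpha>)) \<alpha>)" "y = (\<Sum>\<alpha>\<in>roots m. smul (of_int (n' \<alpha>)) \<alpha>)"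
    using assms unfolding root_lattice_def by blast
  have "x + y = (\<Sum>\<alpha>\<in>roots m. smul (of_int (n \<alpha> + n' \<alpha>)) \<alpha>)"
    unfolding * sum.distrib[symmetric]
    by (intro sum.cong refl) (simp add: smul_def fun_eq_iff algebra_simps)
  thus ?thesis unfolding root_lattice_def by (intro CollectI exI[of _ "\<lambda>\<alpha>. n \<alpha> + n' \<alpha>"])
qed

lemma roots_subset_lattice: "roots m \<subseteq> root_lattice m"
proof
  fix \<alpha> :: "'a weight" assume \<alpha>: "\<alpha> \<in> roots m"
  have "(\<Sum>\<beta>\<in>roots m. smul (of_int (if \<beta> = \<alpha> then 1 else 0)) \<beta>) = (\<Sum>\<beta>\<in>roots m. if \<beta> = \<alpha> then \<alpha> else 0)"
    by (intro sum.cong refl) (auto simp: smul_def fun_eq_iff)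
  also have "\<dots> = \<alpha>" using \<alpha> by (simp add: finite_roots)
  finally show "\<alpha> \<in> root_lattice m" unfolding root_lattice_def
    by (intro CollectI exI[of _ "\<lambda>\<beta>. if \<beta> = \<alpha> then 1 else 0"]) simp
qed

text \<open>
  The lattice contains \<open>2 eps1\<close> although it is not a root. It does not contain \<open>eps1\<close> itself, which
  is why the values of a functional on unit weights are obtained below by halving.
\<close>

lemma double_unit_weight_in_lattice:
  assumes "m \<ge> 1" "x \<in> points m"
  shows "(root_of x x :: 'k::field weight) \<in> root_lattice m"
proof (cases "\<bar>x\<bar> = 1")
  case True
  have "root_pair m x 2" "root_pair m x (- 2)"
    using True assms(1) by (auto intro!: root_pairI)
  hence "(root_of x 2 + root_of x (- 2) :: 'k weight) \<in> root_lattice m"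
    using roots_subset_lattice root_of_in_roots by (intro root_lattice_add) blast+
  moreover have "root_of x 2 + root_of x (- 2) = (root_of x x :: 'k weight)" by (simp add: root_of_def)
  ultimately show ?thesis by simp
next
  case False
  hence "root_pair m x x" using assms(2) by (auto simp: root_pair_def points_def)
  thus ?thesis using roots_subset_lattice root_of_in_roots by blast
qed

text \<open>
  Left inverse of the embedding of the integers; only its values on integers matter.
\<close>

definition int_part :: "'k::field_char_0 \<Rightarrow> int" where
  "int_part = the_inv of_int"

lemma int_part_of_int [simp]: "int_part (of_int n) = n"
  unfolding int_part_def by (rule the_inv_f_f) (simp add: inj_def)

lemma int_part_0_1 [simp]: "int_part 0 = 0" "int_part 1 = 1"
  using int_part_of_int[of 0] int_part_of_int[of 1] by simp_all

lemma int_part_add: "x \<in> \<int> \<Longrightarrow> y \<in> \<int> \<Longrightarrow> int_part (x + y) = int_part x + int_part y"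
  by (auto elim!: Ints_cases simp flip: of_int_add)

lemma unit_weight_apply: "x \<noteq> 0 \<Longrightarrow> unit_weight x i = (if i = nat (\<bar>x\<bar> - 1) then of_int (sgn x) else 0)"
  by (simp add: unit_weight_def smul_def delta_def)

lemma unit_weight_Ints: "unit_weight x i \<in> \<int>"
  by (simp add: unit_weight_def smul_def delta_def)

lemma root_lattice_Ints:
  assumes "v \<in> root_lattice m"
  shows "v i \<in> \<int>"
proof -
  obtain n where "v = (\<Sum>\<alpha>\<in>roots m. smul (of_int (n \<alpha>)) \<alpha>)"
    using assms unfolding root_lattice_def by blast
  moreover have "(\<Sum>\<alpha>\<in>A. smul (of_int (n \<alpha>)) \<alpha>) i = (\<Sum>\<alpha>\<in>A. of_int (n \<alpha>) * \<alpha> i)" for A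
    by (induction A rule: infinite_finite_induct) (auto simp: smul_def)
  moreover have "\<alpha> i \<in> \<int>" if "\<alpha> \<in> roots m" for \<alpha> :: "'a weight"
    using that unfolding roots_eq root_of_def by (auto intro!: Ints_add unit_weight_Ints)
  ultimately show ?thesis by (auto intro!: Ints_sum Ints_mult)
qed

lemma positive_system_pos_roots:
  assumes "generic m c"
  shows "positive_system m (pos_roots m c :: 'k::field_char_0 weight set)"
proof -
  \<comment> \<open>Coordinate i belongs to the index i + 1.\<close>
  define f :: "'k weight \<Rightarrow> real" where "f = (\<lambda>v. \<Sum>i\<le>m. c (int i + 1) * of_int (int_part (v i)))"
  have add: "f (x + y) = f x + f y" if "\<And>i. x i \<in> \<int>" "\<And>i. y i \<in> \<int>" for x y
    using that by (simp add: f_def int_part_add algebra_simps sum.distrib)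
  have unit_weight: "f (unit_weight x) = c x" if "x \<in> points m" for x
  proof -
    have x: "x \<noteq> 0" "nat (\<bar>x\<bar> - 1) \<le> m" using that by (auto simp: points_def)
    have "f (unit_weight x) = (\<Sum>i\<le>m. if i = nat (\<bar>x\<bar> - 1) then c (int i + 1) * of_int (sgn x) else 0)"
      unfolding f_def by (intro sum.cong refl) (auto simp: unit_weight_apply[OF x(1)])
    also have "\<dots> = c \<bar>x\<bar> * of_int (sgn x)" using x by simp
    also have "\<dots> = c x" using x(1) genericD(1)[OF assms, of x] by (cases "x > 0") auto
    finally show ?thesis .
  qed
  have f_root_of: "f (root_of p q) = c p + c q" if "root_pair m p q" for p q
    using that unfolding root_of_def root_pair_def by (subst add) (auto simp: unit_weight_Ints unit_weight)
  show ?thesis unfolding positive_system_def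
  proof (intro exI[of _ f] conjI ballI)
    fix x y :: "'k weight" assume "x \<in> root_lattice m" "y \<in> root_lattice m"
    thus "f (x + y) = f x + f y" using add root_lattice_Ints by blast
  next
    fix \<alpha> :: "'k weight" assume "\<alpha> \<in> roots m"
    thus "f \<alpha> \<noteq> 0" using f_root_of genericD(2)[OF assms] unfolding roots_eq by force
  next
    show "pos_roots m c = {\<alpha> \<in> roots m. 0 < f \<alpha>}"
      unfolding pos_roots_def roots_eq using f_root_of by fastforce
  qed
qed

lemma positive_systemE:
  assumes "positive_system m (P :: 'k::field_char_0 weight set)" "m \<ge> 1"
  obtains c where "generic m c" "P = pos_roots m c"
proof -
  obtain f :: "'k weight \<Rightarrow> real" where
    add: "\<And>x y. x \<in> root_lattice m \<Longrightarrow> y \<in> root_lattice m \<Longrightarrow> f (x + y) = f x + f y"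
    and nz: "\<And>\<alpha>. \<alpha> \<in> roots m \<Longrightarrow> f \<alpha> \<noteq> 0" and P: "P = {\<alpha> \<in> roots m. f \<alpha> > 0}"
    using assms(1) unfolding positive_system_def by blast
  define c where "c = (\<lambda>x. if x \<in> points m then f (root_of x x) / 2 else 0)"
  have dbl: "(root_of x x :: 'k weight) \<in> root_lattice m" if "x \<in> points m" for x
    by (rule double_unit_weight_in_lattice[OF assms(2) that])
  have f_root_of: "f (root_of p q) = c p + c q" if pq: "root_pair m p q" for p q
  proof -
    have pts: "p \<in> points m" "q \<in> points m" using pq by (auto simp: root_pair_def)
    have L: "(root_of p q :: 'k weight) \<in> root_lattice m" using pq root_of_in_roots roots_subset_lattice by blast
    have "2 * f (root_of p q) = f (root_of p q + root_of p q)" using add[OF L L] by simp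
    also have "root_of p q + root_of p q = root_of p p + (root_of q q :: 'k weight)" by (simp add: root_of_def)
    also have "f \<dots> = 2 * (c p + c q)" using pts by (simp add: add[OF dbl dbl] c_def)
    finally show ?thesis by simp
  qed
  have "c (- x) = - c x" for x
  proof (cases "x \<in> points m")
    case True
    hence x': "- x \<in> points m" by (simp add: points_def)
    note L = dbl[OF True] and L' = dbl[OF x']
    have "f (root_of x x + root_of (- x) (- x) + root_of x x) = f (root_of x x) + f (root_of (- x) (- x)) + f (root_of x x)"
      unfolding add[OF root_lattice_add[OF L L'] L] add[OF L L'] ..
    moreover have "root_of x x + root_of (- x) (- x) + root_of x x = (root_of x x :: 'k weight)" by (simp add: root_of_def)
    ultimately have "f (root_of x x) + f (root_of (- x) (- x)) = 0" by simp
    thus ?thesis using True x' by (simp add: c_def)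
  qed (auto simp: c_def points_def)
  hence "generic m c" unfolding generic_def using f_root_of nz root_of_in_roots by metis
  moreover have "P = pos_roots m c" unfolding P pos_roots_def roots_eq using f_root_of by fastforce
  ultimately show thesis using that by blast
qed

lemma root_of_in_pos_roots_iff:
  assumes "root_pair m p q"
  shows "(root_of p q :: 'k::field_char_0 weight) \<in> pos_roots m c \<longleftrightarrow> c p + c q > 0"
proof
  assume "(root_of p q :: 'k weight) \<in> pos_roots m c"
  then obtain u v where *: "(root_of p q :: 'k weight) = root_of u v" "root_pair m u v" "c u + c v > 0"
    unfolding pos_roots_def by blast
  show "c p + c q > 0" using *(3) iffD1[OF root_of_eq_iff[OF assms *(2)] *(1)] by auto
qed (use assms in \<open>auto simp: pos_roots_def\<close>)

lemma roots_uminus: "\<alpha> \<in> roots m \<longleftrightarrow> - \<alpha> \<in> roots m"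
proof -
  have "- \<alpha> \<in> roots m" if "\<alpha> \<in> roots m" for \<alpha> :: "'a weight"
    using that root_of_minus unfolding roots_eq by (force simp flip: root_of_minus)
  from this[of \<alpha>] this[of "- \<alpha>"] show ?thesis by auto
qed

lemma odd_roots_uminus: "\<alpha> \<in> odd_roots m \<Longrightarrow> - \<alpha> \<in> odd_roots m"
  unfolding odd_roots_eq by (force simp flip: root_of_minus)

context
  fixes m :: nat and P :: "'k::field_char_0 weight set"
  assumes m: "m \<ge> 1" and P: "positive_system m P"
begin

lemma pos_subset: "P \<subseteq> roots m"
  using P unfolding positive_system_def by blast

lemma pos_uminus_iff:
  assumes "\<alpha> \<in> roots m"
  shows "- \<alpha> \<in> P \<longleftrightarrow> \<alpha> \<notin> P"
proof -
  obtain c where c: "generic m c" "P = pos_roots m c" using positive_systemE[OF P m] .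
  obtain p q where \<alpha>: "\<alpha> = root_of p q" "root_pair m p q" using assms unfolding roots_eq by blast
  have "- \<alpha> \<in> P \<longleftrightarrow> c (- p) + c (- q) > 0"
    using root_of_in_pos_roots_iff[of m "- p" "- q"] \<alpha> c(2) by (simp add: root_of_minus)
  moreover have "\<alpha> \<in> P \<longleftrightarrow> c p + c q > 0" using root_of_in_pos_roots_iff \<alpha> c(2) by blast
  ultimately show ?thesis using genericD[OF c(1)] \<alpha>(2) by (smt (verit))
qed

lemma pos_add:
  assumes "\<beta> \<in> P" "\<delta> \<in> P" "\<beta> + \<delta> \<in> roots m"
  shows "\<beta> + \<delta> \<in> P"
proof -
  obtain c where c: "generic m c" "P = pos_roots m c" using positive_systemE[OF P m] .
  have "\<beta> \<in> roots m" "\<delta> \<in> roots m" using assms pos_subset by auto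
  then obtain p r q where *: "\<beta> = root_of p r" "\<delta> = root_of (- r) q" "\<beta> + \<delta> = root_of p q"
    "root_pair m p r" "root_pair m (- r) q" "root_pair m p q" using sum_of_roots assms(3) by metis
  have "c p + c r > 0" "c (- r) + c q > 0"
    using assms(1,2) *(1,2,4,5) c(2) root_of_in_pos_roots_iff by blast+
  hence "c p + c q > 0" using genericD(1)[OF c(1), of r] by simp
  thus ?thesis using *(3,6) c(2) root_of_in_pos_roots_iff by metis
qed

lemma simple_subset: "simple_roots P \<subseteq> P"
  by (auto simp: simple_roots_def)

text \<open>
  Every positive root is a sum of simple roots: a root that is not simple splits into two positive
  roots of smaller value, and there are only finitely many roots. Hence a system containing the simple
  roots contains all positive roots.
\<close>

lemma pos_subset_if_simple_subset:
  assumes "positive_system m Q" "simple_roots P \<subseteq> Q"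
  shows "P \<subseteq> Q"
proof
  obtain f :: "'k weight \<Rightarrow> real" where
    add: "\<And>x y. x \<in> root_lattice m \<Longrightarrow> y \<in> root_lattice m \<Longrightarrow> f (x + y) = f x + f y"
    and f: "P = {\<alpha> \<in> roots m. f \<alpha> > 0}"
    using P unfolding positive_system_def by blast
  obtain g :: "'k weight \<Rightarrow> real" where
    add': "\<And>x y. x \<in> root_lattice m \<Longrightarrow> y \<in> root_lattice m \<Longrightarrow> g (x + y) = g x + g y"
    and g: "Q = {\<alpha> \<in> roots m. g \<alpha> > 0}"
    using assms(1) unfolding positive_system_def by blast
  fix \<alpha> assume "\<alpha> \<in> P"
  thus "\<alpha> \<in> Q"
  proof (induction \<alpha> rule: measure_induct_rule[of "\<lambda>\<alpha>. card {\<beta> \<in> P. f \<beta> < f \<alpha>}"])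
    case (less \<alpha>)
    show ?case
    proof (cases "\<alpha> \<in> simple_roots P")
      case True
      thus ?thesis using assms(2) by blast
    next
      case False
      then obtain \<beta> \<gamma> where *: "\<beta> \<in> P" "\<gamma> \<in> P" "\<alpha> = \<beta> + \<gamma>"
        using less.prems unfolding simple_roots_def by blast
      have L: "\<beta> \<in> root_lattice m" "\<gamma> \<in> root_lattice m"
        using * pos_subset roots_subset_lattice by blast+
      have lt: "f \<beta> < f \<alpha>" "f \<gamma> < f \<alpha>" using add[OF L] * f by auto
      have fin: "finite {\<beta> \<in> P. f \<beta> < f \<alpha>}"
        using finite_roots pos_subset by (metis (no_types, lifting) finite_subset mem_Collect_eq subset_iff)
      have "\<beta> \<in> Q"
        by (rule less.IH[OF psubset_card_mono[OF fin] *(1)]) (use lt(1) *(1) in auto)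
      moreover have "\<gamma> \<in> Q"
        by (rule less.IH[OF psubset_card_mono[OF fin] *(2)]) (use lt(2) *(2) in auto)
      ultimately have "g \<alpha> > 0" unfolding *(3) add'[OF L] g by simp
      thus ?thesis using less.prems pos_subset g by blast
    qed
  qed
qed

end

text \<open>
  A positive system contains exactly one root out of each pair of opposite roots.
\<close>

lemma pos_eqI:
  assumes "m \<ge> 1" "positive_system m P" "positive_system m Q" "P \<subseteq> (Q :: 'k::field_char_0 weight set)"
  shows "P = Q"
proof
  show "Q \<subseteq> P"
  proof
    fix \<alpha> assume \<alpha>: "\<alpha> \<in> Q"
    hence r: "\<alpha> \<in> roots m" using pos_subset assms(1,3) by blast
    show "\<alpha> \<in> P"
      using pos_uminus_iff[OF assms(1,2) r] pos_uminus_iff[OF assms(1,3) r] \<alpha> assms(4) by blast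
  qed
qed (rule assms(4))

lemma simple_roots_inj:
  assumes "m \<ge> 1" "positive_system m P" "positive_system m Q" "simple_roots P = simple_roots (Q :: 'k::field_char_0 weight set)"
  shows "P = Q"
  using pos_eqI[OF assms(1-3)] pos_subset_if_simple_subset[OF assms(1,2,3)] assms(4) simple_subset[OF assms(1,3)]
  by blast

section \<open>Strings of isotropic roots\<close>

text \<open>
  The bilinear form on signed unit weights, which is negative on eps1.
\<close>

definition bint :: "int \<Rightarrow> int \<Rightarrow> int" where
  "bint x y = (if \<bar>x\<bar> = 1 then - coord x y else coord x y)"

lemma bform_add_left: "bform m (x + y) z = bform m x z + bform m y z"
  by (simp add: bform_def algebra_simps sum.distrib)

lemma bform_add_right: "bform m x (y + z) = bform m x y + bform m x z"
  by (simp add: bform_def algebra_simps sum.distrib)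

lemma bform_unit_weight:
  assumes "x \<in> points m" "y \<in> points m"
  shows "bform m (unit_weight x) (unit_weight y) = of_int (bint x y)"
proof -
  have nz: "x \<noteq> 0" "y \<noteq> 0" using assms by (auto simp: points_def)
  define i where "i = nat (\<bar>x\<bar> - 1)"
  have i: "i \<le> m" "i = 0 \<longleftrightarrow> \<bar>x\<bar> = 1" using assms(1) by (auto simp: points_def i_def)
  have c: "of_int (sgn x) * unit_weight y i = (of_int (coord x y) :: 'a)"
    unfolding i_def by (rule unit_weight_coord[OF nz])
  have "(\<Sum>j = 1..m. unit_weight x j * unit_weight y j) = (\<Sum>j = 1..m. if j = i then of_int (coord x y) else 0 :: 'a)"
    by (intro sum.cong refl) (auto simp: unit_weight_apply[OF nz(1)] i_def[symmetric] c)
  also have "\<dots> = (if \<bar>x\<bar> = 1 then 0 else of_int (coord x y))" using i by auto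
  finally have 1: "(\<Sum>j = 1..m. unit_weight x j * unit_weight y j) = (if \<bar>x\<bar> = 1 then 0 else of_int (coord x y) :: 'a)" .
  have 2: "unit_weight x 0 * unit_weight y 0 = (if \<bar>x\<bar> = 1 then of_int (coord x y) else 0 :: 'a)"
    using i(2) c by (auto simp: unit_weight_apply[OF nz(1)] i_def[symmetric])
  show ?thesis unfolding bform_def 1 2 bint_def by simp
qed

lemma bform_root_of:
  assumes "root_pair m p q" "root_pair m g h"
  shows "bform m (root_of p q) (root_of g h) = of_int (bint p g + bint q g + (bint p h + bint q h))"
  using assms by (simp add: root_of_def bform_add_left bform_add_right bform_unit_weight root_pair_def)

text \<open>
  Once a unit weight has cancelled, the only obstruction to being a root is that \<open>\<plusminus>eps1\<close> remains
  twice; this can happen only if the cancelled unit is a \<open>\<plusminus>delta i\<close>.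
\<close>

lemma add_odd_root_iff:
  assumes "root_pair m p q" "root_pair m g h" "\<bar>g\<bar> = 1"
    and "\<not> (p = - g \<and> q = - h)" "\<not> (p = - h \<and> q = - g)"
  shows "(root_of p q + root_of g h :: 'k::field_char_0 weight) \<in> roots m \<longleftrightarrow>
    p = - g \<or> q = - g \<or> p = - h \<and> \<bar>q\<bar> \<noteq> 1 \<or> q = - h \<and> \<bar>p\<bar> \<noteq> 1" (is "?L \<longleftrightarrow> ?R")
proof
  assume ?L
  from sum_of_roots[OF root_of_in_roots[OF assms(1)] root_of_in_roots[OF assms(2)] this]
  obtain p' r q' where *: "(root_of p q :: 'k weight) = root_of p' r" "(root_of g h :: 'k weight) = root_of (- r) q'"
    "root_pair m p' r" "root_pair m (- r) q'" "root_pair m p' q'" by metis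
  have 1: "p = p' \<and> q = r \<or> p = r \<and> q = p'" using *(1) root_of_eq_iff[OF assms(1) *(3)] by blast
  have 2: "g = - r \<and> h = q' \<or> g = q' \<and> h = - r" using *(2) root_of_eq_iff[OF assms(2) *(4)] by blast
  show ?R using 1 2 *(5) assms(3) unfolding root_pair_def by auto
next
  note D = root_pairD[OF assms(1)] and E = root_pairD[OF assms(2)]
  have h: "2 \<le> \<bar>h\<bar>" using E(6) assms(3) .
  assume ?R
  then consider "p = - g" | "q = - g" | "p = - h" "\<bar>q\<bar> \<noteq> 1" | "q = - h" "\<bar>p\<bar> \<noteq> 1" by blast
  thus ?L
  proof cases
    case 1
    have "root_of p q + root_of g h = (root_of q h :: 'k weight)" by (simp add: 1 root_of_def)
    moreover have "root_pair m q h" using 1 D(2,5) E(2,5) h assms(4) by (intro root_pairI) auto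
    ultimately show ?thesis using root_of_in_roots by metis
  next
    case 2
    have "root_of p q + root_of g h = (root_of p h :: 'k weight)" by (simp add: 2 root_of_def)
    moreover have "root_pair m p h" using 2 D(1,4) E(2,5) h assms(5) by (intro root_pairI) auto
    ultimately show ?thesis using root_of_in_roots by metis
  next
    case 3
    have "root_of p q + root_of g h = (root_of q g :: 'k weight)" by (simp add: 3 root_of_def)
    moreover have "2 \<le> \<bar>q\<bar>" using 3 D(2) by linarith
    hence "root_pair m q g" using 3 D(2,5) E(1,4) assms(3) by (intro root_pairI) auto
    ultimately show ?thesis using root_of_in_roots by metis
  next
    case 4
    have "root_of p q + root_of g h = (root_of p g :: 'k weight)" by (simp add: 4 root_of_def)
    moreover have "2 \<le> \<bar>p\<bar>" using 4 D(1) by linarith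
    hence "root_pair m p g" using 4 D(1,4) E(1,4) assms(3) by (intro root_pairI) auto
    ultimately show ?thesis using root_of_in_roots by metis
  qed
qed

text \<open>
  Root strings through an isotropic root: they have length two when the form does not vanish and
  length one when it does.
\<close>

lemma odd_root_string:
  assumes "\<alpha> \<in> roots m" "\<gamma> \<in> odd_roots m" "\<alpha> \<noteq> \<gamma>" "\<alpha> \<noteq> - (\<gamma> :: 'k::field_char_0 weight)"
  shows "bform m \<alpha> \<gamma> \<noteq> 0 \<longleftrightarrow> \<alpha> + \<gamma> \<in> roots m \<or> \<alpha> - \<gamma> \<in> roots m"
    and "\<not> (\<alpha> + \<gamma> \<in> roots m \<and> \<alpha> - \<gamma> \<in> roots m)"
proof -
  obtain p q where \<alpha>: "\<alpha> = root_of p q" "root_pair m p q" using assms(1) unfolding roots_eq by blast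
  obtain g h where \<gamma>: "\<gamma> = root_of g h" "root_pair m g h" "\<bar>g\<bar> = 1" using assms(2) unfolding odd_roots_eq by blast
  have ne: "\<not> (p = g \<and> q = h)" "\<not> (p = h \<and> q = g)" "\<not> (p = - g \<and> q = - h)" "\<not> (p = - h \<and> q = - g)"
    using assms(3,4) unfolding \<alpha> \<gamma> by (auto simp: root_of_commute simp flip: root_of_minus)
  note D = root_pairD[OF \<alpha>(2)] and E = root_pairD[OF \<gamma>(2)]
  have h: "2 \<le> \<bar>h\<bar>" using E(6) \<gamma>(3) .
  define N where "N = bint p g + bint q g + (bint p h + bint q h)"
  have N: "bform m \<alpha> \<gamma> = of_int N" unfolding \<alpha> \<gamma> N_def by (rule bform_root_of[OF \<alpha>(2) \<gamma>(2)])
  have plus: "\<alpha> + \<gamma> \<in> roots m \<longleftrightarrow> p = - g \<or> q = - g \<or> p = - h \<and> \<bar>q\<bar> \<noteq> 1 \<or> q = - h \<and> \<bar>p\<bar> \<noteq> 1"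
    unfolding \<alpha> \<gamma> by (rule add_odd_root_iff[OF \<alpha>(2) \<gamma>(2,3) ne(3,4)])
  have "\<alpha> - \<gamma> = root_of p q + root_of (- g) (- h)" by (simp add: \<alpha> \<gamma> root_of_minus)
  hence minus: "\<alpha> - \<gamma> \<in> roots m \<longleftrightarrow> p = g \<or> q = g \<or> p = h \<and> \<bar>q\<bar> \<noteq> 1 \<or> q = h \<and> \<bar>p\<bar> \<noteq> 1"
    using add_odd_root_iff[OF \<alpha>(2), of "- g" "- h", where 'k='k] \<gamma>(2,3) ne(1,2) by simp
  have hnz: "h \<noteq> - h" "g \<noteq> - g" using h \<gamma>(3) by auto
  have "(N \<noteq> 0 \<longleftrightarrow> \<alpha> + \<gamma> \<in> roots m \<or> \<alpha> - \<gamma> \<in> roots m) \<and> \<not> (\<alpha> + \<gamma> \<in> roots m \<and> \<alpha> - \<gamma> \<in> roots m)"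
  proof (cases "\<bar>p\<bar> = 1 \<or> \<bar>q\<bar> = 1")
    case True
    define x where "x = (if \<bar>p\<bar> = 1 then p else q)"
    define y where "y = (if \<bar>p\<bar> = 1 then q else p)"
    have y: "2 \<le> \<bar>y\<bar>" and x: "\<bar>x\<bar> = 1" using True D(6,7) by (auto simp: x_def y_def)
    have N': "N = bint x g + bint y g + (bint x h + bint y h)" by (simp add: N_def x_def y_def)
    have zero: "bint y g = 0" "bint x h = 0"
      using x y h \<gamma>(3) by (auto simp: bint_def coord_def)
    have ne': "\<not> (x = g \<and> y = h)" "\<not> (x = - g \<and> y = - h)"
      using ne by (auto simp: x_def y_def split: if_splits)
    have yh: "bint y h = coord y h" using y by (simp add: bint_def)
    have "\<alpha> + \<gamma> \<in> roots m \<longleftrightarrow> x = - g" "\<alpha> - \<gamma> \<in> roots m \<longleftrightarrow> x = g"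
      unfolding plus minus using True D(6,7) \<gamma>(3) h by (auto simp: x_def)
    moreover have "x = g \<and> bint x g = - 1 \<or> x = - g \<and> bint x g = 1"
      using x \<gamma>(3) hnz(2) by (auto simp: bint_def coord_def)
    moreover have "x = g \<Longrightarrow> coord y h \<le> 0" "x = - g \<Longrightarrow> coord y h \<ge> 0"
      using ne' by (auto simp: coord_def)
    ultimately show ?thesis unfolding N' zero yh using hnz(2) by auto
  next
    case False
    hence pq: "2 \<le> \<bar>p\<bar>" "2 \<le> \<bar>q\<bar>" using D(1,2) by linarith+
    hence zero: "bint p g = 0" "bint q g = 0"
      using \<gamma>(3) by (auto simp: bint_def coord_def)
    have cases: "(a + b \<noteq> 0 \<longleftrightarrow> (B \<or> D) \<or> (A \<or> C)) \<and> \<not> ((B \<or> D) \<and> (A \<or> C))"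
      if "A \<and> a = 1 \<or> B \<and> a = - 1 \<or> \<not> A \<and> \<not> B \<and> a = 0" "C \<and> b = 1 \<or> D \<and> b = - 1 \<or> \<not> C \<and> \<not> D \<and> b = 0"
        "\<not> (A \<and> D)" "\<not> (B \<and> C)" "\<not> (A \<and> B)" "\<not> (C \<and> D)" for A B C D and a b :: int
      using that by auto
    have ph: "bint p h = coord p h" "bint q h = coord q h" using pq by (simp_all add: bint_def)
    have pm: "\<alpha> + \<gamma> \<in> roots m \<longleftrightarrow> p = - h \<or> q = - h" "\<alpha> - \<gamma> \<in> roots m \<longleftrightarrow> p = h \<or> q = h"
      unfolding plus minus using pq \<gamma>(3) by auto
    have 1: "x = h \<and> coord x h = 1 \<or> x = - h \<and> coord x h = - 1 \<or> x \<noteq> h \<and> x \<noteq> - h \<and> coord x h = 0" for x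
      by (auto simp: coord_def)
    have 2: "\<not> (p = h \<and> q = - h)" "\<not> (p = - h \<and> q = h)" "\<not> (x = h \<and> x = - h)" for x
      using D(3) hnz(1) by auto
    show ?thesis unfolding N_def zero ph pm add_0
      using cases[OF 1[of p] 1[of q] 2(1) 2(2) 2(3)[of p] 2(3)[of q]] by simp
  qed
  thus "bform m \<alpha> \<gamma> \<noteq> 0 \<longleftrightarrow> \<alpha> + \<gamma> \<in> roots m \<or> \<alpha> - \<gamma> \<in> roots m"
    and "\<not> (\<alpha> + \<gamma> \<in> roots m \<and> \<alpha> - \<gamma> \<in> roots m)" by (simp_all add: N)
qed

text \<open>
  The combinatorial shadow of the Jacobi identity: lowering a nonzero bracket of root vectors by
  \<open>\<gamma>\<close> must lower one of its two factors.
\<close>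

lemma odd_root_jacobi:
  assumes "\<beta> \<in> roots m" "\<delta> \<in> roots m" "\<beta> + \<delta> \<in> roots m" "\<beta> + \<delta> - \<gamma> \<in> roots m"
    and "\<gamma> \<in> odd_roots m" "\<beta> \<noteq> \<gamma>" "\<delta> \<noteq> (\<gamma> :: 'k::field_char_0 weight)" "\<beta> + \<delta> \<noteq> \<gamma>"
  shows "\<beta> - \<gamma> \<in> roots m \<or> \<delta> - \<gamma> \<in> roots m"
proof -
  obtain p r q where *: "\<beta> = root_of p r" "\<delta> = root_of (- r) q" "\<beta> + \<delta> = root_of p q"
    "root_pair m p r" "root_pair m (- r) q" "root_pair m p q" using sum_of_roots[OF assms(1-3)] .
  obtain g h where \<gamma>: "\<gamma> = root_of g h" "root_pair m g h" "\<bar>g\<bar> = 1" using assms(5) unfolding odd_roots_eq by blast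
  have sub: "root_of u v - \<gamma> \<in> roots m \<longleftrightarrow> u = g \<or> v = g \<or> u = h \<and> \<bar>v\<bar> \<noteq> 1 \<or> v = h \<and> \<bar>u\<bar> \<noteq> 1"
    if "root_pair m u v" "root_of u v \<noteq> \<gamma>" for u v
  proof -
    have "\<not> (u = g \<and> v = h)" "\<not> (u = h \<and> v = g)" using that(2) \<gamma>(1) by (auto simp: root_of_commute)
    hence "(root_of u v + root_of (- g) (- h) :: 'k weight) \<in> roots m \<longleftrightarrow>
        u = g \<or> v = g \<or> u = h \<and> \<bar>v\<bar> \<noteq> 1 \<or> v = h \<and> \<bar>u\<bar> \<noteq> 1"
      using add_odd_root_iff[OF that(1), of "- g" "- h", where 'k='k] \<gamma>(2,3) by simp
    moreover have "root_of u v - \<gamma> = root_of u v + root_of (- g) (- h)" unfolding \<gamma>(1) root_of_minus by simp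
    ultimately show ?thesis by (simp only:)
  qed
  have 1: "p = g \<or> q = g \<or> p = h \<and> \<bar>q\<bar> \<noteq> 1 \<or> q = h \<and> \<bar>p\<bar> \<noteq> 1"
    using assms(4,8) sub[OF *(6)] *(3) by simp
  have 2: "\<beta> - \<gamma> \<in> roots m \<longleftrightarrow> p = g \<or> r = g \<or> p = h \<and> \<bar>r\<bar> \<noteq> 1 \<or> r = h \<and> \<bar>p\<bar> \<noteq> 1"
    using assms(6) sub[OF *(4)] *(1) by simp
  have 3: "\<delta> - \<gamma> \<in> roots m \<longleftrightarrow> - r = g \<or> q = g \<or> - r = h \<and> \<bar>q\<bar> \<noteq> 1 \<or> q = h \<and> \<bar>- r\<bar> \<noteq> 1"
    using assms(7) sub[OF *(5)] *(2) by simp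
  have "\<bar>r\<bar> = 1 \<Longrightarrow> r = g \<or> - r = g" using \<gamma>(3) by linarith
  thus ?thesis unfolding 2 3 using 1 by auto
qed

section \<open>Odd reflections of positive systems\<close>

lemma double_odd_not_root:
  assumes "\<gamma> \<in> odd_roots m"
  shows "\<gamma> + \<gamma> \<notin> (roots m :: 'k::field_char_0 weight set)"
proof
  assume *: "\<gamma> + \<gamma> \<in> roots m"
  obtain g h where \<gamma>: "\<gamma> = root_of g h" "root_pair m g h" "\<bar>g\<bar> = 1" using assms unfolding odd_roots_eq by blast
  obtain u v where uv: "root_of g h + root_of g h = (root_of u v :: 'k weight)" "root_pair m u v"
    using * \<gamma>(1) unfolding roots_eq by blast
  have "g \<noteq> 0" "h \<noteq> 0" "g \<noteq> - h" by (rule root_pairD[OF \<gamma>(2)])+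
  thus False using root_of_sum_cancel[OF uv(1) \<gamma>(2) \<gamma>(2) uv(2)] by auto
qed

lemma odd_root_isotropic:
  assumes "\<gamma> \<in> odd_roots m"
  shows "bform m \<gamma> \<gamma> = (0 :: 'k::field_char_0)"
proof -
  obtain g h where \<gamma>: "\<gamma> = root_of g h" "root_pair m g h" "\<bar>g\<bar> = 1" using assms unfolding odd_roots_eq by blast
  have "2 \<le> \<bar>h\<bar>" using root_pairD(6)[OF \<gamma>(2,3)] .
  hence "bint h g = 0" "bint g h = 0" "bint h h = 1" "bint g g = - 1"
    using \<gamma>(3) by (auto simp: bint_def coord_def)
  thus ?thesis unfolding \<gamma>(1) bform_root_of[OF \<gamma>(2) \<gamma>(2)] by simp
qed

lemma odd_subset_roots: "odd_roots m \<subseteq> roots m"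
  by (auto simp: roots_def)

lemma simple_rootsI:
  assumes "\<alpha> \<in> P" "\<And>\<beta> \<delta>. \<beta> \<in> P \<Longrightarrow> \<delta> \<in> P \<Longrightarrow> \<alpha> = \<beta> + \<delta> \<Longrightarrow> False"
  shows "\<alpha> \<in> simple_roots P"
  using assms unfolding simple_roots_def by blast

lemma simple_rootsD:
  assumes "\<alpha> \<in> simple_roots P"
  shows "\<alpha> \<in> P" "\<beta> \<in> P \<Longrightarrow> \<delta> \<in> P \<Longrightarrow> \<beta> + \<delta> = \<alpha> \<Longrightarrow> False"
  using assms unfolding simple_roots_def by blast+

context
  fixes m :: nat and P :: "'k::field_char_0 weight set" and \<gamma> :: "'k weight"
  assumes m: "m \<ge> 1" and P: "positive_system m P"
    and \<gamma>: "\<gamma> \<in> odd_roots m" "\<gamma> \<in> simple_roots P"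
begin

private definition "P' = insert (- \<gamma>) (P - {\<gamma>})"

private lemma flip_basics:
  shows "\<gamma> \<in> roots m" "- \<gamma> \<in> roots m" "\<gamma> \<in> P" "- \<gamma> \<notin> P" "(0 :: 'k weight) \<notin> roots m" "P \<subseteq> roots m" "P' \<subseteq> roots m"
    "\<gamma> \<noteq> 0" "\<gamma> \<noteq> - \<gamma>"
proof -
  show 1: "\<gamma> \<in> roots m" using \<gamma> odd_subset_roots by blast
  show 2: "- \<gamma> \<in> roots m" using 1 roots_uminus by blast
  show 3: "\<gamma> \<in> P" using simple_rootsD(1)[OF \<gamma>(2)] .
  show 4: "- \<gamma> \<notin> P" using pos_uminus_iff[OF m P 1] 3 by blast
  show 5: "(0 :: 'k weight) \<notin> roots m"
  proof
    assume "(0 :: 'k weight) \<in> roots m"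
    from pos_uminus_iff[OF m P this] show False by simp
  qed
  show 6: "P \<subseteq> roots m" using pos_subset[OF m P] .
  show 7: "P' \<subseteq> roots m" using 2 6 by (auto simp: P'_def)
  show "\<gamma> \<noteq> 0" using 1 5 by blast
  show "\<gamma> \<noteq> - \<gamma>" using 3 4 by metis
qed

private lemma P'_cases: "\<alpha> \<in> P' \<longleftrightarrow> \<alpha> = - \<gamma> \<or> \<alpha> \<in> P \<and> \<alpha> \<noteq> \<gamma>"
  by (auto simp: P'_def)

private lemma minus_simple_pos:
  assumes "\<alpha> \<in> P" "\<alpha> - \<gamma> \<in> roots m"
  shows "\<alpha> - \<gamma> \<in> P"
proof (rule ccontr)
  assume "\<alpha> - \<gamma> \<notin> P"
  hence "\<gamma> - \<alpha> \<in> P" using pos_uminus_iff[OF m P assms(2)] by simp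
  thus False using simple_rootsD(2)[OF \<gamma>(2), of "\<gamma> - \<alpha>" \<alpha>] assms(1) by simp
qed

private lemma neg_simple: "- \<gamma> \<in> simple_roots P'"
proof (rule simple_rootsI)
  fix \<beta> \<delta> assume *: "\<beta> \<in> P'" "\<delta> \<in> P'" "- \<gamma> = \<beta> + \<delta>"
  have "\<beta> \<noteq> 0" "\<delta> \<noteq> 0" using * flip_basics by blast+
  hence "\<beta> \<noteq> - \<gamma>" "\<delta> \<noteq> - \<gamma>" using *(3) by auto
  hence "\<beta> + \<delta> \<in> P" using * P'_cases pos_add[OF m P] flip_basics(2) by metis
  thus False using *(3) flip_basics(4) by simp
qed (simp add: P'_def)

private lemma orthogonal_simple:
  assumes "\<alpha> \<noteq> \<gamma>" "bform m \<alpha> \<gamma> = 0" "\<alpha> \<in> simple_roots P"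
  shows "\<alpha> \<in> simple_roots P'"
proof (rule simple_rootsI)
  have \<alpha>: "\<alpha> \<in> P" "\<alpha> \<in> roots m" "\<alpha> \<noteq> - \<gamma>" using simple_rootsD(1)[OF assms(3)] flip_basics by auto
  show "\<alpha> \<in> P'" using \<alpha> assms(1) P'_cases by blast
  fix \<beta> \<delta> assume *: "\<beta> \<in> P'" "\<delta> \<in> P'" "\<alpha> = \<beta> + \<delta>"
  have "\<alpha> + \<gamma> \<notin> roots m" using odd_root_string(1)[OF \<alpha>(2) \<gamma>(1) assms(1) \<alpha>(3)] assms(2) by blast
  moreover have "\<beta> = \<alpha> + \<gamma>" if "\<delta> = - \<gamma>" using *(3) that by simp
  moreover have "\<delta> = \<alpha> + \<gamma>" if "\<beta> = - \<gamma>" using *(3) that by simp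
  ultimately have "\<beta> \<noteq> - \<gamma>" "\<delta> \<noteq> - \<gamma>" using *(1,2) flip_basics(7) by blast+
  thus False using simple_rootsD(2)[OF assms(3)] * P'_cases by metis
qed

text \<open>
  A decomposition of \<open>\<alpha> + \<gamma>\<close> in the new system either uses \<open>-\<gamma>\<close>, which prolongs the root string
  too far, or consists of old positive roots; then one summand can be lowered by \<open>\<gamma>\<close>, and \<open>\<alpha>\<close> itself
  would decompose.
\<close>

private lemma shifted_simple:
  assumes "bform m \<alpha> \<gamma> \<noteq> 0" "\<alpha> \<in> simple_roots P"
  shows "\<alpha> + \<gamma> \<in> simple_roots P'"
proof (rule simple_rootsI)
  have \<alpha>: "\<alpha> \<in> P" "\<alpha> \<in> roots m" "\<alpha> \<noteq> - \<gamma>" using simple_rootsD(1)[OF assms(2)] flip_basics by auto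
  have ne: "\<alpha> \<noteq> \<gamma>" "\<alpha> \<noteq> 0" using odd_root_isotropic[OF \<gamma>(1)] assms(1) \<alpha>(2) flip_basics(5) by auto
  have "\<alpha> - \<gamma> \<notin> roots m"
    using minus_simple_pos[OF \<alpha>(1)] simple_rootsD(2)[OF assms(2), of "\<alpha> - \<gamma>" \<gamma>] flip_basics(3) by auto
  hence root: "\<alpha> + \<gamma> \<in> roots m"
    using odd_root_string(1)[OF \<alpha>(2) \<gamma>(1) ne(1) \<alpha>(3)] assms(1) by blast
  have pos: "\<alpha> + \<gamma> \<in> P" using pos_add[OF m P \<alpha>(1) flip_basics(3) root] .
  show "\<alpha> + \<gamma> \<in> P'" using pos ne(2) P'_cases by simp
  have "\<alpha> + \<gamma> \<noteq> \<gamma>" using ne(2) by simp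
  moreover have "\<alpha> + \<gamma> \<noteq> - \<gamma>" using pos flip_basics(4) by metis
  ultimately have no: "\<alpha> + \<gamma> + \<gamma> \<notin> roots m"
    using odd_root_string(2)[OF root \<gamma>(1)] \<alpha>(2) by simp
  fix \<beta> \<delta> assume *: "\<beta> \<in> P'" "\<delta> \<in> P'" "\<alpha> + \<gamma> = \<beta> + \<delta>"
  have "\<beta> = \<alpha> + \<gamma> + \<gamma>" if "\<delta> = - \<gamma>" using *(3) that by simp
  moreover have "\<delta> = \<alpha> + \<gamma> + \<gamma>" if "\<beta> = - \<gamma>" using *(3) that by simp
  ultimately have "\<beta> \<noteq> - \<gamma>" "\<delta> \<noteq> - \<gamma>" using *(1,2) flip_basics(7) no by blast+
  hence \<beta>\<delta>: "\<beta> \<in> P" "\<delta> \<in> P" "\<beta> \<noteq> \<gamma>" "\<delta> \<noteq> \<gamma>" using * P'_cases by blast+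
  have eq: "\<alpha> = \<beta> + \<delta> - \<gamma>" using *(3) by (simp add: eq_diff_eq)
  have "\<beta> - \<gamma> \<in> roots m \<or> \<delta> - \<gamma> \<in> roots m"
    using \<beta>\<delta> flip_basics(6) root \<alpha>(2) ne(2) *(3) eq 
    by (intro odd_root_jacobi[OF _ _ _ _ \<gamma>(1)]) auto
  thus False
  proof
    assume "\<beta> - \<gamma> \<in> roots m"
    hence "\<beta> - \<gamma> \<in> P" using minus_simple_pos \<beta>\<delta> by blast
    moreover have "(\<beta> - \<gamma>) + \<delta> = \<alpha>" unfolding eq by (simp add: algebra_simps)
    ultimately show False using simple_rootsD(2)[OF assms(2)] \<beta>\<delta> by blast
  next
    assume "\<delta> - \<gamma> \<in> roots m"
    hence "\<delta> - \<gamma> \<in> P" using minus_simple_pos \<beta>\<delta> by blast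
    moreover have "\<beta> + (\<delta> - \<gamma>) = \<alpha>" unfolding eq by (simp add: algebra_simps)
    ultimately show False using simple_rootsD(2)[OF assms(2)] \<beta>\<delta> by blast
  qed
qed

text \<open>
  The argument runs parallel to that for \<open>\<alpha> + \<gamma>\<close> above, with the roles of the two positive systems
  exchanged.
\<close>

private lemma simple_in_flip:
  assumes "\<alpha> \<in> simple_roots P'" "\<alpha> \<noteq> - \<gamma>"
  shows "\<alpha> \<in> odd_flip m \<gamma> (simple_roots P)"
proof -
  have \<alpha>: "\<alpha> \<in> P" "\<alpha> \<noteq> \<gamma>" "\<alpha> \<in> roots m"
    using simple_rootsD(1)[OF assms(1)] assms(2) P'_cases flip_basics by blast+
  note dec = simple_rootsD(2)[OF assms(1)]
  show ?thesis
  proof (cases "bform m \<alpha> \<gamma> = 0")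
    case True
    have "\<alpha> - \<gamma> \<notin> roots m" using odd_root_string(1)[OF \<alpha>(3) \<gamma>(1) \<alpha>(2) assms(2)] True by blast
    have "\<alpha> \<in> simple_roots P"
    proof (rule simple_rootsI[OF \<alpha>(1)])
      fix \<beta> \<delta> assume *: "\<beta> \<in> P" "\<delta> \<in> P" "\<alpha> = \<beta> + \<delta>"
      have "\<beta> \<noteq> \<gamma>" "\<delta> \<noteq> \<gamma>" using * \<open>\<alpha> - \<gamma> \<notin> roots m\<close> flip_basics(6) by auto
      thus False using dec[of \<beta> \<delta>] * P'_cases by simp
    qed
    thus ?thesis unfolding odd_flip_def using True \<alpha>(2) by blast
  next
    case False
    have "\<alpha> + \<gamma> \<notin> roots m"
    proof
      assume "\<alpha> + \<gamma> \<in> roots m"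
      hence "\<alpha> + \<gamma> \<in> P" using pos_add[OF m P \<alpha>(1) flip_basics(3)] by blast
      moreover have "\<alpha> + \<gamma> \<noteq> \<gamma>" using \<alpha>(3) flip_basics(5) by auto
      ultimately show False using dec[of "\<alpha> + \<gamma>" "- \<gamma>"] P'_cases by simp
    qed
    hence root: "\<alpha> - \<gamma> \<in> roots m" using odd_root_string(1)[OF \<alpha>(3) \<gamma>(1) \<alpha>(2) assms(2)] False by blast
    have pos: "\<alpha> - \<gamma> \<in> P" using minus_simple_pos[OF \<alpha>(1) root] .
    have "\<alpha> \<noteq> \<gamma> + \<gamma>" using double_odd_not_root[OF \<gamma>(1)] \<alpha>(3) by blast
    hence "\<alpha> - \<gamma> \<noteq> \<gamma>" by (simp add: diff_eq_eq)
    moreover have ne': "\<alpha> - \<gamma> \<noteq> - \<gamma>" using pos flip_basics(4) by metis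
    ultimately have no: "\<alpha> - \<gamma> - \<gamma> \<notin> roots m"
      using odd_root_string(2)[OF root \<gamma>(1)] \<alpha>(3) by simp
    have "\<alpha> - \<gamma> \<in> simple_roots P"
    proof (rule simple_rootsI[OF pos])
      fix \<beta> \<delta> assume *: "\<beta> \<in> P" "\<delta> \<in> P" "\<alpha> - \<gamma> = \<beta> + \<delta>"
      have "\<beta> = \<alpha> - \<gamma> - \<gamma>" if "\<delta> = \<gamma>" using *(3) that by simp
      moreover have "\<delta> = \<alpha> - \<gamma> - \<gamma>" if "\<beta> = \<gamma>" using *(3) that by simp
      ultimately have ne: "\<beta> \<noteq> \<gamma>" "\<delta> \<noteq> \<gamma>" using *(1,2) no flip_basics(6) by blast+
      have ne2: "\<beta> \<noteq> 0" "\<delta> \<noteq> 0" "\<beta> \<noteq> - \<gamma>" "\<delta> \<noteq> - \<gamma>" using *(1,2) flip_basics by blast+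
      have eq: "\<alpha> = \<beta> + \<delta> - - \<gamma>" using *(3) by (simp add: diff_eq_eq)
      have "\<beta> - - \<gamma> \<in> roots m \<or> \<delta> - - \<gamma> \<in> roots m"
        using *(1,2) flip_basics(6) root \<alpha>(3) *(3) eq ne' ne2
        by (intro odd_root_jacobi[OF _ _ _ _ odd_roots_uminus[OF \<gamma>(1)]]) auto
      thus False
      proof
        assume "\<beta> - - \<gamma> \<in> roots m"
        hence "\<beta> + \<gamma> \<in> P" using pos_add[OF m P *(1) flip_basics(3)] by simp
        hence "\<beta> + \<gamma> \<in> P'" "\<delta> \<in> P'" using P'_cases ne2 ne *(2) by simp_all
        moreover have "(\<beta> + \<gamma>) + \<delta> = \<alpha>" unfolding eq by (simp add: algebra_simps)
        ultimately show False using dec by blast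
      next
        assume "\<delta> - - \<gamma> \<in> roots m"
        hence "\<delta> + \<gamma> \<in> P" using pos_add[OF m P *(2) flip_basics(3)] by simp
        hence "\<delta> + \<gamma> \<in> P'" "\<beta> \<in> P'" using P'_cases ne2 ne *(1) by simp_all
        moreover have "\<beta> + (\<delta> + \<gamma>) = \<alpha>" unfolding eq by (simp add: algebra_simps)
        ultimately show False using dec by blast
      qed
    qed
    moreover have "bform m (\<alpha> - \<gamma>) \<gamma> \<noteq> 0"
      using bform_add_left[of m "\<alpha> - \<gamma>" \<gamma> \<gamma>] odd_root_isotropic[OF \<gamma>(1)] False by simp
    moreover have "\<alpha> = (\<alpha> - \<gamma>) + \<gamma>" by simp
    ultimately show ?thesis unfolding odd_flip_def by blast
  qed
qed

text \<open>
  The rule for odd reflections of fundamental systems says that exactly the root \<open>\<gamma>\<close> changes sign.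
\<close>

lemma simple_roots_odd_flip:
  "simple_roots (insert (- \<gamma>) (P - {\<gamma>})) = odd_flip m \<gamma> (simple_roots P)"
proof
  show "simple_roots (insert (- \<gamma>) (P - {\<gamma>})) \<subseteq> odd_flip m \<gamma> (simple_roots P)"
    unfolding P'_def[symmetric] using simple_in_flip by (auto simp: odd_flip_def)
  show "odd_flip m \<gamma> (simple_roots P) \<subseteq> simple_roots (insert (- \<gamma>) (P - {\<gamma>}))"
    unfolding P'_def[symmetric] odd_flip_def using neg_simple orthogonal_simple shifted_simple by blast
qed

lemma neg_simple_after_flip: "- \<gamma> \<in> simple_roots (insert (- \<gamma>) (P - {\<gamma>}))"
  using neg_simple unfolding P'_def .

end

text \<open>
  An odd root \<open>\<plusminus>eps1 \<plusminus> delta i\<close> is simple exactly if the two points on the real line that it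
  compares are neighbours, since every point strictly between them splits the root.
\<close>

lemma simple_odd_iff:
  assumes "generic m c" "root_pair m g h" "\<bar>g\<bar> = 1"
  shows "(root_of g h :: 'k::field_char_0 weight) \<in> simple_roots (pos_roots m c) \<longleftrightarrow>
    c g + c h > 0 \<and> (\<forall>x. 2 \<le> \<bar>x\<bar> \<and> \<bar>x\<bar> \<le> int m + 1 \<longrightarrow> \<not> (- c h < c x \<and> c x < c g))" (is "?L \<longleftrightarrow> ?R")
proof
  note odd = genericD(1)[OF assms(1)]
  note D = root_pairD[OF assms(2)]
  assume L: ?L
  have "c g + c h > 0" using simple_rootsD(1)[OF L] root_of_in_pos_roots_iff[OF assms(2)] by blast
  moreover have False if x: "2 \<le> \<bar>x\<bar>" "\<bar>x\<bar> \<le> int m + 1" "- c h < c x" "c x < c g" for x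
  proof -
    have "x \<noteq> - h" using x(3) odd[of h] by auto
    hence 1: "root_pair m x h" "root_pair m g (- x)"
      using x D assms(3) by (auto intro!: root_pairI)
    hence "root_of g (- x) \<in> (pos_roots m c :: 'k weight set)" "root_of x h \<in> (pos_roots m c :: 'k weight set)"
      using x odd[of x] by (simp_all add: root_of_in_pos_roots_iff)
    moreover have "root_of g (- x) + root_of x h = (root_of g h :: 'k weight)" by (simp add: root_of_def)
    ultimately show False using simple_rootsD(2)[OF L] by blast
  qed
  ultimately show ?R by blast
next
  note odd = genericD(1)[OF assms(1)]
  assume R: ?R
  show ?L
  proof (rule simple_rootsI)
    show "root_of g h \<in> (pos_roots m c :: 'k weight set)" using R root_of_in_pos_roots_iff[OF assms(2)] by blast
    fix \<beta> \<delta> :: "'k weight"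
    assume *: "\<beta> \<in> pos_roots m c" "\<delta> \<in> pos_roots m c" "root_of g h = \<beta> + \<delta>"
    have "\<beta> \<in> roots m" "\<delta> \<in> roots m" "\<beta> + \<delta> \<in> roots m"
      using * root_of_in_roots[OF assms(2), where 'a='k] unfolding pos_roots_def roots_eq by auto
    then obtain p r q where d: "\<beta> = root_of p r" "\<delta> = root_of (- r) q" "\<beta> + \<delta> = root_of p q"
      "root_pair m p r" "root_pair m (- r) q" "root_pair m p q" using sum_of_roots by metis
    have pos: "c p + c r > 0" "c q > c r"
      using * d root_of_in_pos_roots_iff[OF d(4), where 'k='k] root_of_in_pos_roots_iff[OF d(5), where 'k='k] odd[of r] by auto
    have "p = g \<and> q = h \<or> p = h \<and> q = g"
      using root_of_eq_iff[OF d(6) assms(2), where 'k='k] d(3) *(3) by metis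
    thus False
    proof
      assume e: "p = g \<and> q = h"
      hence "2 \<le> \<bar>- r\<bar>" "\<bar>- r\<bar> \<le> int m + 1" using root_pairD(5,6)[OF d(4)] assms(3) by auto
      thus False using R pos e odd[of r] by fastforce
    next
      assume e: "p = h \<and> q = g"
      hence "2 \<le> \<bar>r\<bar>" "\<bar>r\<bar> \<le> int m + 1" using root_pairD(7)[OF d(5)] root_pairD(5)[OF d(4)] assms(3) by auto
      thus False using R pos e by fastforce
    qed
  qed
qed

text \<open>
  Moving the value of eps1 changes the sign of precisely those odd roots whose point is crossed.
\<close>

lemma pos_roots_crossing:
  assumes "generic m c" "generic m c'" "root_pair m g h" "\<bar>g\<bar> = 1"
    and same: "\<And>x. 2 \<le> \<bar>x\<bar> \<Longrightarrow> \<bar>x\<bar> \<le> int m + 1 \<Longrightarrow> c' x = c x"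
    and "c g + c h > 0" "c' g + c' h < 0"
    and between: "\<And>x. 2 \<le> \<bar>x\<bar> \<Longrightarrow> \<bar>x\<bar> \<le> int m + 1 \<Longrightarrow> x \<noteq> - h \<Longrightarrow> \<not> (c' g < c x \<and> c x < c g)"
  shows "(pos_roots m c' :: 'k::field_char_0 weight set) = insert (- root_of g h) (pos_roots m c - {root_of g h})"
proof -
  note odd = genericD(1)[OF assms(1)] and odd' = genericD(1)[OF assms(2)]
  have gh: "c' g < c g" using assms(6,7) same root_pairD(5,6)[OF assms(3)] assms(4) by fastforce
  have key: "c' g + c' x > 0 \<longleftrightarrow> c g + c x > 0" if x: "root_pair m g x" "x \<noteq> h" for x
  proof -
    have b: "2 \<le> \<bar>- x\<bar>" "\<bar>- x\<bar> \<le> int m + 1" "- x \<noteq> - h"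
      using root_pairD(5,6)[OF x(1)] assms(4) x(2) by auto
    have "c g + c x \<noteq> 0" "c' g + c' x \<noteq> 0" using genericD(2) assms(1,2) x(1) by blast+
    moreover have "c' (- x) = c (- x)" by (rule same[OF b(1,2)])
    ultimately show ?thesis using between[OF b] odd[of x] odd'[of x] gh by auto
  qed
  have inter: "(root_of p q :: 'k weight) \<in> pos_roots m c' \<longleftrightarrow>
      root_of p q = - (root_of g h :: 'k weight) \<or> (root_of p q :: 'k weight) \<in> pos_roots m c \<and> root_of p q \<noteq> (root_of g h :: 'k weight)"
    if pq: "root_pair m p q" "\<bar>p\<bar> = 1 \<or> 2 \<le> \<bar>p\<bar> \<and> 2 \<le> \<bar>q\<bar>" for p q
  proof -
    have e1: "(root_of p q :: 'k weight) = root_of g h \<longleftrightarrow> p = g \<and> q = h \<or> p = h \<and> q = g"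
      by (rule root_of_eq_iff[OF pq(1) assms(3)])
    have e2: "(root_of p q :: 'k weight) = - root_of g h \<longleftrightarrow> p = - g \<and> q = - h \<or> p = - h \<and> q = - g"
      using root_of_eq_iff[OF pq(1), of "- g" "- h", where 'k='k] assms(3) by (simp add: root_of_minus)
    note E = root_pairD[OF assms(3)]
    have h: "2 \<le> \<bar>h\<bar>" using E(6) assms(4) .
    from pq(2) show ?thesis
    proof
      assume p: "\<bar>p\<bar> = 1"
      have q: "2 \<le> \<bar>q\<bar>" using root_pairD(6)[OF pq(1) p] .
      have "p = g \<or> p = - g" using p assms(4) by linarith
      thus ?thesis
      proof
        assume p: "p = g"
        have "p \<noteq> - g" "p \<noteq> - h" "q \<noteq> g" using p h q assms(4) by auto
        thus ?thesis unfolding e1 e2 root_of_in_pos_roots_iff[OF pq(1)]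
          using p key[of q] pq(1) assms(6,7) by auto
      next
        assume p: "p = - g"
        have 1: "p \<noteq> g" "p \<noteq> h" "q \<noteq> - g" using p h q assms(4) by auto
        have 2: "root_pair m g (- q)" using pq(1) p by (metis root_pair_minus minus_minus)
        have "c g + c (- q) \<noteq> 0" "c' g + c' (- q) \<noteq> 0" using genericD(2) assms(1,2) 2 by blast+
        thus ?thesis unfolding e1 e2 root_of_in_pos_roots_iff[OF pq(1)]
          using 1 p key[of "- q"] 2 assms(6,7) odd[of g] odd[of h] odd'[of g] odd'[of h] odd[of q] odd'[of q]
          by (cases "q = - h") auto
      qed
    next
      assume b: "2 \<le> \<bar>p\<bar> \<and> 2 \<le> \<bar>q\<bar>"
      have "c' p = c p" "c' q = c q" using b same root_pairD(4,5)[OF pq(1)] by blast+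
      moreover have "p \<noteq> g" "q \<noteq> g" "p \<noteq> - g" "q \<noteq> - g" using b assms(4) by auto
      ultimately show ?thesis unfolding e1 e2 root_of_in_pos_roots_iff[OF pq(1)] by auto
    qed
  qed
  have "\<alpha> \<in> pos_roots m c' \<longleftrightarrow> \<alpha> = - root_of g h \<or> \<alpha> \<in> pos_roots m c \<and> \<alpha> \<noteq> root_of g h"
    if \<alpha>: "\<alpha> \<in> roots m" for \<alpha> :: "'k weight"
  proof -
    obtain p q where pq: "\<alpha> = root_of p q" "root_pair m p q" using \<alpha> unfolding roots_eq by blast
    consider "\<bar>p\<bar> = 1 \<or> 2 \<le> \<bar>p\<bar> \<and> 2 \<le> \<bar>q\<bar>" | "\<bar>q\<bar> = 1"
      using root_pairD(1,2)[OF pq(2)] by linarith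
    thus ?thesis
    proof cases
      case 1
      thus ?thesis using inter[OF pq(2)] pq(1) by simp
    next
      case 2
      have "root_pair m q p" using pq(2) root_pair_sym by blast
      thus ?thesis using inter[of q p] pq(1) 2 root_of_commute[of q p, where 'a='k] by simp
    qed
  qed
  moreover have "(pos_roots m c' :: 'k weight set) \<subseteq> roots m" "(pos_roots m c :: 'k weight set) \<subseteq> roots m"
    unfolding pos_roots_def roots_eq by blast+
  moreover have "- root_of g h \<in> (roots m :: 'k weight set)"
    using root_of_in_roots[OF assms(3)] roots_uminus by blast
  ultimately show ?thesis by blast
qed

lemma finite_gap_below:
  fixes v :: real
  assumes "finite S"
  shows "\<exists>t<v. \<forall>y\<in>S. y < v \<longrightarrow> y < t"
  using assms
proof (induction S)
  case empty
  show ?case using lt_ex by blast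
next
  case (insert y S)
  then obtain t where t: "t < v" "\<forall>y\<in>S. y < v \<longrightarrow> y < t" by blast
  show ?case
  proof (intro exI[of _ "if y < v then max t ((y + v) / 2) else t"] conjI ballI impI)
    fix z assume "z \<in> insert y S" "z < v"
    thus "z < (if y < v then max t ((y + v) / 2) else t)" using t by (auto simp: less_max_iff_disj)
  qed (use t in auto)
qed

text \<open>
  The new functional puts the value of eps1 just beyond its neighbour, leaving no other point in
  between.
\<close>

lemma flip_positive:
  assumes "m \<ge> 1" "positive_system m (P :: 'k::field_char_0 weight set)" "\<gamma> \<in> odd_roots m" "\<gamma> \<in> simple_roots P"
  shows "positive_system m (insert (- \<gamma>) (P - {\<gamma>}))"
proof -
  obtain c where c: "generic m c" "P = pos_roots m c" using positive_systemE[OF assms(2,1)] .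
  obtain g h where \<gamma>: "\<gamma> = root_of g h" "root_pair m g h" "\<bar>g\<bar> = 1" using assms(3) unfolding odd_roots_eq by blast
  note odd = genericD(1)[OF c(1)]
  have h: "2 \<le> \<bar>h\<bar>" "\<bar>h\<bar> \<le> int m + 1" using root_pairD[OF \<gamma>(2)] \<gamma>(3) by blast+
  have simple: "c g + c h > 0" "\<And>x. 2 \<le> \<bar>x\<bar> \<Longrightarrow> \<bar>x\<bar> \<le> int m + 1 \<Longrightarrow> \<not> (- c h < c x \<and> c x < c g)"
    using assms(4) simple_odd_iff[OF c(1) \<gamma>(2,3), where 'k='k] unfolding \<gamma>(1) c(2) by blast+
  have "finite (points m)"
    by (rule finite_subset[of _ "{- int m - 1..int m + 1}"]) (auto simp: points_def)
  then obtain t where t: "t < - c h" "\<And>x. x \<in> points m \<Longrightarrow> c x < - c h \<Longrightarrow> c x < t"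
    using finite_gap_below[of "c ` points m" "- c h"] by auto
  define c' where "c' = c (g := t, - g := - t)"
  have g: "g \<noteq> - g" using \<gamma>(3) by auto
  have c'g: "c' g = t" "c' (- g) = - t" using g by (auto simp: c'_def)
  have same: "c' x = c x" if "\<bar>x\<bar> \<noteq> 1" for x using that \<gamma>(3) by (auto simp: c'_def)
  have odd': "c' (- x) = - c' x" for x
  proof (cases "\<bar>x\<bar> = 1")
    case True
    hence "x = g \<or> x = - g" using \<gamma>(3) by linarith
    thus ?thesis using c'g by auto
  qed (simp add: same odd)
  have tne: "t \<noteq> c x" if "x \<in> points m" for x using t that by force
  have nz: "c' p + c' q \<noteq> 0" if pq: "root_pair m p q" "2 \<le> \<bar>q\<bar>" for p q
  proof (cases "\<bar>p\<bar> = 1")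
    case True
    have q: "q \<in> points m" "- q \<in> points m" using pq(1) by (auto simp: root_pair_def points_def)
    have "p = g \<or> p = - g" using True \<gamma>(3) by linarith
    moreover have "c' q = c q" using pq(2) by (intro same) auto
    ultimately show ?thesis using tne[OF q(1)] tne[OF q(2)] odd[of q] c'g by auto
  next
    case False
    thus ?thesis using same[of p] same[of q] pq genericD(2)[OF c(1) pq(1)] by auto
  qed
  have "generic m c'" unfolding generic_def
  proof (intro conjI allI impI odd')
    fix p q assume pq: "root_pair m p q"
    show "c' p + c' q \<noteq> 0"
    proof (cases "2 \<le> \<bar>q\<bar>")
      case False
      hence "\<bar>q\<bar> = 1" using root_pairD(2)[OF pq] by linarith
      hence "2 \<le> \<bar>p\<bar>" using root_pairD(7)[OF pq] by blast
      thus ?thesis using nz[of q p] pq root_pair_sym[of m p q] by (simp add: add.commute)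
    qed (use nz pq in blast)
  qed
  moreover have "(pos_roots m c' :: 'k weight set) = insert (- root_of g h) (pos_roots m c - {root_of g h})"
  proof (rule pos_roots_crossing[OF c(1) \<open>generic m c'\<close> \<gamma>(2,3) _ simple(1)])
    show "c' x = c x" if "2 \<le> \<bar>x\<bar>" for x using that by (intro same) auto
    show "c' g + c' h < 0" using c'g same[of h] h t(1) by auto
    fix x assume x: "2 \<le> \<bar>x\<bar>" "\<bar>x\<bar> \<le> int m + 1" "x \<noteq> - h"
    have "root_pair m x h" using x h by (intro root_pairI) auto
    hence "c x \<noteq> - c h" using genericD(2)[OF c(1), of x h] by force
    moreover have "x \<in> points m" using x by (auto simp: points_def)
    ultimately show "\<not> (c' g < c x \<and> c x < c g)" using t(2)[of x] simple(2)[OF x(1,2)] c'g(1) by force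
  qed
  ultimately show ?thesis using positive_system_pos_roots unfolding \<gamma>(1) c(2) by metis
qed

section \<open>Even reflections of positive systems\<close>

text \<open>
  The signed permutation of the unit weights induced by the reflection in the even root with the
  unit weights p and q. For p = q, a root \<open>\<plusminus>2 delta i\<close>, it is a sign change.
\<close>

definition refl_perm :: "int \<Rightarrow> int \<Rightarrow> int \<Rightarrow> int" where
  "refl_perm p q x = (if x = p then - q else if x = q then - p
     else if x = - p then q else if x = - q then p else x)"

lemma reflection_add: "reflection m \<alpha> (x + y) = reflection m \<alpha> x + reflection m \<alpha> y"
  by (simp add: reflection_def bform_add_left fun_eq_iff smul_def add_divide_distrib algebra_simps)

lemma reflection_unit_weight:
  assumes "root_pair m p q" "2 \<le> \<bar>p\<bar>" "2 \<le> \<bar>q\<bar>" "x \<in> points m"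
  shows "reflection m (root_of p q) (unit_weight x) = (unit_weight (refl_perm p q x) :: 'k::field_char_0 weight)"
proof -
  have pts: "p \<in> points m" "q \<in> points m" using assms(1) by (auto simp: root_pair_def)
  define N where "N = bint x p + bint x q"
  define D :: int where "D = (if p = q then 4 else 2)"
  have N: "bform m (unit_weight x) (root_of p q :: 'k weight) = of_int N"
    unfolding root_of_def bform_add_right N_def using assms(4) pts by (simp add: bform_unit_weight)
  have "bint p p + bint q p + (bint p q + bint q q) = D"
    using assms(2,3) root_pairD(1-3)[OF assms(1)] by (auto simp: bint_def coord_def D_def)
  hence D: "bform m (root_of p q) (root_of p q :: 'k weight) = of_int D"
    using bform_root_of[OF assms(1) assms(1), where 'a='k] by simp
  have refl: "reflection m (root_of p q) (unit_weight x) = unit_weight x - smul (2 * of_int N / of_int D) (root_of p q :: 'k weight)"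
    unfolding reflection_def N D ..
  have ne: "p \<noteq> - q" "p \<noteq> - p" "q \<noteq> - q" "q \<noteq> - p" using root_pairD(1-3)[OF assms(1)] by auto
  have x0: "x \<noteq> 0" using assms(4) by (auto simp: points_def)
  \<comment> \<open>The reflection coefficient is \<plusminus>1 on \<plusminus>p and \<plusminus>q, both for p = q and for p different from q.\<close>
  have half: "2 * (bint y p + bint y q) = D" if "y = p \<or> y = q" for y
    using that ne assms(2,3) by (auto simp: D_def bint_def coord_def)
  have neg: "bint (- x) z = - bint x z" for z
    using x0 by (auto simp: bint_def coord_def)
  consider "x = p \<or> x = q" | "x = - p \<or> x = - q" | "x \<noteq> p" "x \<noteq> q" "x \<noteq> - p" "x \<noteq> - q" by blast
  thus ?thesis
  proof cases
    case 1
    hence "2 * N = D" unfolding N_def by (rule half)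
    hence "2 * of_int N / of_int D = (1 :: 'k)"
      by (metis D_def divide_self_if of_int_eq_0_iff of_int_mult of_int_numeral zero_neq_numeral)
    hence "reflection m (root_of p q) (unit_weight x) = unit_weight x - (root_of p q :: 'k weight)"
      unfolding refl by (simp add: smul_def)
    thus ?thesis using 1 by (auto simp: refl_perm_def root_of_def)
  next
    case 2
    hence "- x = p \<or> - x = q" by auto
    hence "2 * N = - D" using half[of "- x"] unfolding neg N_def by simp
    hence "2 * of_int N / of_int D = (- 1 :: 'k)"
      by (metis D_def divide_self_if minus_divide_left of_int_eq_0_iff of_int_minus of_int_mult of_int_numeral zero_neq_numeral)
    hence "reflection m (root_of p q) (unit_weight x) = unit_weight x + (root_of p q :: 'k weight)"
      unfolding refl by (simp add: smul_def fun_eq_iff)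
    thus ?thesis using 2 ne by (auto simp: refl_perm_def root_of_def)
  next
    case 3
    hence "p \<noteq> - x" "q \<noteq> - x" by auto
    hence "N = 0" using 3 by (auto simp: N_def bint_def coord_def)
    thus ?thesis using 3 unfolding refl by (simp add: refl_perm_def smul_def fun_eq_iff)
  qed
qed

lemma refl_perm_minus:
  assumes "p \<noteq> 0" "q \<noteq> 0" "p \<noteq> - q"
  shows "refl_perm p q (- x) = - refl_perm p q x"
  using assms by (auto simp: refl_perm_def)

lemma refl_perm_involutive:
  assumes "p \<noteq> 0" "q \<noteq> 0" "p \<noteq> - q"
  shows "refl_perm p q (refl_perm p q x) = x"
  using assms by (auto simp: refl_perm_def)

lemma refl_perm_range:
  assumes "2 \<le> \<bar>p\<bar>" "2 \<le> \<bar>q\<bar>" "\<bar>p\<bar> \<le> int m + 1" "\<bar>q\<bar> \<le> int m + 1"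
  shows "\<bar>refl_perm p q x\<bar> = 1 \<longleftrightarrow> \<bar>x\<bar> = 1" "x \<in> points m \<Longrightarrow> refl_perm p q x \<in> points m"
proof -
  have "\<bar>x\<bar> \<ge> 2 \<and> \<bar>refl_perm p q x\<bar> \<ge> 2 \<and> \<bar>refl_perm p q x\<bar> \<le> int m + 1 \<or> refl_perm p q x = x"
    using assms by (cases "x = p \<or> x = q \<or> x = - p \<or> x = - q") (auto simp: refl_perm_def)
  thus "\<bar>refl_perm p q x\<bar> = 1 \<longleftrightarrow> \<bar>x\<bar> = 1" "x \<in> points m \<Longrightarrow> refl_perm p q x \<in> points m"
    by (auto simp: points_def)
qed

context
  fixes m :: nat and p q :: int
  assumes pq: "root_pair m p q" "2 \<le> \<bar>p\<bar>" "2 \<le> \<bar>q\<bar>"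
begin

lemma refl_perm_root_pair:
  assumes "root_pair m u v"
  shows "root_pair m (refl_perm p q u) (refl_perm p q v)"
proof -
  note D = root_pairD(1-5)[OF pq(1)]
  have "refl_perm p q u \<noteq> - refl_perm p q v"
  proof
    assume "refl_perm p q u = - refl_perm p q v"
    hence "refl_perm p q (refl_perm p q u) = refl_perm p q (refl_perm p q (- v))"
      by (simp add: refl_perm_minus[OF D(1-3)])
    thus False using root_pairD(3)[OF assms] by (simp add: refl_perm_involutive[OF D(1-3)])
  qed
  thus ?thesis using assms refl_perm_range[OF pq(2,3) D(4,5)] unfolding root_pair_def by blast
qed

lemma reflection_root_of:
  assumes "root_pair m u v"
  shows "reflection m (root_of p q) (root_of u v) = (root_of (refl_perm p q u) (refl_perm p q v) :: 'k::field_char_0 weight)"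
  using assms unfolding root_of_def[of u v] reflection_add
  by (simp add: root_of_def[of "refl_perm p q u"] root_pair_def reflection_unit_weight[OF pq])

lemma reflection_involutive:
  assumes "\<alpha> \<in> roots m"
  shows "reflection m (root_of p q) (reflection m (root_of p q) \<alpha>) = (\<alpha> :: 'k::field_char_0 weight)"
proof -
  obtain u v where "\<alpha> = root_of u v" "root_pair m u v" using assms unfolding roots_eq by blast
  thus ?thesis using refl_perm_involutive[OF root_pairD(1-3)[OF pq(1)]]
    by (simp add: reflection_root_of refl_perm_root_pair)
qed

lemma reflection_odd_root:
  assumes "\<alpha> \<in> odd_roots m"
  shows "reflection m (root_of p q) \<alpha> \<in> (odd_roots m :: 'k::field_char_0 weight set)"
proof -
  obtain u v where \<alpha>: "\<alpha> = root_of u v" "root_pair m u v" "\<bar>u\<bar> = 1" using assms unfolding odd_roots_eq by blast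
  have "\<bar>refl_perm p q u\<bar> = 1" using \<alpha>(3) refl_perm_range(1)[OF pq(2,3) root_pairD(4,5)[OF pq(1)]] by blast
  thus ?thesis unfolding odd_roots_eq \<alpha>(1) reflection_root_of[OF \<alpha>(2)] using refl_perm_root_pair[OF \<alpha>(2)] by blast
qed

lemma reflection_uminus:
  assumes "\<alpha> \<in> roots m"
  shows "reflection m (root_of p q) (- \<alpha>) = - (reflection m (root_of p q) \<alpha> :: 'k::field_char_0 weight)"
proof -
  have "reflection m (root_of p q) \<alpha> + reflection m (root_of p q) (- \<alpha>) = reflection m (root_of p q) 0"
    by (simp flip: reflection_add)
  also have "\<dots> = (0 :: 'k weight)" by (simp add: reflection_def bform_def smul_def fun_eq_iff)
  finally show ?thesis by (simp add: eq_neg_iff_add_eq_0 add.commute)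
qed

lemma generic_reflect:
  assumes "generic m c"
  shows "generic m (c \<circ> refl_perm p q)"
  using assms refl_perm_root_pair refl_perm_minus[OF root_pairD(1-3)[OF pq(1)]]
  unfolding generic_def by simp

lemma reflection_pos_roots:
  assumes "generic m c"
  shows "reflection m (root_of p q) ` pos_roots m c = (pos_roots m (c \<circ> refl_perm p q) :: 'k::field_char_0 weight set)"
proof -
  note inv = refl_perm_involutive[OF root_pairD(1-3)[OF pq(1)]]
  have sub: "reflection m (root_of p q) ` pos_roots m c \<subseteq> (pos_roots m (c \<circ> refl_perm p q) :: 'k weight set)" for c
  proof
    fix \<alpha> :: "'k weight" assume "\<alpha> \<in> reflection m (root_of p q) ` pos_roots m c"
    then obtain u v where uv: "\<alpha> = reflection m (root_of p q) (root_of u v)" "root_pair m u v" "c u + c v > 0"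
      unfolding pos_roots_def by blast
    show "\<alpha> \<in> pos_roots m (c \<circ> refl_perm p q)"
      unfolding uv(1) reflection_root_of[OF uv(2)] root_of_in_pos_roots_iff[OF refl_perm_root_pair[OF uv(2)]]
      using uv(3) by (simp add: inv)
  qed
  have "\<alpha> \<in> reflection m (root_of p q) ` pos_roots m c"
    if \<alpha>: "\<alpha> \<in> pos_roots m (c \<circ> refl_perm p q)" for \<alpha> :: "'k weight"
  proof -
    have "reflection m (root_of p q) \<alpha> \<in> pos_roots m (c \<circ> refl_perm p q \<circ> refl_perm p q)"
      using sub \<alpha> by blast
    moreover have "c \<circ> refl_perm p q \<circ> refl_perm p q = c" by (simp add: fun_eq_iff inv)
    moreover have "\<alpha> \<in> roots m" using \<alpha> by (auto simp: pos_roots_def roots_eq)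
    ultimately show ?thesis using reflection_involutive by (metis imageI)
  qed
  thus ?thesis using sub by blast
qed

lemma reflection_positive:
  assumes "m \<ge> 1" "positive_system m (P :: 'k::field_char_0 weight set)"
  shows "positive_system m (reflection m (root_of p q) ` P)"
proof -
  obtain c where c: "generic m c" "P = pos_roots m c" using positive_systemE[OF assms(2,1)] .
  show ?thesis unfolding c(2) reflection_pos_roots[OF c(1)]
    by (rule positive_system_pos_roots[OF generic_reflect[OF c(1)]])
qed

lemma simple_roots_reflection:
  assumes "P \<subseteq> (roots m :: 'k::field_char_0 weight set)"
  shows "simple_roots (reflection m (root_of p q) ` P) = reflection m (root_of p q) ` simple_roots P"
proof -
  let ?s = "reflection m (root_of p q) :: 'k weight \<Rightarrow> _"
  have sum: "?s \<alpha> = ?s \<beta> + ?s \<delta> \<longleftrightarrow> \<alpha> = \<beta> + \<delta>" if "\<alpha> \<in> P" "\<beta> \<in> P" "\<delta> \<in> P" for \<alpha> \<beta> \<delta>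
  proof
    assume "?s \<alpha> = ?s \<beta> + ?s \<delta>"
    hence "?s (?s \<alpha>) = ?s (?s \<beta>) + ?s (?s \<delta>)" by (simp add: reflection_add)
    moreover have "\<alpha> \<in> roots m" "\<beta> \<in> roots m" "\<delta> \<in> roots m" using that assms by auto
    ultimately show "\<alpha> = \<beta> + \<delta>" by (simp add: reflection_involutive)
  qed (simp add: reflection_add)
  show ?thesis unfolding simple_roots_def using sum by (auto; metis)
qed

end

lemma even_rootE:
  assumes "\<alpha> \<in> even_roots m"
  obtains p q where "\<alpha> = root_of p q" "root_pair m p q" "2 \<le> \<bar>p\<bar>" "2 \<le> \<bar>q\<bar>"
  using assms unfolding even_roots_eq by blast

section \<open>The action on positive systems\<close>

text \<open>
  The action of the generators of the super Weyl group on positive systems instead of fundamental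
  systems.
\<close>

definition pos_act :: "nat \<Rightarrow> 'k::field weight \<Rightarrow> 'k weight set \<Rightarrow> 'k weight set" where
  "pos_act m \<theta> P =
     (if \<theta> \<in> even_roots m then reflection m \<theta> ` P
      else if \<theta> \<in> simple_roots P then insert (- \<theta>) (P - {\<theta>})
      else if - \<theta> \<in> simple_roots P then insert \<theta> (P - {- \<theta>})
      else P)"

lemma pos_act_even: "\<theta> \<in> even_roots m \<Longrightarrow> pos_act m \<theta> P = reflection m \<theta> ` P"
  by (simp add: pos_act_def)

lemma pos_act_odd:
  assumes "(\<theta> :: 'k::field_char_0 weight) \<in> odd_roots m"
  shows "pos_act m \<theta> P =
     (if \<theta> \<in> simple_roots P then insert (- \<theta>) (P - {\<theta>})
      else if - \<theta> \<in> simple_roots P then insert \<theta> (P - {- \<theta>})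
      else P)"
  using assms even_odd_disjoint[of m, where 'k='k] by (auto simp: pos_act_def)

lemma root_cases:
  assumes "\<theta> \<in> roots m"
  obtains "\<theta> \<in> even_roots m" | "\<theta> \<in> odd_roots m"
  using assms unfolding roots_def by blast

context
  fixes m :: nat and P :: "'k::field_char_0 weight set" and \<theta> :: "'k weight"
  assumes m: "m \<ge> 1" and P: "positive_system m P" and \<theta>: "\<theta> \<in> roots m"
begin

lemma pos_act_positive: "positive_system m (pos_act m \<theta> P)"
proof (rule root_cases[OF \<theta>])
  assume e: "\<theta> \<in> even_roots m"
  obtain p q where *: "\<theta> = root_of p q" "root_pair m p q" "2 \<le> \<bar>p\<bar>" "2 \<le> \<bar>q\<bar>" using even_rootE[OF e] .
  show ?thesis unfolding pos_act_even[OF e] unfolding *(1) by (rule reflection_positive[OF *(2-4) m P])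
next
  assume o: "\<theta> \<in> odd_roots m"
  thus ?thesis using flip_positive[OF m P o] flip_positive[OF m P odd_roots_uminus[OF o]] P
    by (simp add: pos_act_odd)
qed

lemma rhat_simple_roots: "rhat m \<theta> (simple_roots P) = simple_roots (pos_act m \<theta> P)"
proof -
  have B: "simple_roots P \<in> Borels m" using P unfolding Borels_def by blast
  show ?thesis
  proof (rule root_cases[OF \<theta>])
    assume e: "\<theta> \<in> even_roots m"
    obtain p q where "\<theta> = root_of p q" "root_pair m p q" "2 \<le> \<bar>p\<bar>" "2 \<le> \<bar>q\<bar>" using even_rootE[OF e] .
    thus ?thesis using simple_roots_reflection[OF _ _ _ pos_subset[OF m P]] B e
      by (simp add: pos_act_even rhat_def)
  next
    assume o: "\<theta> \<in> odd_roots m"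
    hence ne: "\<theta> \<notin> even_roots m" using even_odd_disjoint[of m, where 'k='k] by blast
    show ?thesis using B simple_roots_odd_flip[OF m P o] simple_roots_odd_flip[OF m P odd_roots_uminus[OF o]]
      by (simp add: rhat_def ne pos_act_odd[OF o])
  qed
qed

lemma pos_act_involutive: "pos_act m \<theta> (pos_act m \<theta> P) = P"
proof (rule root_cases[OF \<theta>])
  assume e: "\<theta> \<in> even_roots m"
  obtain p q where *: "\<theta> = root_of p q" "root_pair m p q" "2 \<le> \<bar>p\<bar>" "2 \<le> \<bar>q\<bar>" using even_rootE[OF e] .
  have "reflection m \<theta> (reflection m \<theta> \<alpha>) = \<alpha>" if "\<alpha> \<in> P" for \<alpha>
    using reflection_involutive[OF *(2-4)] that pos_subset[OF m P] *(1) by blast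
  thus ?thesis by (simp add: pos_act_even[OF e] image_image)
next
  assume o: "\<theta> \<in> odd_roots m"
  have flip: "pos_act m \<gamma> (insert (- \<gamma>) (P - {\<gamma>})) = P"
    if \<gamma>: "\<gamma> \<in> odd_roots m" "\<gamma> \<in> simple_roots P" for \<gamma>
  proof -
    have r: "\<gamma> \<in> roots m" using \<gamma>(1) odd_subset_roots by blast
    have 1: "\<gamma> \<in> P" "- \<gamma> \<notin> P"
      using simple_rootsD(1)[OF \<gamma>(2)] pos_uminus_iff[OF m P r] by blast+
    hence "\<gamma> \<noteq> - \<gamma>" by metis
    hence "\<gamma> \<notin> simple_roots (insert (- \<gamma>) (P - {\<gamma>}))"
      using simple_rootsD(1) by blast
    thus ?thesis using neg_simple_after_flip[OF m P \<gamma>] 1 by (auto simp: pos_act_odd[OF \<gamma>(1)])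
  qed
  have sym: "pos_act m (- \<theta>) Q = pos_act m \<theta> Q" if "\<not> (\<theta> \<in> simple_roots Q \<and> - \<theta> \<in> simple_roots Q)" for Q
    using that by (simp add: pos_act_odd[OF o] pos_act_odd[OF odd_roots_uminus[OF o]])
  show ?thesis
  proof (cases "\<theta> \<in> simple_roots P")
    case True
    thus ?thesis using flip[OF o] by (simp add: pos_act_odd[OF o, of P])
  next
    case F: False
    show ?thesis
    proof (cases "- \<theta> \<in> simple_roots P")
      case True
      have "- \<theta> \<in> P" "\<theta> \<notin> P"
        using simple_rootsD(1)[OF True] pos_uminus_iff[OF m P \<theta>] by blast+
      hence "\<theta> \<noteq> - \<theta>" by metis
      hence "- \<theta> \<notin> insert \<theta> (P - {- \<theta>})" by (metis DiffD2 insertE singletonI)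
      hence "- \<theta> \<notin> simple_roots (insert \<theta> (P - {- \<theta>}))"
        using simple_rootsD(1) by blast
      thus ?thesis using flip[OF odd_roots_uminus[OF o] True] sym F True
        by (simp add: pos_act_odd[OF o, of P])
    next
      case False
      thus ?thesis using F by (simp add: pos_act_odd[OF o])
    qed
  qed
qed

end

text \<open>
  Conjugating an odd reflection by an even one gives the odd reflection in the reflected root.
\<close>

lemma pos_act_conjugate:
  assumes "m \<ge> 1" "positive_system m (P :: 'k::field_char_0 weight set)"
    and "\<alpha> \<in> even_roots m" "\<gamma> \<in> odd_roots m"
  shows "pos_act m \<alpha> (pos_act m \<gamma> P) = pos_act m (reflection m \<alpha> \<gamma>) (pos_act m \<alpha> P)"
proof -
  obtain p q where \<alpha>: "\<alpha> = root_of p q" and pq: "root_pair m p q" "2 \<le> \<bar>p\<bar>" "2 \<le> \<bar>q\<bar>" using even_rootE[OF assms(3)] .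
  let ?s = "reflection m \<alpha> :: 'k weight \<Rightarrow> _"
  have inv: "?s (?s \<beta>) = \<beta>" if "\<beta> \<in> roots m" for \<beta>
    unfolding \<alpha> by (rule reflection_involutive[OF pq that])
  have PR: "P \<subseteq> roots m" by (rule pos_subset[OF assms(1,2)])
  have SR: "simple_roots P \<subseteq> roots m" using PR by (auto simp: simple_roots_def)
  have mem: "?s \<beta> \<in> ?s ` Q \<longleftrightarrow> \<beta> \<in> Q" if "\<beta> \<in> roots m" "Q \<subseteq> roots m" for \<beta> Q
    using that inv by (auto; metis subsetD)
  have simple: "simple_roots (?s ` P) = ?s ` simple_roots P"
    unfolding \<alpha> by (rule simple_roots_reflection[OF pq PR])
  have diff: "?s ` (P - {\<beta>}) = ?s ` P - {?s \<beta>}" if "\<beta> \<in> roots m" for \<beta>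
    using PR inv that by (auto; metis subsetD)
  have \<gamma>: "\<gamma> \<in> roots m" "- \<gamma> \<in> roots m" using assms(4) odd_subset_roots roots_uminus by blast+
  have neg: "- ?s \<gamma> = ?s (- \<gamma>)" unfolding \<alpha> by (rule reflection_uminus[OF pq \<gamma>(1), symmetric])
  have odd: "?s \<gamma> \<in> odd_roots m" unfolding \<alpha> by (rule reflection_odd_root[OF pq assms(4)])
  show ?thesis
    unfolding pos_act_even[OF assms(3)] pos_act_odd[OF odd] pos_act_odd[OF assms(4)] simple neg
      mem[OF \<gamma>(1) SR] mem[OF \<gamma>(2) SR]
    using diff \<gamma> by simp
qed

section \<open>Orders in the super Weyl group\<close>

lemma rhat_in_Bij:
  assumes "m \<ge> 1" "\<theta> \<in> (roots m :: 'k::field_char_0 weight set)"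
  shows "rhat m \<theta> \<in> Bij (Borels m)"
proof -
  have 1: "rhat m \<theta> B \<in> Borels m \<and> rhat m \<theta> (rhat m \<theta> B) = B" if B: "B \<in> Borels m" for B
  proof -
    obtain P where P: "B = simple_roots P" "positive_system m P" using B unfolding Borels_def by blast
    note pos = pos_act_positive[OF assms(1) P(2) assms(2)]
    have "rhat m \<theta> B = simple_roots (pos_act m \<theta> P)"
      unfolding P(1) by (rule rhat_simple_roots[OF assms(1) P(2) assms(2)])
    moreover have "rhat m \<theta> \<dots> = B"
      unfolding P(1) rhat_simple_roots[OF assms(1) pos assms(2)] pos_act_involutive[OF assms(1) P(2) assms(2)] ..
    ultimately show ?thesis using pos unfolding Borels_def by auto
  qed
  have "bij_betw (rhat m \<theta>) (Borels m) (Borels m)"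
    by (rule bij_betw_byWitness[of _ "rhat m \<theta>"]) (use 1 in auto)
  thus ?thesis by (simp add: Bij_def rhat_def)
qed

context
  fixes m :: nat and W :: "'k::field_char_0 borel_map monoid"
  assumes m: "m \<ge> 1" and W: "W = super_Weyl_group m"
begin

lemma super_Weyl_subgroup:
  "subgroup (generate (BijGroup (Borels m)) (rhat m ` (roots m :: 'k weight set))) (BijGroup (Borels m))"
  using rhat_in_Bij[OF m]
  by (intro group.generate_is_subgroup[OF group_BijGroup]) (auto simp: BijGroup_def)

lemma group_super_Weyl: "group W"
  unfolding W super_Weyl_group_def
  using subgroup.subgroup_is_group[OF super_Weyl_subgroup group_BijGroup] .

lemma super_Weyl_carrier: "x \<in> carrier W \<Longrightarrow> x \<in> Bij (Borels m)"
  using subgroup.subset[OF super_Weyl_subgroup] by (auto simp: W super_Weyl_group_def BijGroup_def)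

lemma rhat_in_carrier: "\<theta> \<in> roots m \<Longrightarrow> rhat m \<theta> \<in> carrier W"
  by (auto simp: W super_Weyl_group_def intro: generate.incl)

lemma super_Weyl_mult:
  assumes "x \<in> carrier W" "y \<in> carrier W"
  shows "x \<otimes>\<^bsub>W\<^esub> y = compose (Borels m) x y"
  using assms[THEN super_Weyl_carrier] by (simp add: W super_Weyl_group_def BijGroup_def)

lemma super_Weyl_one: "\<one>\<^bsub>W\<^esub> = (\<lambda>B\<in>Borels m. B)"
  by (simp add: W super_Weyl_group_def BijGroup_def)

context
  fixes \<theta> \<theta>' :: "'k weight"
  assumes \<theta>: "\<theta> \<in> roots m" "\<theta>' \<in> roots m"
begin

lemma pos_act_funpow_positive:
  assumes "positive_system m P"
  shows "positive_system m (((pos_act m \<theta> \<circ> pos_act m \<theta>') ^^ n) P)"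
  using assms by (induction n) (auto intro!: pos_act_positive m \<theta>)

text \<open>
  Computations in the super Weyl group thereby become iterations of an explicit map on positive
  systems.
\<close>

lemma super_Weyl_pow_apply:
  assumes "positive_system m P"
  shows "((rhat m \<theta> \<otimes>\<^bsub>W\<^esub> rhat m \<theta>') [^]\<^bsub>W\<^esub> n) (simple_roots P) =
    simple_roots (((pos_act m \<theta> \<circ> pos_act m \<theta>') ^^ n) P)"
  using assms
proof (induction n arbitrary: P)
  interpret group W by (rule group_super_Weyl)
  note carr = rhat_in_carrier[OF \<theta>(1)] rhat_in_carrier[OF \<theta>(2)]
  have B: "simple_roots P \<in> Borels m" if "positive_system m P" for P :: "'k weight set"
    using that unfolding Borels_def by blast
  {
    case 0
    show ?case by (simp add: super_Weyl_one B[OF 0])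
  next
    case (Suc n)
    note pos' = pos_act_positive[OF m Suc.prems \<theta>(2)]
    note pos = pos_act_positive[OF m pos' \<theta>(1)]
    let ?z = "rhat m \<theta> \<otimes>\<^bsub>W\<^esub> rhat m \<theta>'"
    have z: "?z \<in> carrier W" using carr by blast
    have "(?z [^]\<^bsub>W\<^esub> Suc n) (simple_roots P) = (?z [^]\<^bsub>W\<^esub> n) (?z (simple_roots P))"
      using z by (simp add: super_Weyl_mult compose_eq B[OF Suc.prems])
    also have "?z (simple_roots P) = simple_roots ((pos_act m \<theta> \<circ> pos_act m \<theta>') P)"
      using carr B[OF Suc.prems]
      by (simp add: super_Weyl_mult compose_eq rhat_simple_roots[OF m Suc.prems \<theta>(2)] rhat_simple_roots[OF m pos' \<theta>(1)])
    also have "(?z [^]\<^bsub>W\<^esub> n) \<dots> = simple_roots (((pos_act m \<theta> \<circ> pos_act m \<theta>') ^^ Suc n) P)"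
      using Suc.IH[OF pos] by (simp add: funpow_Suc_right comp_def del: funpow.simps)
    finally show ?case .
  }
qed

lemma ord_dvd_iff:
  "group.ord W (rhat m \<theta> \<otimes>\<^bsub>W\<^esub> rhat m \<theta>') dvd n \<longleftrightarrow>
    (\<forall>P. positive_system m P \<longrightarrow> ((pos_act m \<theta> \<circ> pos_act m \<theta>') ^^ n) P = P)"
proof -
  interpret group W by (rule group_super_Weyl)
  let ?z = "rhat m \<theta> \<otimes>\<^bsub>W\<^esub> rhat m \<theta>'"
  have z: "?z \<in> carrier W" "?z [^]\<^bsub>W\<^esub> n \<in> carrier W" using rhat_in_carrier \<theta> by blast+
  have ext: "?z [^]\<^bsub>W\<^esub> n \<in> extensional (Borels m)"
    using super_Weyl_carrier[OF z(2)] by (rule Bij_imp_extensional)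
  have "ord ?z dvd n \<longleftrightarrow> ?z [^]\<^bsub>W\<^esub> n = \<one>\<^bsub>W\<^esub>" using pow_eq_id[OF z(1)] by blast
  also have "\<dots> \<longleftrightarrow> (\<forall>B\<in>Borels m. (?z [^]\<^bsub>W\<^esub> n) B = B)"
  proof
    assume "\<forall>B\<in>Borels m. (?z [^]\<^bsub>W\<^esub> n) B = B"
    thus "?z [^]\<^bsub>W\<^esub> n = \<one>\<^bsub>W\<^esub>" unfolding super_Weyl_one
      by (intro extensionalityI[OF ext]) auto
  qed (simp add: super_Weyl_one)
  also have "\<dots> \<longleftrightarrow> (\<forall>P. positive_system m P \<longrightarrow> ((pos_act m \<theta> \<circ> pos_act m \<theta>') ^^ n) P = P)"
    using super_Weyl_pow_apply simple_roots_inj[OF m pos_act_funpow_positive]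
    unfolding Borels_def by fastforce
  finally show ?thesis .
qed

text \<open>
  The generators are involutions, so the two products are inverse to each other.
\<close>

lemma ord_commute:
  "group.ord W (rhat m \<theta>' \<otimes>\<^bsub>W\<^esub> rhat m \<theta>) = group.ord W (rhat m \<theta> \<otimes>\<^bsub>W\<^esub> rhat m \<theta>')"
proof -
  interpret group W by (rule group_super_Weyl)
  have inv: "inv\<^bsub>W\<^esub> (rhat m \<eta>) = rhat m \<eta>" if \<eta>: "\<eta> \<in> roots m" for \<eta> :: "'k weight"
  proof (rule inv_equality)
    show c: "rhat m \<eta> \<in> carrier W" "rhat m \<eta> \<in> carrier W" using rhat_in_carrier[OF \<eta>] by blast+
    show "rhat m \<eta> \<otimes>\<^bsub>W\<^esub> rhat m \<eta> = \<one>\<^bsub>W\<^esub>"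
      unfolding super_Weyl_mult[OF c] super_Weyl_one
    proof (rule extensionalityI[of _ "Borels m"])
      fix B :: "'k weight set" assume B: "B \<in> Borels m"
      then obtain P where P: "B = simple_roots P" "positive_system m P" unfolding Borels_def by blast
      have "rhat m \<eta> (rhat m \<eta> B) = B"
        unfolding P(1) rhat_simple_roots[OF m P(2) \<eta>]
          rhat_simple_roots[OF m pos_act_positive[OF m P(2) \<eta>] \<eta>] pos_act_involutive[OF m P(2) \<eta>] ..
      thus "compose (Borels m) (rhat m \<eta>) (rhat m \<eta>) B = (\<lambda>B\<in>Borels m. B) B"
        using B by (simp add: compose_eq)
    qed auto
  qed
  have c: "rhat m \<theta> \<in> carrier W" "rhat m \<theta>' \<in> carrier W" using rhat_in_carrier \<theta> by blast+
  have "rhat m \<theta>' \<otimes>\<^bsub>W\<^esub> rhat m \<theta> = inv\<^bsub>W\<^esub> (rhat m \<theta> \<otimes>\<^bsub>W\<^esub> rhat m \<theta>')"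
    using c \<theta> by (simp add: inv_mult_group inv)
  thus ?thesis using c by simp
qed

end

end

section \<open>The product of two odd reflections\<close>

lemma funpow_fixed: "f x = x \<Longrightarrow> (f ^^ n) x = x"
  by (induction n) auto

text \<open>
  Only the signs of \<open>\<gamma>\<close> and \<open>\<gamma>'\<close> can change, and the constant sign of their difference rules out one
  of the four patterns. So the orbits of this bijection have length at most 3, and 6 is a common
  multiple of 1, 2 and 3.
\<close>

lemma two_odd_reflections_order:
  assumes "m \<ge> 1" "\<gamma> \<in> odd_roots m" "\<gamma>' \<in> odd_roots m" "\<gamma>' - \<gamma> \<in> (roots m :: 'k::field_char_0 weight set)"
    and P: "positive_system m P"
  shows "((pos_act m \<gamma> \<circ> pos_act m \<gamma>') ^^ 6) P = P"
proof -
  define T where "T = pos_act m \<gamma> \<circ> pos_act m \<gamma>'"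
  define N where "N = {\<gamma>, - \<gamma>, \<gamma>', - \<gamma>'}"
  have r: "\<gamma> \<in> roots m" "\<gamma>' \<in> roots m" using assms(2,3) odd_subset_roots by blast+
  have zero: "(0 :: 'k weight) \<notin> roots m"
  proof
    assume "(0 :: 'k weight) \<in> roots m"
    from pos_uminus_iff[OF assms(1) P this] show False by simp
  qed
  have \<delta>N: "\<gamma>' - \<gamma> \<notin> N"
  proof
    assume "\<gamma>' - \<gamma> \<in> N"
    hence "\<gamma>' = \<gamma> + \<gamma> \<or> \<gamma>' = 0 \<or> \<gamma> = 0 \<or> \<gamma> = \<gamma>' + \<gamma>'"
      by (auto simp: N_def diff_eq_eq eq_diff_eq)
    thus False using r zero double_odd_not_root[OF assms(2)] double_odd_not_root[OF assms(3)] by metis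
  qed
  have T_pos: "positive_system m (T Q)" if "positive_system m Q" for Q
    unfolding T_def comp_apply using that assms(1) r by (intro pos_act_positive)
  have T_N: "T Q - N = Q - N" for Q
    by (auto simp: T_def N_def pos_act_odd[OF assms(2)] pos_act_odd[OF assms(3)])
  have T_inj: "Q = Q'" if "positive_system m Q" "positive_system m Q'" "T Q = T Q'" for Q Q'
  proof -
    have "pos_act m \<gamma>' (pos_act m \<gamma> (T X)) = X" if "positive_system m X" for X
      using that pos_act_positive[OF assms(1) that r(2)] assms(1) r
      by (simp add: T_def pos_act_involutive)
    thus ?thesis using that by metis
  qed
  have pos: "positive_system m ((T ^^ k) P)" for k by (induction k) (auto intro: T_pos P)
  have N: "(T ^^ k) P - N = P - N" for k by (induction k) (auto simp: T_N)
  define pat where "pat k = (\<gamma> \<in> (T ^^ k) P, \<gamma>' \<in> (T ^^ k) P)" for k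
  define A where "A = (if \<gamma>' - \<gamma> \<in> P then {(True, True), (False, True), (False, False)}
    else {(True, True), (True, False), (False, False)})"
  \<comment> \<open>One pattern is impossible because \<gamma>' is the sum of \<gamma> and their difference.\<close>
  have patA: "pat k \<in> A" for k
  proof (cases "\<gamma>' - \<gamma> \<in> P")
    case True
    hence "\<gamma>' - \<gamma> \<in> (T ^^ k) P" using N[of k] \<delta>N by blast
    hence "\<gamma> \<in> (T ^^ k) P \<Longrightarrow> \<gamma>' \<in> (T ^^ k) P"
      using pos_add[OF assms(1) pos, of \<gamma> k "\<gamma>' - \<gamma>"] r(2) by simp
    thus ?thesis using True by (auto simp: pat_def A_def)
  next
    case False
    hence "\<gamma>' - \<gamma> \<notin> (T ^^ k) P" using N[of k] \<delta>N by blast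
    hence "\<gamma> - \<gamma>' \<in> (T ^^ k) P" using pos_uminus_iff[OF assms(1) pos assms(4), of k] by simp
    hence "\<gamma>' \<in> (T ^^ k) P \<Longrightarrow> \<gamma> \<in> (T ^^ k) P"
      using pos_add[OF assms(1) pos, of \<gamma>' k "\<gamma> - \<gamma>'"] r(1) by simp
    thus ?thesis using False by (auto simp: pat_def A_def)
  qed
  \<comment> \<open>Four consecutive members of the orbit show at most three patterns.\<close>
  have "\<not> inj_on pat {0..3}"
  proof
    assume "inj_on pat {0..3}"
    moreover have "finite A" by (simp add: A_def)
    ultimately have "card {0..3::nat} \<le> card A" using patA by (intro card_inj_on_le[of pat]) blast+
    thus False by (simp add: A_def split: if_splits)
  qed
  then obtain i j where ij: "i < j" "j \<le> 3" "pat i = pat j"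
    unfolding inj_on_def by (metis atLeastAtMost_iff linorder_neqE_nat)
  have "(T ^^ i) P = (T ^^ j) P"
  proof (rule pos_eqI[OF assms(1) pos pos subsetI])
    fix \<alpha> assume \<alpha>: "\<alpha> \<in> (T ^^ i) P"
    show "\<alpha> \<in> (T ^^ j) P"
    proof (cases "\<alpha> \<in> N")
      case False
      thus ?thesis using \<alpha> N[of i] N[of j] by blast
    next
      case True
      thus ?thesis using \<alpha> ij(3) pos_uminus_iff[OF assms(1) pos r(1)] pos_uminus_iff[OF assms(1) pos r(2)]
        by (auto simp: N_def pat_def)
    qed
  qed
  moreover have "(T ^^ j) P = (T ^^ i) ((T ^^ (j - i)) P)"
    using ij(1) by (metis add_diff_inverse_nat comp_apply funpow_add not_less_iff_gr_or_eq)
  moreover have "X = Y"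
    if "positive_system m X" "positive_system m Y" "(T ^^ i) X = (T ^^ i) Y" for X Y i
    using that
  proof (induction i arbitrary: X Y)
    case (Suc i)
    have "(T ^^ i) (T X) = (T ^^ i) (T Y)"
      using Suc.prems(3) by (simp add: funpow_Suc_right del: funpow.simps)
    hence "T X = T Y" using Suc.IH[OF T_pos T_pos] Suc.prems(1,2) by blast
    thus ?case using T_inj Suc.prems(1,2) by blast
  qed simp
  ultimately have fixd: "(T ^^ (j - i)) P = P" using pos P by metis
  have "j - i \<in> {1, 2, 3}" using ij by auto
  then obtain k where "6 = (j - i) * k" by auto
  hence "(T ^^ 6) P = (((T ^^ (j - i)) ^^ k) P)" by (simp add: funpow_mult)
  thus ?thesis using funpow_fixed[of "T ^^ (j - i)", OF fixd] by (simp add: T_def)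
qed

section \<open>Signed permutations along the chain\<close>

text \<open>
  The standard simple roots in the order of the Dynkin diagram: i = 1 is the odd root
  \<open>eps1 - delta 1\<close>, and i = m + 1 is \<open>2 delta m\<close>. In this numbering neighbours in the chain have
  consecutive indices.
\<close>

definition chain_root :: "nat \<Rightarrow> nat \<Rightarrow> 'k::field weight" where
  "chain_root m i = root_of (int i) (if i = m + 1 then int i else - (int i + 1))"

lemma chain_root_pair:
  assumes "m \<ge> 1" "i \<in> {1..m + 1}"
  shows "root_pair m (int i) (if i = m + 1 then int i else - (int i + 1))"
  using assms by (intro root_pairI) auto

lemma chain_root_in_roots: "m \<ge> 1 \<Longrightarrow> i \<in> {1..m + 1} \<Longrightarrow> chain_root m i \<in> roots m"
  unfolding chain_root_def by (rule root_of_in_roots[OF chain_root_pair])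

lemma chain_root_even: "m \<ge> 1 \<Longrightarrow> i \<in> {2..m + 1} \<Longrightarrow> chain_root m i \<in> even_roots m"
  unfolding chain_root_def even_roots_eq using chain_root_pair[of m i] by fastforce

lemma chain_root_odd:
  assumes "m \<ge> 1"
  shows "chain_root m 1 = (root_of 1 (- 2) :: 'k::field weight)" "(chain_root m 1 :: 'k weight) \<in> odd_roots m"
proof -
  show 1: "chain_root m 1 = (root_of 1 (- 2) :: 'k weight)" using assms by (simp add: chain_root_def)
  have "root_pair m 1 (- 2)" using assms by (intro root_pairI) auto
  thus "(chain_root m 1 :: 'k weight) \<in> odd_roots m" unfolding 1 odd_roots_eq by fastforce
qed

definition chain_refl :: "nat \<Rightarrow> nat \<Rightarrow> int \<Rightarrow> int" where
  "chain_refl m i = refl_perm (int i) (if i = m + 1 then int i else - (int i + 1))"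

lemma chain_refl_swap:
  "1 \<le> i \<Longrightarrow> i \<le> m \<Longrightarrow> chain_refl m i x =
    (if x = int i then int i + 1 else if x = int i + 1 then int i
     else if x = - int i then - (int i + 1) else if x = - (int i + 1) then - int i else x)"
  unfolding chain_refl_def refl_perm_def by auto

lemma chain_refl_last:
  "chain_refl m (m + 1) x = (if \<bar>x\<bar> = int m + 1 then - x else x)"
  unfolding chain_refl_def refl_perm_def by auto

lemma chain_refl_involutive: "1 \<le> i \<Longrightarrow> chain_refl m i (chain_refl m i x) = x"
  unfolding chain_refl_def by (rule refl_perm_involutive) auto

lemma chain_refl_fixes:
  assumes "1 \<le> i" "i \<le> m + 1" "\<bar>x\<bar> \<noteq> int i" "i = m + 1 \<or> \<bar>x\<bar> \<noteq> int i + 1"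
  shows "chain_refl m i x = x"
  using assms unfolding chain_refl_def refl_perm_def by (auto simp: abs_if split: if_splits)

lemma chain_refl_moves:
  assumes "1 \<le> i" "i \<le> m + 1" "\<bar>x\<bar> = int i \<or> i \<le> m \<and> \<bar>x\<bar> = int i + 1"
  shows "\<bar>chain_refl m i x\<bar> = int i \<or> i \<le> m \<and> \<bar>chain_refl m i x\<bar> = int i + 1"
proof -
  have "x = int i \<or> x = - int i \<or> i \<le> m \<and> (x = int i + 1 \<or> x = - (int i + 1))"
    using assms(1,3) by linarith
  thus ?thesis using assms(1,2) unfolding chain_refl_def refl_perm_def by auto
qed

lemma chain_refl_commute:
  assumes "1 \<le> i" "i + 2 \<le> j" "j \<le> m + 1"
  shows "chain_refl m i (chain_refl m j x) = chain_refl m j (chain_refl m i x)"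
proof -
  let ?in = "\<lambda>i x. \<bar>x\<bar> = int i \<or> i \<le> m \<and> \<bar>x\<bar> = int i + 1"
  have fixd: "chain_refl m k x = x" if "\<not> ?in k x" "1 \<le> k" "k \<le> m + 1" for k x
    using that by (intro chain_refl_fixes) auto
  have ij: "\<not> (?in i x \<and> ?in j x)" for x using assms by auto
  have mv: "?in k x \<Longrightarrow> ?in k (chain_refl m k x)" if "1 \<le> k" "k \<le> m + 1" for k x
    using chain_refl_moves[OF that] .
  have b: "1 \<le> i" "i \<le> m + 1" "1 \<le> j" "j \<le> m + 1" using assms by auto
  show ?thesis
  proof (cases "?in i x")
    case True
    have "chain_refl m j x = x" using True ij b by (intro fixd) blast+
    moreover have "chain_refl m j (chain_refl m i x) = chain_refl m i x"
      using mv[OF b(1,2) True] ij b by (intro fixd) blast+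
    ultimately show ?thesis by simp
  next
    case F: False
    have i: "chain_refl m i x = x" using F b by (intro fixd) blast+
    show ?thesis
    proof (cases "?in j x")
      case True
      have "chain_refl m i (chain_refl m j x) = chain_refl m j x"
        using mv[OF b(3,4) True] ij b by (intro fixd) blast+
      thus ?thesis using i by simp
    next
      case False
      have "chain_refl m j x = x" using False b by (intro fixd) blast+
      thus ?thesis using i by simp
    qed
  qed
qed

text \<open>
  The product is a 3-cycle on i, i + 1, i + 2.
\<close>

lemma chain_refl_order_3:
  assumes "1 \<le> i" "i + 1 \<le> m"
  shows "((chain_refl m (i + 1) \<circ> chain_refl m i) ^^ 3) x = x"
proof -
  define g where "g = chain_refl m (i + 1) \<circ> chain_refl m i"
  have g: "g x = (if x = int i then int i + 2 else if x = int i + 1 then int i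
     else if x = int i + 2 then int i + 1 else if x = - int i then - (int i + 2)
     else if x = - (int i + 1) then - int i else if x = - (int i + 2) then - (int i + 1) else x)" for x
    using assms by (auto simp: g_def chain_refl_swap)
  have "g (g (g x)) = x" using assms by (auto simp: g)
  thus ?thesis unfolding g_def[symmetric] by (simp add: numeral_3_eq_3)
qed

text \<open>
  The product is a rotation by a right angle in the plane of the last two coordinates; its square is
  the negation there.
\<close>

lemma chain_refl_order_4:
  assumes "1 \<le> m"
  shows "((chain_refl m (m + 1) \<circ> chain_refl m m) ^^ 4) x = x"
    and "((chain_refl m (m + 1) \<circ> chain_refl m m) ^^ 2) (int m + 1) = - (int m + 1)"
proof -
  define g where "g = chain_refl m (m + 1) \<circ> chain_refl m m"
  have g: "g x = (if x = int m then - (int m + 1) else if x = int m + 1 then int m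
     else if x = - int m then int m + 1 else if x = - (int m + 1) then - int m else x)" for x
    using assms by (auto simp: g_def chain_refl_swap[OF assms order.refl] chain_refl_last simp del: One_nat_def)
  have "g (g (g (g x))) = x" using assms by (auto simp: g)
  thus "((chain_refl m (m + 1) \<circ> chain_refl m m) ^^ 4) x = x"
    unfolding g_def[symmetric] by (simp add: eval_nat_numeral)
  have "g (g (int m + 1)) = - (int m + 1)" using assms by (auto simp: g)
  thus "((chain_refl m (m + 1) \<circ> chain_refl m m) ^^ 2) (int m + 1) = - (int m + 1)"
    unfolding g_def[symmetric] by (simp add: numeral_2_eq_2)
qed

lemma chain_root_act:
  assumes "m \<ge> 1" "i \<in> {2..m + 1}" "generic m c"
  shows "pos_act m (chain_root m i) (pos_roots m c) = (pos_roots m (c \<circ> chain_refl m i) :: 'k::field_char_0 weight set)"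
    and "generic m (c \<circ> chain_refl m i)"
proof -
  have pq: "root_pair m (int i) (if i = m + 1 then int i else - (int i + 1))"
    using chain_root_pair assms(1,2) by simp
  have ge: "2 \<le> \<bar>int i\<bar>" "2 \<le> \<bar>if i = m + 1 then int i else - (int i + 1)\<bar>" using assms(2) by auto
  show "generic m (c \<circ> chain_refl m i)" unfolding chain_refl_def by (rule generic_reflect[OF pq ge assms(3)])
  show "pos_act m (chain_root m i) (pos_roots m c) = (pos_roots m (c \<circ> chain_refl m i) :: 'k weight set)"
    unfolding pos_act_even[OF chain_root_even[OF assms(1,2)]] unfolding chain_refl_def chain_root_def
    by (rule reflection_pos_roots[OF pq ge assms(3)])
qed

text \<open>
  Acting on functionals reverses the order of the factors.
\<close>

lemma even_chain_pow:
  assumes "m \<ge> 1" "i \<in> {2..m + 1}" "j \<in> {2..m + 1}" "generic m c"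
  shows "((pos_act m (chain_root m i) \<circ> pos_act m (chain_root m j)) ^^ n) (pos_roots m c) =
    (pos_roots m (c \<circ> (chain_refl m j \<circ> chain_refl m i) ^^ n) :: 'k::field_char_0 weight set)"
  using assms(4)
proof (induction n arbitrary: c)
  case (Suc n)
  note j = chain_root_act[OF assms(1,3) Suc.prems]
  note i = chain_root_act[OF assms(1,2) j(2)]
  have "((pos_act m (chain_root m i) \<circ> pos_act m (chain_root m j)) ^^ Suc n) (pos_roots m c) =
      ((pos_act m (chain_root m i) \<circ> pos_act m (chain_root m j)) ^^ n)
        (pos_roots m (c \<circ> chain_refl m j \<circ> chain_refl m i) :: 'k weight set)"
    by (simp add: funpow_Suc_right j(1) i(1) del: funpow.simps)
  also have "\<dots> = pos_roots m (c \<circ> (chain_refl m j \<circ> chain_refl m i) ^^ Suc n)"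
    unfolding Suc.IH[OF i(2)] by (simp add: comp_assoc)
  finally show ?case .
qed simp

section \<open>Explicit positive systems\<close>

definition odd_extension :: "(int \<Rightarrow> real) \<Rightarrow> int \<Rightarrow> real" where
  "odd_extension d x = of_int (sgn x) * d \<bar>x\<bar>"

lemma odd_extension_pos [simp]: "x > 0 \<Longrightarrow> odd_extension d x = d x"
  by (simp add: odd_extension_def)

lemma odd_extension_minus [simp]: "odd_extension d (- x) = - odd_extension d x"
  by (simp add: odd_extension_def sgn_minus)

lemma generic_odd_extension:
  assumes "\<And>x y. 1 \<le> x \<Longrightarrow> x \<le> int m + 1 \<Longrightarrow> 1 \<le> y \<Longrightarrow> y \<le> int m + 1 \<Longrightarrow> \<bar>d x\<bar> = \<bar>d y\<bar> \<Longrightarrow> x = y"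
    and "\<And>x. 1 \<le> x \<Longrightarrow> x \<le> int m + 1 \<Longrightarrow> d x \<noteq> 0"
  shows "generic m (odd_extension d)"
  unfolding generic_def
proof (intro conjI allI impI)
  fix p q assume pq: "root_pair m p q"
  have b: "1 \<le> \<bar>p\<bar>" "1 \<le> \<bar>q\<bar>" "\<bar>p\<bar> \<le> int m + 1" "\<bar>q\<bar> \<le> int m + 1"
    using pq by (auto simp: root_pair_def points_def)
  have abs: "\<bar>odd_extension d x\<bar> = \<bar>d \<bar>x\<bar>\<bar>" if "x \<noteq> 0" for x
    using that by (cases "x > 0") (auto simp: odd_extension_def)
  show "odd_extension d p + odd_extension d q \<noteq> 0"
  proof
    assume 0: "odd_extension d p + odd_extension d q = 0"
    hence "\<bar>odd_extension d p\<bar> = \<bar>odd_extension d q\<bar>" by linarith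
    hence "\<bar>d \<bar>p\<bar>\<bar> = \<bar>d \<bar>q\<bar>\<bar>" using abs[of p] abs[of q] b by auto
    hence "\<bar>p\<bar> = \<bar>q\<bar>" using assms(1) b by blast
    hence "p = q" using root_pairD(3)[OF pq] by linarith
    hence "odd_extension d p = 0" using 0 by simp
    hence "d \<bar>p\<bar> = 0" using abs[of p] b by auto
    thus False using assms(2) b by blast
  qed
qed simp

text \<open>
  It defines the standard Borel subalgebra: its values are m + 1 on eps1 and m, ..., 1 on delta 1,
  ..., delta m.
\<close>

definition standard_functional :: "nat \<Rightarrow> int \<Rightarrow> real" where
  "standard_functional m = odd_extension (\<lambda>x. real m + 2 - of_int x)"

lemma standard_functional_pos: "x > 0 \<Longrightarrow> standard_functional m x = real m + 2 - of_int x"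
  by (simp add: standard_functional_def)

lemma generic_standard_functional: "generic m (standard_functional m)"
  unfolding standard_functional_def by (rule generic_odd_extension) auto

text \<open>
  The point of x separates the two points compared by the odd root, so the odd reflection fixes the
  positive system.
\<close>

lemma pos_act_skip:
  assumes "generic m c" "root_pair m g h" "\<bar>g\<bar> = 1" "2 \<le> \<bar>x\<bar>" "\<bar>x\<bar> \<le> int m + 1"
    and "- c h < c x \<and> c x < c g \<or> c g < c x \<and> c x < - c h"
  shows "pos_act m (root_of g h) (pos_roots m c) = (pos_roots m c :: 'k::field_char_0 weight set)"
proof -
  have odd: "(root_of g h :: 'k weight) \<in> odd_roots m" using assms(2,3) unfolding odd_roots_eq by blast
  note odd_c = genericD(1)[OF assms(1)]
  have "root_of g h \<notin> simple_roots (pos_roots m c :: 'k weight set)"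
    using simple_odd_iff[OF assms(1-3), where 'k='k] assms(4-6) by force
  moreover have "root_of (- g) (- h) \<notin> simple_roots (pos_roots m c :: 'k weight set)"
  proof
    assume "root_of (- g) (- h) \<in> simple_roots (pos_roots m c :: 'k weight set)"
    hence "c (- g) + c (- h) > 0" "\<not> (- c (- h) < c (- x) \<and> c (- x) < c (- g))"
      using simple_odd_iff[OF assms(1), of "- g" "- h", where 'k='k] assms(2-5) by force+
    thus False using assms(6) odd_c[of g] odd_c[of h] odd_c[of x] by linarith
  qed
  ultimately show ?thesis by (simp add: pos_act_odd[OF odd] root_of_minus)
qed

lemma pos_act_cross:
  assumes "generic m c" "generic m c'" "root_pair m g h" "\<bar>g\<bar> = 1"
    and "\<And>x. 2 \<le> \<bar>x\<bar> \<Longrightarrow> \<bar>x\<bar> \<le> int m + 1 \<Longrightarrow> c' x = c x"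
    and "c g + c h > 0" "c' g + c' h < 0"
    and between: "\<And>x. 2 \<le> \<bar>x\<bar> \<Longrightarrow> \<bar>x\<bar> \<le> int m + 1 \<Longrightarrow> x \<noteq> - h \<Longrightarrow> \<not> (c' g < c x \<and> c x < c g)"
  shows "pos_act m (root_of g h) (pos_roots m c) = (pos_roots m c' :: 'k::field_char_0 weight set)"
proof -
  have odd: "(root_of g h :: 'k weight) \<in> odd_roots m" using assms(3,4) unfolding odd_roots_eq by blast
  have h: "2 \<le> \<bar>h\<bar>" "\<bar>h\<bar> \<le> int m + 1" using root_pairD[OF assms(3)] assms(4) by blast+
  have "c' g < - c h" using assms(5)[OF h] assms(7) by simp
  moreover have "c (- h) = - c h" by (rule genericD(1)[OF assms(1)])
  ultimately have "root_of g h \<in> simple_roots (pos_roots m c :: 'k weight set)"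
    unfolding simple_odd_iff[OF assms(1,3,4)] using assms(6) between by force
  thus ?thesis
    using pos_roots_crossing[OF assms, where 'k='k] by (simp add: pos_act_odd[OF odd])
qed

text \<open>
  A simple reflection makes its own simple root negative and keeps the other simple roots positive,
  which distinguishes the generators of the chain.
\<close>

lemma chain_roots_separated:
  assumes "m \<ge> 1" "1 \<le> i" "i < j" "j \<le> m + 1"
  defines "P \<equiv> (pos_roots m (standard_functional m) :: 'k::field_char_0 weight set)"
  shows "chain_root m i \<in> pos_act m (chain_root m j) P" "chain_root m i \<notin> pos_act m (chain_root m i) P"
proof -
  note odd = genericD(1)[OF generic_standard_functional]
  have im: "i \<le> m" using assms by simp
  have root: "chain_root m i = root_of (int i) (- (int i + 1))" using im by (simp add: chain_root_def)
  have pr: "root_pair m (int i) (- (int i + 1))" using chain_root_pair[of m i] assms(1,2) im by simp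
  have "standard_functional m (chain_refl m j (int i)) + standard_functional m (chain_refl m j (- (int i + 1))) > 0"
  proof (cases "j = m + 1")
    case True
    show ?thesis unfolding True chain_refl_last
      using im assms(2) odd[of m "int i + 1"] by (auto simp: standard_functional_pos)
  next
    case False
    thus ?thesis using assms(2-4) odd[of m "int i + 1"] odd[of m "int j + 1"]
      by (auto simp: chain_refl_swap standard_functional_pos)
  qed
  moreover have j: "j \<in> {2..m + 1}" using assms(2-4) by simp
  ultimately show "chain_root m i \<in> pos_act m (chain_root m j) P"
    unfolding P_def chain_root_act(1)[OF assms(1) j generic_standard_functional] root root_of_in_pos_roots_iff[OF pr] comp_apply by blast
  show "chain_root m i \<notin> pos_act m (chain_root m i) P"
  proof (cases "i = 1")
    case True
    have rt1: "chain_root m i = root_of 1 (- 2)" using True root by simp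
    have pr1: "root_pair m 1 (- 2)" using pr True by simp
    have S: "root_of 1 (- 2) \<in> simple_roots P" unfolding P_def simple_odd_iff[OF generic_standard_functional pr1 abs_one]
    proof (intro conjI allI impI)
      show "standard_functional m 1 + standard_functional m (- 2) > 0" using odd[of m 2] by (simp add: standard_functional_pos)
      fix x :: int assume x: "2 \<le> \<bar>x\<bar> \<and> \<bar>x\<bar> \<le> int m + 1"
      have "standard_functional m x \<le> real m"
      proof (cases "x > 0")
        case True
        hence "real_of_int x \<ge> 2" using x by simp
        thus ?thesis using True by (simp add: standard_functional_pos)
      next
        case False
        hence "standard_functional m x = - (real m + 2 - of_int (- x))" using odd[of m "- x"] x by (simp add: standard_functional_pos)
        moreover have "real_of_int (- x) \<le> real m + 1" using x by linarith
        ultimately show ?thesis by simp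
      qed
      thus "\<not> (- standard_functional m (- 2) < standard_functional m x \<and> standard_functional m x < standard_functional m 1)"
        using odd[of m 2] by (simp add: standard_functional_pos)
    qed
    have "- root_of 1 (- 2) \<notin> P"
      using pos_uminus_iff[OF assms(1) positive_system_pos_roots[OF generic_standard_functional] root_of_in_roots[OF pr1], where 'k='k]
        simple_rootsD(1)[OF S] unfolding P_def by blast
    hence "root_of 1 (- 2) \<noteq> (- root_of 1 (- 2) :: 'k weight)" using simple_rootsD(1)[OF S] by metis
    moreover have "pos_act m (chain_root m i) P = insert (- root_of 1 (- 2)) (P - {root_of 1 (- 2)})"
      using chain_root_odd[OF assms(1), where 'k='k] S True by (simp add: pos_act_odd)
    ultimately show ?thesis unfolding rt1 by (metis Diff_iff insertE singletonI)
  next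
    case False
    hence i: "i \<in> {2..m + 1}" using assms by simp
    show ?thesis unfolding P_def chain_root_act(1)[OF assms(1) i generic_standard_functional] unfolding root root_of_in_pos_roots_iff[OF pr]
      using assms(2) im odd[of m "int i"] odd[of m "int i + 1"] by (simp add: chain_refl_swap standard_functional_pos)
  qed
qed

text \<open>
  The value e belongs to eps1, 3 to delta 1 and a to delta 2; all further values are so small that
  they do not interfere near the points 2 and 3.
\<close>

definition witness_functional :: "real \<Rightarrow> real \<Rightarrow> int \<Rightarrow> real" where
  "witness_functional a e = odd_extension (\<lambda>x. if x = 1 then e else if x = 2 then 3 else if x = 3 then a else 1 / of_int x)"

lemma witness_functional_values [simp]:
  "witness_functional a e 1 = e" "witness_functional a e 2 = 3" "witness_functional a e 3 = a" "witness_functional a e (- x) = - witness_functional a e x"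
  by (simp_all add: witness_functional_def)

lemma witness_functional_small:
  assumes "4 \<le> \<bar>x\<bar>"
  shows "\<bar>witness_functional a e x\<bar> < 1" "witness_functional a e x = witness_functional a e' x"
proof -
  have "\<bar>x\<bar> \<noteq> 1" "\<bar>x\<bar> \<noteq> 2" "\<bar>x\<bar> \<noteq> 3" using assms by auto
  hence 1: "witness_functional a e x = of_int (sgn x) * (1 / of_int \<bar>x\<bar>)" for e by (simp add: witness_functional_def odd_extension_def)
  have "x \<noteq> 0" using assms by auto
  hence "\<bar>real_of_int (sgn x)\<bar> = 1" by (cases "x > 0") auto
  thus "\<bar>witness_functional a e x\<bar> < 1" using assms unfolding 1 abs_mult by simp
  show "witness_functional a e x = witness_functional a e' x" unfolding 1 ..
qed

lemma generic_witness_functional: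
  assumes "\<bar>a\<bar> = 2" "e \<in> {4, 5/2, 3/2}"
  shows "generic m (witness_functional a e)"
  unfolding witness_functional_def
proof (rule generic_odd_extension)
  let ?d = "\<lambda>x. if x = 1 then e else if x = 2 then 3 else if x = 3 then a else 1 / of_int x :: real"
  have small: "\<bar>?d x\<bar> < 1" "?d x \<noteq> 0" if "x \<ge> 4" for x :: int using that by auto
  have big: "\<bar>?d x\<bar> > 1" "x = 1 \<or> x = 2 \<or> x = 3" if "1 \<le> x" "x < 4" for x :: int
  proof -
    show x: "x = 1 \<or> x = 2 \<or> x = 3" using that by linarith
    show "\<bar>?d x\<bar> > 1" using x assms by auto
  qed
  fix x :: int assume x: "1 \<le> x"
  show "?d x \<noteq> 0"
  proof (cases "x < 4")
    case True
    show ?thesis using big(1)[OF x True] by linarith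
  next
    case False
    thus ?thesis using small(2)[of x] by linarith
  qed
  fix y :: int assume y: "1 \<le> y" and eq: "\<bar>?d x\<bar> = \<bar>?d y\<bar>"
  have iff: "x < 4 \<longleftrightarrow> y < 4" using small(1)[of x] small(1)[of y] big(1)[OF x] big(1)[OF y] eq by linarith
  show "x = y"
  proof (cases "x < 4")
    case True
    thus ?thesis using big(2)[OF x] big(2)[OF y] iff eq assms by auto
  next
    case False
    thus ?thesis using iff eq by auto
  qed
qed

text \<open>
  With delta 1 = 3 and delta 2 = 2 as neighbouring points, eps1 can pass from 4 over 5/2 to 3/2:
  three positions, permuted cyclically.
\<close>

lemma odd_pair_pow_2:
  assumes "m \<ge> 2"
  obtains P :: "'k::field_char_0 weight set" where "positive_system m P"
    "((pos_act m (root_of 1 (- 2)) \<circ> pos_act m (root_of 1 (- 3))) ^^ 2) P \<noteq> P"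
proof
  let ?P = "\<lambda>e. pos_roots m (witness_functional 2 e) :: 'k weight set"
  have g: "generic m (witness_functional 2 4)" "generic m (witness_functional 2 (5/2))" "generic m (witness_functional 2 (3/2))"
    by (simp_all add: generic_witness_functional)
  have pr: "root_pair m 1 (- 2)" "root_pair m 1 (- 3)" using assms by (auto intro!: root_pairI)
  have cases: "x = 2 \<or> x = - 2 \<or> x = 3 \<or> x = - 3 \<or> 4 \<le> \<bar>x\<bar>" if "2 \<le> \<bar>x\<bar>" for x :: int
    using that by linarith
  have same: "witness_functional a e x = witness_functional a e' x" if "2 \<le> \<bar>x\<bar>" for a e e' x
    using cases[OF that] witness_functional_small(2)[of x a e e'] by auto
  have 1: "pos_act m (root_of 1 (- 3)) (?P 4) = ?P 4"
    by (rule pos_act_skip[OF g(1) pr(2), of 2]) (use assms in auto)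
  have 2: "pos_act m (root_of 1 (- 2)) (?P 4) = ?P (5/2)"
  proof (rule pos_act_cross[OF g(1,2) pr(1)])
    fix x :: int assume "2 \<le> \<bar>x\<bar>" "x \<noteq> - (- 2)"
    thus "\<not> (witness_functional 2 (5/2) 1 < witness_functional 2 4 x \<and> witness_functional 2 4 x < witness_functional 2 4 1)"
      using cases[of x] witness_functional_small(1)[of x 2 4] by auto
  qed (auto intro: same)
  have 3: "pos_act m (root_of 1 (- 3)) (?P (5/2)) = ?P (3/2)"
  proof (rule pos_act_cross[OF g(2,3) pr(2)])
    fix x :: int assume "2 \<le> \<bar>x\<bar>" "x \<noteq> - (- 3)"
    thus "\<not> (witness_functional 2 (3/2) 1 < witness_functional 2 (5/2) x \<and> witness_functional 2 (5/2) x < witness_functional 2 (5/2) 1)"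
      using cases[of x] witness_functional_small(1)[of x 2 "5/2"] by auto
  qed (auto intro: same)
  have 4: "pos_act m (root_of 1 (- 2)) (?P (3/2)) = ?P (3/2)"
    by (rule pos_act_skip[OF g(3) pr(1), of 3]) (use assms in auto)
  have "root_of 1 (- 2) \<in> ?P 4" "root_of 1 (- 2) \<notin> ?P (3/2)"
    by (simp_all add: root_of_in_pos_roots_iff[OF pr(1)])
  hence "?P (3/2) \<noteq> ?P 4" by blast
  thus "((pos_act m (root_of 1 (- 2)) \<circ> pos_act m (root_of 1 (- 3))) ^^ 2) (?P 4) \<noteq> ?P 4"
    by (simp add: numeral_2_eq_2 1 2 3 4)
  show "positive_system m (?P 4)" by (rule positive_system_pos_roots[OF g(1)])
qed

text \<open>
  With delta 1 = 3 and delta 2 = -2, the point 2 of \<open>- delta 2\<close> always separates eps1 from delta 2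
  as long as eps1 is at 4 or 5/2. So one of the two reflections is idle and the other exchanges these
  two positions.
\<close>

lemma odd_pair_pow_3:
  assumes "m \<ge> 2"
  obtains P :: "'k::field_char_0 weight set" where "positive_system m P"
    "((pos_act m (root_of 1 (- 2)) \<circ> pos_act m (root_of 1 (- 3))) ^^ 3) P \<noteq> P"
proof
  let ?P = "\<lambda>e. pos_roots m (witness_functional (- 2) e) :: 'k weight set"
  have g: "generic m (witness_functional (- 2) 4)" "generic m (witness_functional (- 2) (5/2))"
    by (simp_all add: generic_witness_functional)
  have pr: "root_pair m 1 (- 2)" "root_pair m 1 (- 3)" using assms by (auto intro!: root_pairI)
  have cases: "x = 2 \<or> x = - 2 \<or> x = 3 \<or> x = - 3 \<or> 4 \<le> \<bar>x\<bar>" if "2 \<le> \<bar>x\<bar>" for x :: int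
    using that by linarith
  have same: "witness_functional a e x = witness_functional a e' x" if "2 \<le> \<bar>x\<bar>" for a e e' x
    using cases[OF that] witness_functional_small(2)[of x a e e'] by auto
  have 1: "pos_act m (root_of 1 (- 3)) (?P 4) = ?P 4"
    by (rule pos_act_skip[OF g(1) pr(2), of "- 3"]) (use assms in auto)
  have 2: "pos_act m (root_of 1 (- 3)) (?P (5/2)) = ?P (5/2)"
    by (rule pos_act_skip[OF g(2) pr(2), of "- 3"]) (use assms in auto)
  have 3: "pos_act m (root_of 1 (- 2)) (?P 4) = ?P (5/2)"
  proof (rule pos_act_cross[OF g(1,2) pr(1)])
    fix x :: int assume "2 \<le> \<bar>x\<bar>" "x \<noteq> - (- 2)"
    thus "\<not> (witness_functional (- 2) (5/2) 1 < witness_functional (- 2) 4 x \<and> witness_functional (- 2) 4 x < witness_functional (- 2) 4 1)"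
      using cases[of x] witness_functional_small(1)[of x "- 2" 4] by auto
  qed (auto intro: same)
  show pos: "positive_system m (?P 4)" by (rule positive_system_pos_roots[OF g(1)])
  have 4: "pos_act m (root_of 1 (- 2)) (?P (5/2)) = ?P 4"
    using pos_act_involutive[OF _ pos root_of_in_roots[OF pr(1)]] assms unfolding 3 by simp
  have "root_of 1 (- 2) \<in> ?P 4" "root_of 1 (- 2) \<notin> ?P (5/2)"
    by (simp_all add: root_of_in_pos_roots_iff[OF pr(1)])
  hence "?P (5/2) \<noteq> ?P 4" by blast
  thus "((pos_act m (root_of 1 (- 2)) \<circ> pos_act m (root_of 1 (- 3))) ^^ 3) (?P 4) \<noteq> ?P 4"
    by (simp add: numeral_3_eq_3 1 2 3 4)
qed

section \<open>The exponents of the chain\<close>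

definition chain_gen :: "nat \<Rightarrow> nat \<Rightarrow> 'k::field borel_map" where
  "chain_gen m i = rhat m (chain_root m i)"

text \<open>
  The type argument fixes the ground field, which does not occur in the value.
\<close>

definition chain_ord :: "nat \<Rightarrow> 'k::field_char_0 itself \<Rightarrow> nat \<Rightarrow> nat \<Rightarrow> nat" where
  "chain_ord m _ i j = group.ord (super_Weyl_group m) ((chain_gen m i :: 'k borel_map) \<otimes>\<^bsub>super_Weyl_group m\<^esub> chain_gen m j)"

context
  fixes m :: nat and K :: "'k::field_char_0 itself"
  assumes m: "m \<ge> 2"
begin

private lemma m1: "m \<ge> 1" using m by simp

lemma chain_gen_inj: "inj_on (chain_gen m :: nat \<Rightarrow> 'k borel_map) {1..m + 1}"
proof (rule linorder_inj_onI')
  fix i j assume ij: "i \<in> {1..m + 1}" "j \<in> {1..m + 1}" "i < j"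
  let ?P = "pos_roots m (standard_functional m) :: 'k weight set"
  have P: "positive_system m ?P" by (rule positive_system_pos_roots[OF generic_standard_functional])
  note r = chain_root_in_roots[OF m1 ij(1), where 'a='k] chain_root_in_roots[OF m1 ij(2), where 'a='k]
  have "pos_act m (chain_root m i) ?P \<noteq> pos_act m (chain_root m j) ?P"
    using chain_roots_separated[OF m1, of i j, where 'k='k] ij by auto
  hence "simple_roots (pos_act m (chain_root m i) ?P) \<noteq> simple_roots (pos_act m (chain_root m j) ?P)"
    using simple_roots_inj[OF m1 pos_act_positive[OF m1 P r(1)] pos_act_positive[OF m1 P r(2)]] by blast
  thus "chain_gen m i \<noteq> (chain_gen m j :: 'k borel_map)"
    unfolding chain_gen_def rhat_simple_roots[OF m1 P r(1), symmetric] rhat_simple_roots[OF m1 P r(2), symmetric] by metis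
qed

lemma chain_ord_dvd_iff:
  assumes "i \<in> {1..m + 1}" "j \<in> {1..m + 1}"
  shows "chain_ord m K i j dvd n \<longleftrightarrow> (\<forall>P :: 'k weight set. positive_system m P \<longrightarrow>
    ((pos_act m (chain_root m i) \<circ> pos_act m (chain_root m j)) ^^ n) P = P)"
  unfolding chain_ord_def chain_gen_def
  by (rule ord_dvd_iff[OF m1 refl chain_root_in_roots[OF m1 assms(1)] chain_root_in_roots[OF m1 assms(2)]])

lemma chain_ord_commute:
  assumes "i \<in> {1..m + 1}" "j \<in> {1..m + 1}"
  shows "chain_ord m K j i = chain_ord m K i j"
  unfolding chain_ord_def chain_gen_def
  by (rule ord_commute[OF m1 refl chain_root_in_roots[OF m1 assms(1)] chain_root_in_roots[OF m1 assms(2)]])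

lemma chain_ord_neq_1:
  assumes "1 \<le> i" "i < j" "j \<le> m + 1"
  shows "\<not> chain_ord m K i j dvd 1"
proof
  assume d: "chain_ord m K i j dvd 1"
  have ij: "i \<in> {1..m + 1}" "j \<in> {1..m + 1}" using assms by auto
  let ?P = "pos_roots m (standard_functional m) :: 'k weight set"
  have P: "positive_system m ?P" by (rule positive_system_pos_roots[OF generic_standard_functional])
  have "pos_act m (chain_root m i) (pos_act m (chain_root m j) ?P) = ?P"
    using d P unfolding chain_ord_dvd_iff[OF ij] by force
  hence "pos_act m (chain_root m i) ?P = pos_act m (chain_root m j) ?P"
    using pos_act_involutive[OF m1 pos_act_positive[OF m1 P chain_root_in_roots[OF m1 ij(2)]] chain_root_in_roots[OF m1 ij(1)]]
    by simp
  thus False using chain_roots_separated[OF m1 assms, where 'k='k] by metis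
qed

lemma chain_ord_even_dvd:
  assumes "2 \<le> i" "i < j" "j \<le> m + 1" "\<And>x. ((chain_refl m j \<circ> chain_refl m i) ^^ n) x = x"
  shows "chain_ord m K i j dvd n"
proof -
  have ij: "i \<in> {1..m + 1}" "j \<in> {1..m + 1}" "i \<in> {2..m + 1}" "j \<in> {2..m + 1}" using assms by auto
  show ?thesis unfolding chain_ord_dvd_iff[OF ij(1,2)]
  proof (intro allI impI)
    fix P :: "'k weight set" assume "positive_system m P"
    then obtain c where c: "generic m c" "P = pos_roots m c" using positive_systemE m1 by metis
    have "c \<circ> (chain_refl m j \<circ> chain_refl m i) ^^ n = c" using assms(4) by (simp add: fun_eq_iff)
    thus "((pos_act m (chain_root m i) \<circ> pos_act m (chain_root m j)) ^^ n) P = P"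
      unfolding c(2) even_chain_pow[OF m1 ij(3,4) c(1)] by simp
  qed
qed

lemma chain_ord_far:
  assumes "1 \<le> i" "i + 2 \<le> j" "j \<le> m + 1"
  shows "chain_ord m K i j = 2"
proof -
  have ij: "i \<in> {1..m + 1}" "j \<in> {1..m + 1}" "j \<in> {2..m + 1}" using assms by auto
  have "chain_ord m K i j dvd 2"
  proof (cases "i = 1")
    case False
    have "((chain_refl m j \<circ> chain_refl m i) ^^ 2) x = x" for x
      using assms chain_refl_commute[OF assms, of "chain_refl m i x"]
      by (simp add: numeral_2_eq_2 chain_refl_involutive)
    thus ?thesis using assms False by (intro chain_ord_even_dvd) auto
  next
    case True
    let ?\<gamma> = "chain_root m 1 :: 'k weight" and ?\<alpha> = "chain_root m j :: 'k weight"
    note \<gamma> = chain_root_odd[OF m1, where 'k='k]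
    note r = chain_root_in_roots[OF m1 ij(1), where 'a='k] chain_root_in_roots[OF m1 ij(2), where 'a='k]
    have e: "?\<alpha> \<in> even_roots m" by (rule chain_root_even[OF m1 ij(3)])
    have "root_pair m 1 (- 2)" using m by (intro root_pairI) auto
    hence "reflection m ?\<alpha> ?\<gamma> = root_of (chain_refl m j 1) (chain_refl m j (- 2))"
      unfolding \<gamma>(1) using chain_root_pair[OF m1 ij(2)] assms(2) unfolding chain_root_def chain_refl_def
      by (intro reflection_root_of) auto
    also have "\<dots> = ?\<gamma>" unfolding \<gamma>(1) using assms True by (simp add: chain_refl_fixes)
    finally have fixd: "reflection m ?\<alpha> ?\<gamma> = ?\<gamma>" .
    show ?thesis unfolding chain_ord_dvd_iff[OF ij(1,2)]
    proof (intro allI impI)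
      fix P :: "'k weight set" assume P: "positive_system m P"
      note P' = pos_act_positive[OF m1 P r(2)]
      have "pos_act m ?\<alpha> (pos_act m ?\<gamma> (pos_act m ?\<alpha> P)) = pos_act m ?\<gamma> P"
        unfolding pos_act_conjugate[OF m1 P' e \<gamma>(2)] fixd pos_act_involutive[OF m1 P r(2)] ..
      thus "((pos_act m (chain_root m i) \<circ> pos_act m (chain_root m j)) ^^ 2) P = P"
        using pos_act_involutive[OF m1 P r(1)] True by (simp add: numeral_2_eq_2)
    qed
  qed
  moreover have "\<not> chain_ord m K i j dvd 1" using assms by (intro chain_ord_neq_1) auto
  ultimately show ?thesis using two_is_prime_nat unfolding prime_nat_iff by auto
qed

lemma chain_ord_3:
  assumes "2 \<le> i" "i + 1 \<le> m"
  shows "chain_ord m K i (i + 1) = 3"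
proof -
  have 3: "chain_ord m K i (i + 1) dvd 3" using assms by (intro chain_ord_even_dvd chain_refl_order_3) auto
  moreover have "\<not> chain_ord m K i (i + 1) dvd 1" using assms by (intro chain_ord_neq_1) auto
  moreover have "chain_ord m K i (i + 1) \<le> 3" using 3 by (rule dvd_imp_le) simp
  hence "chain_ord m K i (i + 1) \<in> {0, 1, 2, 3}" by auto
  ultimately show ?thesis using 3 by auto
qed

lemma chain_ord_4: "chain_ord m K m (m + 1) = 4"
proof -
  have ij: "m \<in> {1..m + 1}" "m + 1 \<in> {1..m + 1}" "m \<in> {2..m + 1}" "m + 1 \<in> {2..m + 1}" using m by auto
  have 4: "chain_ord m K m (m + 1) dvd 4"
    using m by (intro chain_ord_even_dvd chain_refl_order_4) auto
  have "\<not> chain_ord m K m (m + 1) dvd 2"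
  proof
    assume d: "chain_ord m K m (m + 1) dvd 2"
    let ?P = "pos_roots m (standard_functional m) :: 'k weight set"
    have P: "positive_system m ?P" by (rule positive_system_pos_roots[OF generic_standard_functional])
    have "(pos_roots m (standard_functional m \<circ> (chain_refl m (m + 1) \<circ> chain_refl m m) ^^ 2) :: 'k weight set) = ?P"
      using d P unfolding chain_ord_dvd_iff[OF ij(1,2)]
      unfolding even_chain_pow[OF m1 ij(3,4) generic_standard_functional, symmetric] by blast
    moreover have pr: "root_pair m (int m + 1) (int m + 1)" using m by (intro root_pairI) auto
    have "root_of (int m + 1) (int m + 1) \<in> ?P" by (simp add: root_of_in_pos_roots_iff[OF pr] standard_functional_pos)
    moreover have "root_of (int m + 1) (int m + 1) \<notin>
      (pos_roots m (standard_functional m \<circ> (chain_refl m (m + 1) \<circ> chain_refl m m) ^^ 2) :: 'k weight set)"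
      unfolding root_of_in_pos_roots_iff[OF pr] comp_apply chain_refl_order_4(2)[OF m1] genericD(1)[OF generic_standard_functional]
      by (simp add: standard_functional_pos)
    ultimately show False by blast
  qed
  moreover have "chain_ord m K m (m + 1) \<le> 4" using 4 by (rule dvd_imp_le) simp
  hence "chain_ord m K m (m + 1) \<in> {0, 1, 2, 3, 4}" by auto
  ultimately show ?thesis using 4 by auto
qed

text \<open>
  The square of r s is the product of two odd reflections, so the even powers of r s are powers of
  that product.
\<close>

lemma chain_ord_12: "chain_ord m K 1 2 = 12"
proof -
  have ij: "1 \<in> {1..m + 1}" "2 \<in> {1..m + 1}" "2 \<in> {2..m + 1}" using m by auto
  define \<gamma> where "\<gamma> = (chain_root m 1 :: 'k weight)"
  define \<alpha> where "\<alpha> = (chain_root m 2 :: 'k weight)"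
  define \<gamma>' where "\<gamma>' = (root_of 1 (- 3) :: 'k weight)"
  define f where "f = pos_act m \<gamma> \<circ> pos_act m \<alpha>"
  define T where "T = pos_act m \<gamma> \<circ> pos_act m \<gamma>'"
  note r = chain_root_in_roots[OF m1 ij(1), where 'a='k, folded \<gamma>_def] chain_root_in_roots[OF m1 ij(2), where 'a='k, folded \<alpha>_def]
  note \<gamma> = chain_root_odd[OF m1, where 'k='k, folded \<gamma>_def]
  have \<alpha>: "\<alpha> = root_of 2 (- 3)" "\<alpha> \<in> even_roots m"
    using m chain_root_even[OF m1 ij(3), where 'a='k] by (simp_all add: \<alpha>_def chain_root_def)
  have pr: "root_pair m 1 (- 2)" "root_pair m 1 (- 3)" "root_pair m 2 (- 3)" using m by (auto intro!: root_pairI)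
  have \<gamma>': "\<gamma>' \<in> odd_roots m" unfolding \<gamma>'_def odd_roots_eq using pr(2) by fastforce
  have refl: "reflection m \<alpha> \<gamma> = \<gamma>'"
    unfolding \<alpha>(1) \<gamma>(1) \<gamma>'_def using reflection_root_of[OF pr(3) _ _ pr(1), where 'k='k] by (simp add: refl_perm_def)
  have "\<gamma>' - \<gamma> = \<alpha>" unfolding \<gamma>'_def \<gamma>(1) \<alpha>(1) by (simp add: root_of_def)
  hence T6: "(T ^^ 6) P = P" if "positive_system m P" for P
    unfolding T_def using two_odd_reflections_order[OF m1 \<gamma>(2) \<gamma>' _ that] r(2) by simp
  have ff: "f (f P) = T P" if P: "positive_system m P" for P
  proof -
    note P' = pos_act_positive[OF m1 P r(2)]
    show ?thesis unfolding f_def T_def comp_apply pos_act_conjugate[OF m1 P' \<alpha>(2) \<gamma>(2)] refl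
        pos_act_involutive[OF m1 P r(2)] ..
  qed
  have T_pos: "positive_system m (T P)" if "positive_system m P" for P
    unfolding T_def comp_apply using that \<gamma>' odd_subset_roots r m1 by (intro pos_act_positive) auto
  have even_pow: "(f ^^ (2 * k)) P = (T ^^ k) P" if "positive_system m P" for k P
    using that
  proof (induction k arbitrary: P)
    case (Suc k)
    have "(f ^^ (2 * Suc k)) P = (f ^^ (2 * k)) (f (f P))"
      by (simp add: funpow_Suc_right del: funpow.simps)
    thus ?case using Suc.IH[OF T_pos[OF Suc.prems]] by (simp add: ff[OF Suc.prems] funpow_Suc_right del: funpow.simps)
  qed simp
  have dvd: "chain_ord m K 1 2 dvd 2 * k \<longleftrightarrow> (\<forall>P. positive_system m P \<longrightarrow> (T ^^ k) P = P)" for k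
    unfolding chain_ord_dvd_iff[OF ij(1,2)] \<gamma>_def[symmetric] \<alpha>_def[symmetric] f_def[symmetric]
    using even_pow by simp
  have 12: "chain_ord m K 1 2 dvd 12" using dvd[of 6] T6 by simp
  have n4: "\<not> chain_ord m K 1 2 dvd 4"
  proof
    assume "chain_ord m K 1 2 dvd 4"
    hence fixd: "\<forall>P. positive_system m P \<longrightarrow> (T ^^ 2) P = P" using dvd[of 2] by simp
    obtain P where "positive_system m P" "(T ^^ 2) P \<noteq> P"
      unfolding T_def \<gamma>(1) \<gamma>'_def by (rule odd_pair_pow_2[OF m])
    thus False using fixd by blast
  qed
  have n6: "\<not> chain_ord m K 1 2 dvd 6"
  proof
    assume "chain_ord m K 1 2 dvd 6"
    hence fixd: "\<forall>P. positive_system m P \<longrightarrow> (T ^^ 3) P = P" using dvd[of 3] by simp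
    obtain P where "positive_system m P" "(T ^^ 3) P \<noteq> P"
      unfolding T_def \<gamma>(1) \<gamma>'_def by (rule odd_pair_pow_3[OF m])
    thus False using fixd by blast
  qed
  have "chain_ord m K 1 2 \<le> 12" using 12 by (rule dvd_imp_le) simp
  moreover have "k = 0 \<or> k = 1 \<or> k = 2 \<or> k = 3 \<or> k = 4 \<or> k = 5 \<or> k = 6 \<or> k = 7 \<or> k = 8 \<or> k = 9 \<or>
    k = 10 \<or> k = 11 \<or> k = 12" if "k \<le> 12" for k :: nat
    using that by presburger
  ultimately have "chain_ord m K 1 2 \<in> {0, 1, 2, 3, 4, 5, 6, 7, 8, 9, 10, 11, 12}" by blast
  thus ?thesis using 12 n4 n6 by auto
qed

lemma chain_ord_eq:
  assumes "1 \<le> i" "i < j" "j \<le> m + 1"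
  shows "chain_ord m K i j = (if j \<noteq> i + 1 then 2 else if i = 1 then 12 else if j = m + 1 then 4 else 3)"
proof (cases "j = i + 1")
  case False
  thus ?thesis using chain_ord_far[of i j] assms by simp
next
  case True
  consider "i = 1" | "i \<ge> 2" "j = m + 1" | "i \<ge> 2" "i + 1 \<le> m" using assms True by linarith
  thus ?thesis
  proof cases
    case 1
    thus ?thesis using True chain_ord_12 by (simp add: numeral_2_eq_2)
  next
    case 2
    thus ?thesis using True chain_ord_4 by simp
  next
    case 3
    thus ?thesis using True chain_ord_3[of i] by simp
  qed
qed

end

section \<open>The Coxeter graph\<close>

lemma chain_root_weights:
  assumes "m \<ge> 1"
  shows "eps1 - delta 1 = (chain_root m 1 :: 'k::field weight)"
    and "i \<in> {1..<m} \<Longrightarrow> delta i - delta (i + 1) = (chain_root m (i + 1) :: 'k weight)"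
    and "smul 2 (delta m) = (chain_root m (m + 1) :: 'k weight)"
proof -
  show "eps1 - delta 1 = (chain_root m 1 :: 'k weight)"
    unfolding chain_root_odd(1)[OF assms] by (simp add: root_of_def unit_weight_def eps1_def delta_def smul_def fun_eq_iff)
  show "delta i - delta (i + 1) = (chain_root m (i + 1) :: 'k weight)" if "i \<in> {1..<m}"
    using that by (simp add: chain_root_def root_of_def unit_weight_def delta_def smul_def fun_eq_iff nat_add_distrib)
  show "smul 2 (delta m) = (chain_root m (m + 1) :: 'k weight)"
    by (simp add: chain_root_def root_of_def unit_weight_def delta_def smul_def fun_eq_iff)
qed

lemma standard_system_chain:
  assumes "m \<ge> 1"
  shows "rhat m ` standard_system m = (chain_gen m ` {1..m + 1} :: 'k::field_char_0 borel_map set)"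
proof -
  have "{delta i - delta (i + 1) | i. i \<in> {1..<m}} = ((\<lambda>i. delta i - delta (i + 1)) ` {1..<m} :: 'k weight set)"
    by (rule Setcompr_eq_image)
  also have "\<dots> = (\<lambda>i. chain_root m (i + 1)) ` {1..<m}"
    by (rule image_cong[OF refl]) (rule chain_root_weights(2)[OF assms])
  also have "\<dots> = chain_root m ` ((\<lambda>i. i + 1) ` {1..<m})" by (rule image_image[symmetric])
  also have "(\<lambda>i. i + 1) ` {1..<m} = {2..m}" unfolding image_add_atLeastLessThan' by auto
  finally have "{delta i - delta (i + 1) | i. i \<in> {1..<m}} = (chain_root m ` {2..m} :: 'k weight set)" .
  hence "standard_system m = (chain_root m ` ({1} \<union> {2..m} \<union> {m + 1}) :: 'k weight set)"
    unfolding standard_system_def chain_root_weights(1,3)[OF assms] by simp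
  also have "{1} \<union> {2..m} \<union> {m + 1} = {1..m + 1}" using assms by auto
  finally show ?thesis by (simp add: chain_gen_def[abs_def] image_image)
qed

text \<open>
  This identifies the generator of \<open>delta 1 - eps1\<close> at the end of the chain with that of the simple
  root \<open>eps1 - delta 1\<close>.
\<close>

lemma rhat_uminus:
  assumes "m \<ge> 1" "(\<theta> :: 'k::field_char_0 weight) \<in> odd_roots m"
  shows "rhat m (- \<theta>) = rhat m \<theta>"
proof -
  have "\<theta> \<notin> even_roots m" "- \<theta> \<notin> even_roots m"
    using even_odd_disjoint[of m, where 'k='k] assms(2) odd_roots_uminus by blast+
  moreover have "\<not> (\<theta> \<in> B \<and> - \<theta> \<in> B)" if "B \<in> Borels m" for B
  proof -
    obtain P where P: "B = simple_roots P" "positive_system m P" using \<open>B \<in> Borels m\<close> unfolding Borels_def by blast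
    have "\<theta> \<in> roots m" using assms(2) odd_subset_roots by blast
    thus ?thesis using pos_uminus_iff[OF assms(1) P(2)] simple_rootsD(1)[of _ P] P(1) by blast
  qed
  ultimately show ?thesis by (auto simp: rhat_def fun_eq_iff restrict_def)
qed

lemma chain_vertices_eq:
  assumes "m \<ge> 2"
  shows "chain_vertices m = (map (chain_gen m) (rev [1..<m + 2]) :: 'k::field_char_0 borel_map list)"
proof -
  have m1: "m \<ge> 1" using assms by simp
  have "delta 1 - eps1 = (- chain_root m 1 :: 'k weight)"
    unfolding chain_root_weights(1)[OF m1, symmetric] by simp
  hence 1: "rhat m (delta 1 - eps1) = (chain_gen m 1 :: 'k borel_map)"
    using rhat_uminus[OF m1 chain_root_odd(2)[OF m1, where 'k='k]] by (simp add: chain_gen_def)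
  have 2: "rhat m (delta i - delta (i + 1)) = (chain_gen m (i + 1) :: 'k borel_map)" if "i \<in> {1..<m}" for i
    unfolding chain_gen_def chain_root_weights(2)[OF m1 that] ..
  have 3: "rhat m (smul 2 (delta m)) = (chain_gen m (m + 1) :: 'k borel_map)"
    unfolding chain_gen_def chain_root_weights(3)[OF m1] ..
  have "rev [1..<m + 2] = (m + 1) # map (\<lambda>i. i + 1) (rev [1..<m]) @ [1]"
  proof -
    have "[1..<m + 2] = 1 # map Suc [1..<m] @ [m + 1]"
      using assms by (simp add: map_Suc_upt upt_conv_Cons)
    thus ?thesis by (simp add: rev_map)
  qed
  hence "map (chain_gen m) (rev [1..<m + 2]) =
    (chain_gen m (m + 1) :: 'k borel_map) # map (\<lambda>i. chain_gen m (i + 1)) (rev [1..<m]) @ [chain_gen m 1]"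
    by simp
  moreover have "map (\<lambda>i. rhat m (delta i - delta (i + 1))) (rev [1..<m]) =
    (map (\<lambda>i. chain_gen m (i + 1)) (rev [1..<m]) :: 'k borel_map list)"
    using 2 by (intro map_cong refl) simp
  ultimately show ?thesis unfolding chain_vertices_def 1 3 by simp
qed

theorem theorem4p9:
  fixes m :: nat
  assumes "m \<ge> 2"
  shows "distinct (chain_vertices m :: 'k::{alg_closed_field, field_char_0} borel_map list) \<and>
    Coxeter_graph (super_Coxeter_group m :: 'k borel_map coxeter_presentation) =
    chain_graph (chain_vertices m) (4 # replicate (m - 2) 3 @ [12])"
proof
  have m1: "m \<ge> 1" using assms by simp
  let ?x = "chain_gen m :: nat \<Rightarrow> 'k borel_map"
  let ?C = "super_Coxeter_group m :: 'k borel_map coxeter_presentation"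
  let ?e = "exponents ?C"
  let ?vs = "chain_vertices m :: 'k borel_map list"
  let ?ls = "4 # replicate (m - 2) 3 @ [12] :: nat list"
  note inj = chain_gen_inj[OF assms, where 'k='k]
  have vs: "?vs = map ?x (rev [1..<m + 2])" by (rule chain_vertices_eq[OF assms])
  have set: "set (rev [1..<m + 2]) = {1..m + 1}" by auto
  show "distinct ?vs" unfolding vs distinct_map set using inj by simp
  have gens: "generators ?C = ?x ` {1..m + 1}"
    by (simp add: super_Coxeter_group_def standard_system_chain[OF m1])
  have e_ord: "?e (?x i) (?x j) = chain_ord m TYPE('k) i j" for i j
    by (simp add: super_Coxeter_group_def chain_ord_def)
  have e_sym: "?e (?x j) (?x i) = ?e (?x i) (?x j)" if "i \<in> {1..m + 1}" "j \<in> {1..m + 1}" for i j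
    unfolding e_ord by (rule chain_ord_commute[OF assms that])
  have e: "?e (?x i) (?x j) = (if j \<noteq> i + 1 then 2 else if i = 1 then 12 else if j = m + 1 then 4 else 3)"
    if "1 \<le> i" "i < j" "j \<le> m + 1" for i j
    unfolding e_ord by (rule chain_ord_eq[OF assms that])
  \<comment> \<open>The label between the k-th and the (k+1)-st generator; the list of vertices runs backwards.\<close>
  define lab where "lab k = (if k = 1 then 12 else if k = m then 4 else 3 :: nat)" for k
  have adj: "?e (?x k) (?x (k + 1)) = lab k" if "k \<in> {1..m}" for k
    using e[of k "k + 1"] that by (simp add: lab_def)
  have pairs: "{({x, y}, ?e x y) | x y. x \<in> generators ?C \<and> y \<in> generators ?C \<and> x \<noteq> y \<and> ?e x y \<ge> n} =
      {({?x k, ?x (k + 1)}, lab k) | k. k \<in> {1..m} \<and> lab k \<ge> n}" (is "?L = ?R") if "n \<ge> 3" for n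
  proof (intro equalityI subsetI)
    fix z assume "z \<in> ?L"
    then obtain i j where ij: "i \<in> {1..m + 1}" "j \<in> {1..m + 1}" "z = ({?x i, ?x j}, ?e (?x i) (?x j))"
      "?x i \<noteq> ?x j" "?e (?x i) (?x j) \<ge> n" unfolding gens by blast
    define a b where "a = min i j" and "b = max i j"
    have ab: "1 \<le> a" "a < b" "b \<le> m + 1" using ij by (auto simp: a_def b_def min_def max_def)
    have z: "z = ({?x a, ?x b}, ?e (?x a) (?x b))" "?e (?x a) (?x b) \<ge> n"
      using ij e_sym[OF ij(1,2)] by (auto simp: a_def b_def min_def max_def insert_commute)
    have b: "b = a + 1" using z(2) e[OF ab] that by (auto split: if_splits)
    have "a \<in> {1..m}" using ab by simp
    thus "z \<in> ?R" using z adj[of a] b by auto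
  next
    fix z assume "z \<in> ?R"
    then obtain k where k: "k \<in> {1..m}" "z = ({?x k, ?x (k + 1)}, lab k)" "lab k \<ge> n" by blast
    have "?x k \<noteq> ?x (k + 1)" using inj_onD[OF inj, of k "k + 1"] k(1) by auto
    moreover have "?x k \<in> generators ?C" "?x (k + 1) \<in> generators ?C" using k(1) unfolding gens by auto
    ultimately show "z \<in> ?L" using adj[OF k(1)] k(2,3) by force
  qed
  have nth: "?vs ! i = ?x (m + 1 - i)" if "i < m + 1" for i
    using that by (simp add: vs rev_nth Suc_diff_le del: upt_Suc)
  have len: "length ?vs = m + 1" by (simp add: vs)
  have ls: "?ls ! i = lab (m - i)" if "i < m" for i
    using that assms by (cases i) (auto simp: lab_def nth_append)
  have reindex: "{({?vs ! i, ?vs ! (i + 1)}, ?ls ! i) | i. i + 1 < length ?vs \<and> Q (?ls ! i)} =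
      {({?x k, ?x (k + 1)}, lab k) | k. k \<in> {1..m} \<and> Q (lab k)}" (is "?L = ?R") for Q
  proof (intro equalityI subsetI)
    fix z assume "z \<in> ?L"
    then obtain i where i: "i < m" "z = ({?vs ! i, ?vs ! (i + 1)}, ?ls ! i)" "Q (?ls ! i)" unfolding len by auto
    have idx: "m + 1 - i = m - i + 1" "m + 1 - (i + 1) = m - i" "m - i \<in> {1..m}" using i(1) by auto
    have "?vs ! i = ?x (m - i + 1)" unfolding idx(1)[symmetric] using i(1) by (intro nth) simp
    moreover have "?vs ! (i + 1) = ?x (m - i)" unfolding idx(2)[symmetric] using i(1) by (intro nth) simp
    ultimately have "z = ({?x (m - i), ?x (m - i + 1)}, lab (m - i))" "Q (lab (m - i))"
      using i(2,3) ls[OF i(1)] by (simp_all only: insert_commute)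
    thus "z \<in> ?R" using idx(3) by blast
  next
    fix z assume "z \<in> ?R"
    then obtain k where k: "k \<in> {1..m}" "z = ({?x k, ?x (k + 1)}, lab k)" "Q (lab k)" by blast
    have i: "m - k < m" "m + 1 - (m - k) = k + 1" "m + 1 - (m - k + 1) = k" "m - (m - k) = k" using k(1) by auto
    hence "z = ({?vs ! (m - k), ?vs ! (m - k + 1)}, ?ls ! (m - k)) \<and> m - k + 1 < length ?vs \<and> Q (?ls ! (m - k))"
      using k nth[of "m - k"] nth[of "m - k + 1"] ls[of "m - k"] len by (simp add: insert_commute)
    thus "z \<in> ?L" by blast
  qed
  have lab3: "lab k \<ge> 3" "lab k \<ge> 4 \<longleftrightarrow> lab k \<noteq> 3" for k by (auto simp: lab_def)
  have labels: "{({x, y}, ?e x y) | x y. x \<in> generators ?C \<and> y \<in> generators ?C \<and> x \<noteq> y \<and> ?e x y \<ge> 4} =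
    {({?vs ! i, ?vs ! (i + 1)}, ?ls ! i) | i. i + 1 < length ?vs \<and> ?ls ! i \<noteq> 3}"
    using pairs[of 4] reindex[of "\<lambda>l. l \<noteq> 3"] lab3(2) by simp
  have "fst ` {({x, y}, ?e x y) | x y. x \<in> generators ?C \<and> y \<in> generators ?C \<and> x \<noteq> y \<and> ?e x y \<ge> 3} =
    fst ` {({?vs ! i, ?vs ! (i + 1)}, ?ls ! i) | i. i + 1 < length ?vs \<and> True}"
    using pairs[of 3] reindex[of "\<lambda>l. True"] lab3(1) by simp
  moreover have "fst ` {(f x y, g x y) | x y. R x y} = {f x y | x y. R x y}"
    for f :: "'k borel_map \<Rightarrow> 'k borel_map \<Rightarrow> 'k borel_map set" and g :: "_ \<Rightarrow> _ \<Rightarrow> nat" and R by force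
  moreover have "fst ` {(f i, g i) | i. R i} = {f i | i. R i}"
    for f :: "nat \<Rightarrow> 'k borel_map set" and g :: "_ \<Rightarrow> nat" and R by force
  ultimately have edges: "{{x, y} | x y. x \<in> generators ?C \<and> y \<in> generators ?C \<and> x \<noteq> y \<and> ?e x y \<ge> 3} =
    {{?vs ! i, ?vs ! (i + 1)} | i. i + 1 < length ?vs}"
    by simp
  have "generators ?C = set ?vs" unfolding gens vs set_map set ..
  thus "Coxeter_graph ?C = chain_graph ?vs ?ls"
    unfolding Coxeter_graph_def chain_graph_def labels edges by simp
qed

end
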